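(* Let $D\geq 2$ and let $f:\widehat{\mathbb C}\to\widehat{\mathbb C}$ be a postcritically finite rational map of degree $D$. Let $\Lambda_f$ be the set of eigenvalues of the induced operator $f_*:\mathcal Q(\widehat{\mathbb C})/\mathcal Q_f\to \mathcal Q(\widehat{\mathbb C})/\mathcal Q_f$. Then $\Lambda_f$ consists of $0$ and of the complex numbers $\lambda\in\mathbb C\setminus\{0\}$ such that, for some $m\geq 1$, $1/\lambda^m$ is the multiplier of a cycle of $f$ of period $m$ which is not contained in $\mathcal P_f$. Moreover, if $\lambda\in\Lambda_f\setminus\{0\}$, then $\lambda$ is an algebraic number but not an algebraic integer.
   Context: $\widehat{\mathbb C}$ is the Riemann sphere. For a rational map $f$ with critical set $\mathcal C_f$, the postcritical set is $\mathcal P_f=\bigcup_{n\geq1}f^{\circ n}(\mathcal C_f)$; $f$ is postcritically finite if $\mathcal P_f$ is finite. The multiplier of a cycle of period $m$ is the eigenvalue of $\mathrm D_xf^{\circ m}:\mathrm T_x\widehat{\mathbb C}\to \mathrm T_x\widehat{\mathbb C}$ for $x$ in the cycle. A meromorphic quadratic differential on $\widehat{\mathbb C}$ is $\mathbf q=q(z)\,(\mathrm dz)^2$ with $q$ a rational function (orders of zeros and poles at $\infty$ are computed in the coordinate $w=1/z$, so $(\mathrm dz)^2$ has a pole of order $4$ at $\infty$). $\mathcal Q(\widehat{\mathbb C})$ is the complex vector space of meromorphic quadratic differentials on $\widehat{\mathbb C}$ with at worst simple poles. The subspace $\mathcal Q_f\subset\mathcal Q(\widehat{\mathbb C})$ consists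 of those whose poles are contained in $\mathcal P_f$. The pushforward operator is $f_*\mathbf q=r\,(\mathrm dz)^2$ with $r(y)=\sum_{x\in f^{-1}(y)}\frac{q(x)}{f'(x)^2}$ (for generic $y$; this extends to a meromorphic quadratic differential). It maps $\mathcal Q(\widehat{\mathbb C})$ to itself and $\mathcal Q_f$ to itself. An eigenvalue of a linear endomorphism is a scalar for which there is a nonzero eigenvector. *)

theory Defs
  imports
    "HOL-Complex_Analysis.Complex_Analysis"
    "HOL-Computational_Algebra.Computational_Algebra"
    "HOL-Computational_Algebra.Field_as_Ring"
begin

section \<open>The Riemann sphere and rational maps\<close>

text \<open>The sphere is the one-point compactification of the complex plane; \<^const>\<open>None\<close> is the point
  at infinity.\<close>

type_synonym sphere = "complex option"

definition rat_map :: "complex poly \<Rightarrow> complex poly \<Rightarrow> sphere \<Rightarrow> sphere" where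
  "rat_map p q x =
     (case x of
        Some z \<Rightarrow> if poly q z = 0 then None else Some (poly p z / poly q z)
      | None \<Rightarrow> if degree p > degree q then None
                else Some (coeff p (degree q) / lead_coeff q))"

definition rational_map :: "nat \<Rightarrow> (sphere \<Rightarrow> sphere) \<Rightarrow> bool" where
  "rational_map D f \<longleftrightarrow>
     (\<exists>p q. q \<noteq> 0 \<and> coprime p q \<and> max (degree p) (degree q) = D \<and> f = rat_map p q)"

text \<open>\<open>chart a\<close> is the standard coordinate near \<open>a\<close>: the coordinate \<open>z\<close> if \<open>a\<close> is finite and
  \<open>w = 1/z\<close> if \<open>a\<close> is infinity. Its value at the single point outside its domain (infinity,
  respectively the origin) is a dummy. \<open>chart_inv a\<close> is the inverse parametrization.\<close>

definition chart :: "sphere \<Rightarrow> sphere \<Rightarrow> complex" where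
  "chart a x =
     (case a of
        Some _ \<Rightarrow> (case x of Some z \<Rightarrow> z | None \<Rightarrow> 0)
      | None \<Rightarrow> (case x of Some z \<Rightarrow> 1 / z | None \<Rightarrow> 0))"

definition chart_inv :: "sphere \<Rightarrow> complex \<Rightarrow> sphere" where
  "chart_inv a t =
     (case a of
        Some _ \<Rightarrow> Some t
      | None \<Rightarrow> if t = 0 then None else Some (1 / t))"

text \<open>The derivative of \<open>f\<close> at \<open>x\<close>, that is, the one-by-one matrix of the tangent map at \<open>x\<close> in the
  coordinates near \<open>x\<close> and near \<open>f x\<close>. If \<open>f x = x\<close>, the two coordinates agree, and this number is
  the eigenvalue of the tangent map.\<close>

definition sphere_deriv :: "(sphere \<Rightarrow> sphere) \<Rightarrow> sphere \<Rightarrow> complex" where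
  "sphere_deriv f x = deriv (\<lambda>t. chart (f x) (f (chart_inv x t))) (chart x x)"

definition critical_set :: "(sphere \<Rightarrow> sphere) \<Rightarrow> sphere set" where
  "critical_set f = {x. sphere_deriv f x = 0}"

definition postcritical_set :: "(sphere \<Rightarrow> sphere) \<Rightarrow> sphere set" where
  "postcritical_set f = (\<Union>n\<in>{1..}. (f ^^ n) ` critical_set f)"

definition postcritically_finite :: "(sphere \<Rightarrow> sphere) \<Rightarrow> bool" where
  "postcritically_finite f \<longleftrightarrow> finite (postcritical_set f)"

definition is_cycle :: "(sphere \<Rightarrow> sphere) \<Rightarrow> nat \<Rightarrow> sphere set \<Rightarrow> bool" where
  "is_cycle f m C \<longleftrightarrow>
     m \<ge> 1 \<and>
     (\<exists>x. (f ^^ m) x = x \<and> (\<forall>i. 0 < i \<and> i < m \<longrightarrow> (f ^^ i) x \<noteq> x) \<and>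
          C = (\<lambda>i. (f ^^ i) x) ` {..<m})"

text \<open>By the chain rule, the derivative of the \<open>m\<close>-th iterate is the same at all points of a cycle of
  period \<open>m\<close>.\<close>

definition is_multiplier :: "(sphere \<Rightarrow> sphere) \<Rightarrow> nat \<Rightarrow> sphere set \<Rightarrow> complex \<Rightarrow> bool" where
  "is_multiplier f m C \<mu> \<longleftrightarrow> (\<forall>x\<in>C. sphere_deriv (f ^^ m) x = \<mu>)"


section \<open>Quadratic differentials\<close>

text \<open>The field of fractions of the complex polynomials is the field of rational functions; its
  element \<open>q\<close> stands for the meromorphic quadratic differential \<open>q(z) (dz)^2\<close>.\<close>

type_synonym quad_diff = "complex poly fract"

text \<open>The quotient below is in lowest terms, so only at the poles of \<open>q\<close> is the value a dummy.\<close>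

definition rf_eval :: "complex poly fract \<Rightarrow> complex \<Rightarrow> complex" where
  "rf_eval q z = poly (fst (quot_of_fract q)) z / poly (snd (quot_of_fract q)) z"

definition qd_scale :: "complex \<Rightarrow> quad_diff \<Rightarrow> quad_diff" where
  "qd_scale c q = Fract [:c:] 1 * q"

text \<open>The coefficient of \<open>q(z) (dz)^2\<close> in the coordinate \<open>z\<close> or \<open>w = 1/z\<close>; in the second case
  \<open>(dz)^2 = (dw)^2 / w^4\<close>.\<close>

definition qd_coeff :: "quad_diff \<Rightarrow> sphere \<Rightarrow> complex \<Rightarrow> complex" where
  "qd_coeff q a =
     (case a of
        Some _ \<Rightarrow> rf_eval q
      | None \<Rightarrow> (\<lambda>w. rf_eval q (1 / w) / w ^ 4))"

text \<open>Meaningful for \<open>q \<noteq> 0\<close> only.\<close>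

definition qd_order :: "quad_diff \<Rightarrow> sphere \<Rightarrow> int" where
  "qd_order q x = zorder (qd_coeff q x) (chart x x)"

definition qd_poles :: "quad_diff \<Rightarrow> sphere set" where
  "qd_poles q = (if q = 0 then {} else {x. qd_order q x < 0})"

definition QD :: "quad_diff set" where
  "QD = {q. \<forall>x\<in>qd_poles q. qd_order q x = -1}"

definition QD_post :: "(sphere \<Rightarrow> sphere) \<Rightarrow> quad_diff set" where
  "QD_post f = {q \<in> QD. qd_poles q \<subseteq> postcritical_set f}"

text \<open>For all but finitely many \<open>y\<close>, the fibre of \<open>f\<close> over \<open>y\<close> contains neither infinity, nor a
  critical point, nor a pole of \<open>q\<close>; for the finite points \<open>z\<close> of such a fibre, \<^const>\<open>sphere_deriv\<close>
  is the ordinary derivative \<open>f'(z)\<close>.\<close>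

definition pushforward :: "(sphere \<Rightarrow> sphere) \<Rightarrow> quad_diff \<Rightarrow> quad_diff" where
  "pushforward f q =
     (THE r. \<forall>\<^sub>\<infinity>y. rf_eval r y =
        (\<Sum>z | f (Some z) = Some y. rf_eval q z / (sphere_deriv f (Some z))\<^sup>2))"


section \<open>The induced operator on the quotient space\<close>

definition quot_rel :: "(sphere \<Rightarrow> sphere) \<Rightarrow> (quad_diff \<times> quad_diff) set" where
  "quot_rel f = {(q, r). q \<in> QD \<and> r \<in> QD \<and> q - r \<in> QD_post f}"

definition QD_quot :: "(sphere \<Rightarrow> sphere) \<Rightarrow> quad_diff set set" where
  "QD_quot f = QD // quot_rel f"

definition quot_zero :: "(sphere \<Rightarrow> sphere) \<Rightarrow> quad_diff set" where
  "quot_zero f = quot_rel f `` {0}"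

definition quot_scale :: "(sphere \<Rightarrow> sphere) \<Rightarrow> complex \<Rightarrow> quad_diff set \<Rightarrow> quad_diff set" where
  "quot_scale f c X = (\<Union>q\<in>X. quot_rel f `` {qd_scale c q})"

definition quot_pushforward :: "(sphere \<Rightarrow> sphere) \<Rightarrow> quad_diff set \<Rightarrow> quad_diff set" where
  "quot_pushforward f X = (\<Union>q\<in>X. quot_rel f `` {pushforward f q})"

definition quot_eigenvalues :: "(sphere \<Rightarrow> sphere) \<Rightarrow> complex set" where
  "quot_eigenvalues f =
     {c. \<exists>X\<in>QD_quot f. X \<noteq> quot_zero f \<and> quot_pushforward f X = quot_scale f c X}"

end

theory Submission
  imports Defs "HOL-Library.Real_Mod"
begin

text \<open>Let \<open>P\<close> be the postcritical set. Modulo differentials with poles in \<open>P\<close>, a differential is determined by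
  its residues outside \<open>P\<close>, and the residue of \<open>f\<^sub>* q\<close> at \<open>v \<notin> P\<close> is the sum of \<open>res\<^sub>x q / f'(x)\<close> over the
  fibre of \<open>v\<close>. The finite set of poles outside \<open>P\<close> of an eigenvector for \<open>c \<noteq> 0\<close> therefore contains a
  cycle, and going once around it gives the multiplier \<open>1 / c ^ m\<close>. Conversely, the eigenvector
  condition can be solved on a single cycle; three points of \<open>P\<close> suffice to find a differential with these
  residues. If \<open>P\<close> has only two points, then \<open>f\<close> is a power map up to a change of coordinate,
  and one combines two cycles.

  Let \<open>c \<noteq> 0\<close> be an eigenvalue. Inverse branches of the iterates of \<open>f\<close> form bounded families off
  \<open>P\<close>, so a cycle outside \<open>P\<close> is not attracting, and its multiplier is not \<open>1\<close>. Applied to the Galois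
  conjugates of \<open>f\<close>, which are postcritically finite as well, this shows that all conjugates of \<open>c\<close> lie in
  the closed unit disc. Hence \<open>c\<close> is algebraic, because a transcendental number can be moved anywhere outside
  a countable set. If \<open>c\<close> were an algebraic integer, then it would be a root of unity by Kronecker's theorem,
  so that a multiple of the period would give the multiplier \<open>1\<close>.\<close>

section \<open>The sphere as a compact Riemann surface, and rational maps on it\<close>

section \<open>The topology of the sphere\<close>

text \<open>The orders of a nonzero differential add up to -4, so simple poles in a set of n >= 3
  points leave n - 3 free parameters. Three points of P thus absorb every constraint on the residues
  outside P. With only two points these residues satisfy one linear relation, which a single cycle
  may violate; two cycles for the same \<open>c\<close> span a plane of candidates, in which the
  relation leaves at least a line.

  The bound on multipliers rests on Schottky's theorem, which needs three omitted values on the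
  sphere. The case of two points is therefore separate here too: there the multiplier is computed
  outright as \<open>K ^ m\<close>, of modulus greater than 1.

  Conjugation of \<open>f\<close> uses homomorphisms on countable subfields of the complex numbers:
  only finitely many numbers enter (coefficients, Bezout cofactors, critical points, a periodic
  point, \<open>c\<close>), and a homomorphism extends to any finite set of further numbers. Since
  the multiplier is \<open>1 / c ^ m\<close>, the lower bound 1 for multipliers of the conjugate map
  turns into the upper bound 1 for conjugates of \<open>c\<close>, as Kronecker's theorem
  requires.\<close>

instantiation option :: (topological_space) topological_space
begin

text \<open>One-point compactification. Openness of the finite part is required for neighbourhoods
  of \<open>None\<close> as well, because \<open>'a\<close> need not be Hausdorff and a compact
  complement need not be closed.\<close>

definition open_option :: "'a option set \<Rightarrow> bool" where
  "open_option S \<longleftrightarrow> open (Some -` S) \<and> (None \<in> S \<longrightarrow> compact (- (Some -` S)))"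

instance
proof
  show "open (UNIV :: 'a option set)"
    by (simp add: open_option_def)
next
  fix S T :: "'a option set" assume "open S" "open T"
  then show "open (S \<inter> T)"
    by (auto simp: open_option_def Compl_Int intro: compact_Un)
next
  fix K :: "'a option set set" assume K: "\<forall>S\<in>K. open S"
  have op: "open (Some -` \<Union>K)"
    using K by (auto simp: open_option_def vimage_Union)
  moreover have "compact (- (Some -` \<Union>K))" if N: "None \<in> \<Union>K"
  proof -
    obtain S where S: "S \<in> K" "None \<in> S" using N by blast
    have "compact (- (Some -` S) \<inter> - (Some -` \<Union>K))"
      using K S op by (intro compact_Int_closed) (auto simp: open_option_def)
    also have "- (Some -` S) \<inter> - (Some -` \<Union>K) = - (Some -` \<Union>K)"
      using S by auto
    finally show ?thesis .
  qed
  ultimately show "open (\<Union>K)" by (simp add: open_option_def)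
qed

end

lemma open_image_Some: "open U \<Longrightarrow> open (Some ` U)"
  by (auto simp: open_option_def inj_vimage_image_eq)

lemma nhds_Some: "nhds (Some z) = filtermap Some (nhds z)"
proof (rule filter_eqI)
  fix P :: "'a option \<Rightarrow> bool"
  show "eventually P (nhds (Some z)) \<longleftrightarrow> eventually P (filtermap Some (nhds z))"
    unfolding eventually_filtermap eventually_nhds
  proof safe
    fix S assume "open S" "Some z \<in> S" "\<forall>x\<in>S. P x"
    then show "\<exists>S. open S \<and> z \<in> S \<and> (\<forall>x\<in>S. P (Some x))"
      by (intro exI[of _ "Some -` S"]) (auto simp: open_option_def)
  next
    fix S assume "open S" "z \<in> S" "\<forall>x\<in>S. P (Some x)"
    then show "\<exists>S. open S \<and> Some z \<in> S \<and> (\<forall>x\<in>S. P x)"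
      by (intro exI[of _ "Some ` S"]) (auto simp: open_image_Some)
  qed
qed

lemma eventually_nhds_None:
  fixes P :: "'a::{real_normed_vector,heine_borel} option \<Rightarrow> bool"
  shows "eventually P (nhds None) \<longleftrightarrow> P None \<and> eventually (\<lambda>z. P (Some z)) at_infinity"
  unfolding eventually_nhds eventually_at_infinity
proof safe
  fix S :: "'a option set" assume S: "open S" "None \<in> S" "\<forall>x\<in>S. P x"
  then have "bounded (- (Some -` S))"
    by (auto simp: open_option_def compact_imp_bounded)
  then obtain b where b: "\<And>x. x \<in> - (Some -` S) \<Longrightarrow> norm x \<le> b"
    by (auto simp: bounded_iff)
  show "\<exists>b. \<forall>x. b \<le> norm x \<longrightarrow> P (Some x)"
  proof (intro exI[of _ "b + 1"] allI impI)
    fix x :: 'a assume "b + 1 \<le> norm x"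
    with b[of x] S show "P (Some x)" by force
  qed
next
  fix b assume b: "P None" "\<forall>x. b \<le> norm x \<longrightarrow> P (Some x)"
  have "Some -` (insert None (Some ` (- cball (0::'a) b))) = - cball 0 b" by auto
  then have "open (insert None (Some ` (- cball (0::'a) b)))"
    by (auto simp: open_option_def)
  with b show "\<exists>S. open S \<and> None \<in> S \<and> (\<forall>x\<in>S. P x)"
    by (intro exI[of _ "insert None (Some ` (- cball (0::'a) b))"]) auto
qed auto

lemma compact_UNIV_option: "compact (UNIV :: 'a::topological_space option set)"
proof (rule compactI)
  fix C :: "'a option set set"
  assume C: "\<forall>t\<in>C. open t" "UNIV \<subseteq> \<Union>C"
  have "None \<in> \<Union>C" using C(2) by (rule subsetD) simp
  then obtain c where c: "c \<in> C" "None \<in> c" by (rule UnionE)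
  then have "compact (- (Some -` c))" using C by (auto simp: open_option_def)
  moreover have "\<And>t. t \<in> C \<Longrightarrow> open (Some -` t)" using C by (auto simp: open_option_def)
  moreover have "- (Some -` c) \<subseteq> (\<Union>t\<in>C. Some -` t)"
  proof
    fix x show "x \<in> (\<Union>t\<in>C. Some -` t)"
      using subsetD[OF C(2), of "Some x"] by auto
  qed
  ultimately obtain C' where C': "C' \<subseteq> C" "finite C'" "- (Some -` c) \<subseteq> (\<Union>t\<in>C'. Some -` t)"
    using compactE_image[of "- (Some -` c)" C "\<lambda>t. Some -` t"] by metis
  have "x \<in> \<Union>(insert c C')" for x
  proof (cases x)
    case (Some z)
    then show ?thesis using subsetD[OF C'(3), of z] by auto
  qed (use c in auto)
  then have "UNIV \<subseteq> \<Union>(insert c C')" by (rule subsetI)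
  moreover have "insert c C' \<subseteq> C" "finite (insert c C')" using c C' by auto
  ultimately show "\<exists>C'\<subseteq>C. finite C' \<and> UNIV \<subseteq> \<Union>C'" by metis
qed

instance option :: ("{real_normed_vector,heine_borel}") t2_space
proof
  fix x y :: "'a option" assume ne: "x \<noteq> y"
  have *: "\<exists>U V. open U \<and> open V \<and> Some a \<in> U \<and> None \<in> V \<and> U \<inter> V = {}" for a :: 'a
  proof (intro exI conjI)
    show "open (Some ` ball a 1)" by (simp add: open_image_Some)
    have "Some -` (insert None (Some ` (- cball a 1))) = - cball a 1" by auto
    then show "open (insert None (Some ` (- cball a 1)))" by (auto simp: open_option_def)
  qed auto
  show "\<exists>U V. open U \<and> open V \<and> x \<in> U \<and> y \<in> V \<and> U \<inter> V = {}"
  proof (cases x; cases y)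
    fix a b assume ab: "x = Some a" "y = Some b"
    with ne obtain U V where UV: "open U" "open V" "a \<in> U" "b \<in> V" "U \<inter> V = {}"
      using hausdorff[of a b] by auto
    have "Some ` U \<inter> Some ` V = {}" using UV by auto
    with UV ab open_image_Some[of U] open_image_Some[of V] show ?thesis
      by (metis imageI)
  next
    fix a assume "x = Some a" "y = None"
    then show ?thesis using *[of a] by metis
  next
    fix a assume "x = None" "y = Some a"
    moreover obtain U V where "open U" "open V" "Some a \<in> U" "None \<in> V" "U \<inter> V = {}"
      using *[of a] by metis
    moreover have "V \<inter> U = {}" using \<open>U \<inter> V = {}\<close> by (simp add: Int_commute)
    ultimately show ?thesis by metis
  qed (use ne in simp)
qed

section \<open>Charts\<close>

definition chart_dom :: "sphere \<Rightarrow> sphere set" where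
  "chart_dom a = (case a of Some _ \<Rightarrow> - {None} | None \<Rightarrow> - {Some 0})"

lemma chart_simps [simp]:
  "chart (Some c) (Some z) = z" "chart (Some c) None = 0"
  "chart None (Some z) = 1 / z" "chart None None = 0"
  "chart_inv (Some c) t = Some t"
  "chart_inv None 0 = None"
  by (auto simp: chart_def chart_inv_def)

lemma chart_inv_None: "chart_inv None t = (if t = 0 then None else Some (1 / t))"
  by (simp add: chart_inv_def)

lemma chart_dom_self [simp]: "a \<in> chart_dom a"
  by (simp add: chart_dom_def split: option.splits)

lemma chart_inv_chart [simp]: "x \<in> chart_dom a \<Longrightarrow> chart_inv a (chart a x) = x"
  by (auto simp: chart_dom_def chart_inv_def chart_def split: option.splits)

lemma chart_chart_inv [simp]: "chart a (chart_inv a t) = t"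
  by (auto simp: chart_inv_def chart_def split: option.splits)

lemma chart_eq_iff: "x \<in> chart_dom a \<Longrightarrow> y \<in> chart_dom a \<Longrightarrow> chart a x = chart a y \<longleftrightarrow> x = y"
  by (metis chart_inv_chart)

lemma open_chart_dom [simp]: "open (chart_dom a)"
  by (simp add: chart_dom_def open_Compl closed_singleton split: option.splits)

text \<open>Charts are homeomorphisms onto open sets, stated for filters: limits and eventual
  properties at a point of the sphere can then be moved to the coordinate. The delicate point is
  \<open>t = 0\<close> in the chart at infinity, where \<open>inverse\<close> exchanges
  \<open>at 0\<close> and \<open>at_infinity\<close>.\<close>

lemma nhds_chart_inv: "nhds (chart_inv a t) = filtermap (chart_inv a) (nhds t)"
proof (cases a)
  case (Some c)
  have "chart_inv (Some c) = Some" by auto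
  then show ?thesis using Some by (simp add: nhds_Some)
next
  case [simp]: None
  show ?thesis
  proof (cases "t = 0")
    case t0: True
    show ?thesis
    proof (rule filter_eqI)
      fix P :: "sphere \<Rightarrow> bool"
      have "eventually P (filtermap (chart_inv None) (nhds 0)) \<longleftrightarrow>
         P None \<and> eventually (\<lambda>t. P (chart_inv None t)) (at 0)"
        by (auto simp: eventually_filtermap eventually_nhds_conv_at)
      also have "eventually (\<lambda>t. P (chart_inv None t)) (at 0) \<longleftrightarrow>
          eventually (\<lambda>t. P (Some (inverse t))) (at (0::complex))"
        by (intro eventually_cong) (auto simp: eventually_at_filter chart_inv_None inverse_eq_divide)
      also have "\<dots> \<longleftrightarrow> eventually (\<lambda>z. P (Some z)) at_infinity"
        by (simp add: at_to_infinity eventually_filtermap filtermap_filtermap)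
      finally show "eventually P (nhds (chart_inv a t)) \<longleftrightarrow> eventually P (filtermap (chart_inv a) (nhds t))"
        using t0 by (simp add: eventually_nhds_None)
    qed
  next
    case t0: False
    have "filtermap (chart_inv None) (nhds t) = filtermap (\<lambda>t. Some (1 / t)) (nhds t)"
      unfolding filter_eq_iff eventually_filtermap
    proof (intro allI)
      fix P :: "sphere \<Rightarrow> bool"
      have "eventually (\<lambda>s. s \<in> - {0}) (nhds t)" using t0
        by (intro eventually_nhds_in_open) auto
      then show "eventually (\<lambda>s. P (chart_inv None s)) (nhds t) = eventually (\<lambda>s. P (Some (1 / s))) (nhds t)"
        by (intro eventually_cong, elim eventually_mono) (auto simp: chart_inv_None)
    qed
    also have "\<dots> = filtermap Some (filtermap (\<lambda>t. 1 / t) (nhds t))"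
      by (simp add: filtermap_filtermap)
    also have "filtermap (\<lambda>t. 1 / t) (nhds t) = nhds (1 / t)"
    proof (rule antisym)
      show "filtermap ((/) 1) (nhds t) \<le> nhds (1 / t)"
        using t0 tendsto_divide[OF tendsto_const[of 1] filterlim_ident[of "nhds t"] t0]
        by (simp add: filterlim_def)
      \<comment> \<open>Inversion is an involution, so continuity at \<open>1 / t\<close> gives the
        reverse inequality at \<open>t\<close>.\<close>
      have "filtermap ((/) 1) (nhds (1/t)) \<le> nhds t"
        using t0 tendsto_divide[OF tendsto_const[of 1] filterlim_ident[of "nhds (1/t)"]]
        by (simp add: filterlim_def)
      then have "filtermap ((/) 1) (filtermap ((/) 1) (nhds (1/t))) \<le> filtermap ((/) 1) (nhds t)"
        by (rule filtermap_mono)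
      then show "nhds (1 / t) \<le> filtermap ((/) 1) (nhds t)"
        by (simp add: filtermap_filtermap)
    qed
    finally show ?thesis using t0 by (simp add: chart_inv_None[of t] nhds_Some)
  qed
qed

lemma nhds_chart: "x \<in> chart_dom a \<Longrightarrow> nhds x = filtermap (chart_inv a) (nhds (chart a x))"
  using nhds_chart_inv[of a "chart a x"] by simp

lemma isCont_chart_inv: "isCont (chart_inv a) t"
  unfolding isCont_def using nhds_chart_inv[of a t]
  by (metis filterlim_def at_within_le_nhds filtermap_mono)

lemma eventually_sphere:
  "x \<in> chart_dom a \<Longrightarrow> eventually P (nhds x) \<longleftrightarrow> eventually (\<lambda>t. P (chart_inv a t)) (nhds (chart a x))"
  by (simp add: nhds_chart[of x a] eventually_filtermap)

lemma open_image_chart_inv: "open U \<Longrightarrow> open (chart_inv a ` U)"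
  unfolding open_subopen[of "chart_inv a ` U"]
proof
  fix x assume "open U" "x \<in> chart_inv a ` U"
  then obtain t where t: "x = chart_inv a t" "t \<in> U" by blast
  then have "eventually (\<lambda>y. y \<in> chart_inv a ` U) (nhds x)"
    using \<open>open U\<close> by (auto simp: nhds_chart_inv eventually_filtermap eventually_nhds)
  then show "\<exists>T. open T \<and> x \<in> T \<and> T \<subseteq> chart_inv a ` U"
    unfolding eventually_nhds by auto
qed

section \<open>Holomorphic self-maps of the sphere\<close>

definition chart_rep :: "(sphere \<Rightarrow> sphere) \<Rightarrow> sphere \<Rightarrow> complex \<Rightarrow> complex" where
  "chart_rep f x t = chart (f x) (f (chart_inv x t))"

text \<open>Continuity does not follow from the second conjunct: \<open>chart\<close> has a dummy
  value at the one point outside its domain, so an analytic representation may conceal a jump of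
  \<open>f\<close> to that point.\<close>

definition sph_holo :: "(sphere \<Rightarrow> sphere) \<Rightarrow> bool" where
  "sph_holo f \<longleftrightarrow> (\<forall>x. isCont f x \<and> chart_rep f x analytic_on {chart x x})"

lemma sphere_deriv_rep: "sphere_deriv f x = deriv (chart_rep f x) (chart x x)"
  by (simp add: sphere_deriv_def chart_rep_def[abs_def])

lemma chart_rep_self [simp]: "chart_rep f x (chart x x) = chart (f x) (f x)"
  by (simp add: chart_rep_def)

lemma isCont_tendsto_nhds: "isCont f x \<Longrightarrow> (f \<longlongrightarrow> f x) (nhds (x::'a::t2_space))"
  by (simp add: isCont_def tendsto_at_iff_tendsto_nhds)

lemma eventually_in_chart_dom:
  assumes "isCont f x"
  shows "\<forall>\<^sub>F t in nhds (chart x x). f (chart_inv x t) \<in> chart_dom (f x)"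
proof -
  have "(f \<longlongrightarrow> f x) (nhds x)" using assms by (rule isCont_tendsto_nhds)
  then have "\<forall>\<^sub>F y in nhds x. f y \<in> chart_dom (f x)"
    by (rule topological_tendstoD) auto
  then show ?thesis by (simp add: eventually_sphere[of x x])
qed

lemma eventually_chart_inv_rep:
  assumes "isCont f x"
  shows "\<forall>\<^sub>F t in nhds (chart x x). f (chart_inv x t) = chart_inv (f x) (chart_rep f x t)"
  using eventually_in_chart_dom[OF assms] by eventually_elim (simp add: chart_rep_def)

lemma chart_rep_comp:
  assumes "isCont f x"
  shows "\<forall>\<^sub>F t in nhds (chart x x). chart_rep (g \<circ> f) x t = chart_rep g (f x) (chart_rep f x t)"
  using eventually_chart_inv_rep[OF assms] by eventually_elim (simp add: chart_rep_def)

lemma sph_holoD: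
  assumes "sph_holo f"
  shows "isCont f x" "chart_rep f x analytic_on {chart x x}"
  using assms by (auto simp: sph_holo_def)

lemma sph_holo_has_deriv:
  assumes "sph_holo f"
  shows "(chart_rep f x has_field_derivative sphere_deriv f x) (at (chart x x))"
  using sph_holoD(2)[OF assms, of x] unfolding sphere_deriv_rep
  by (simp add: DERIV_deriv_iff_field_differentiable analytic_on_imp_differentiable_at)

lemma isCont_comp: "isCont f x \<Longrightarrow> isCont g (f x) \<Longrightarrow> isCont (g \<circ> f) x"
  by (rule continuous_at_compose)

lemma sph_holo_comp:
  assumes "sph_holo f" "sph_holo g"
  shows "sph_holo (g \<circ> f)"
  unfolding sph_holo_def
proof (intro allI conjI)
  fix x
  show "isCont (g \<circ> f) x"
    using assms by (intro isCont_comp) (auto simp: sph_holo_def)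
  have "chart_rep g (f x) \<circ> chart_rep f x analytic_on {chart x x}"
    using assms by (intro analytic_on_compose) (auto simp: sph_holo_def)
  moreover have "(chart_rep g (f x) \<circ> chart_rep f x analytic_on {chart x x}) \<longleftrightarrow>
     (chart_rep (g \<circ> f) x analytic_on {chart x x})"
    using chart_rep_comp[OF sph_holoD(1)[OF assms(1)], where x = x and g = g]
    by (intro analytic_at_cong) (auto elim!: eventually_mono)
  ultimately show "chart_rep (g \<circ> f) x analytic_on {chart x x}" by simp
qed

lemma sphere_deriv_comp:
  assumes "sph_holo f" "sph_holo g"
  shows "sphere_deriv (g \<circ> f) x = sphere_deriv g (f x) * sphere_deriv f x"
proof -
  have "(chart_rep g (f x) \<circ> chart_rep f x has_field_derivative sphere_deriv g (f x) * sphere_deriv f x) (at (chart x x))"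
    using sph_holo_has_deriv[OF assms(1), of x] sph_holo_has_deriv[OF assms(2), of "f x"]
    by (intro DERIV_chain) auto
  moreover have "\<forall>\<^sub>F t in nhds (chart x x). (chart_rep g (f x) \<circ> chart_rep f x) t = chart_rep (g \<circ> f) x t"
    using chart_rep_comp[OF sph_holoD(1)[OF assms(1)], where x = x and g = g] by eventually_elim simp
  ultimately have "(chart_rep (g \<circ> f) x has_field_derivative sphere_deriv g (f x) * sphere_deriv f x) (at (chart x x))"
    using DERIV_cong_ev[OF refl _ refl] by blast
  then show ?thesis by (simp add: sphere_deriv_rep DERIV_imp_deriv)
qed

lemma chart_rep_id: "chart_rep id x = (\<lambda>t. t)"
  by (auto simp: chart_rep_def)

lemma sph_holo_id: "sph_holo id"
  unfolding sph_holo_def chart_rep_id by (auto simp: id_def)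

lemma sphere_deriv_id [simp]: "sphere_deriv id x = 1"
  unfolding sphere_deriv_rep chart_rep_id by simp

lemma sph_holo_funpow: "sph_holo f \<Longrightarrow> sph_holo (f ^^ n)"
  by (induction n) (auto simp: sph_holo_id sph_holo_comp)

lemma sphere_deriv_funpow:
  assumes "sph_holo f"
  shows "sphere_deriv (f ^^ n) x = (\<Prod>i<n. sphere_deriv f ((f ^^ i) x))"
proof (induction n)
  case 0
  then show ?case using sphere_deriv_id by (simp add: id_def)
next
  case (Suc n)
  have "sphere_deriv (f ^^ Suc n) x = sphere_deriv (f \<circ> f ^^ n) x" by simp
  also have "\<dots> = sphere_deriv f ((f ^^ n) x) * sphere_deriv (f ^^ n) x"
    by (rule sphere_deriv_comp[OF sph_holo_funpow[OF assms] assms])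
  finally show ?case
    unfolding Suc.IH prod.lessThan_Suc by (simp only: mult.commute)
qed

lemma sph_holo_continuous_on: "sph_holo f \<Longrightarrow> continuous_on S f"
  by (simp add: continuous_at_imp_continuous_on sph_holoD)

section \<open>Local inverses and fibres\<close>

text \<open>Compactness of the sphere: the points where \<open>P\<close> does not hold locally form
  a compact set, whose image is closed and misses \<open>v\<close>. It controls all preimages of a
  nearby value at once, including those near critical points, where no inverse branches
  exist.\<close>

lemma fibre_nearby:
  fixes f :: "sphere \<Rightarrow> sphere"
  assumes "continuous_on UNIV f" and "\<And>x. f x = v \<Longrightarrow> eventually P (nhds x)"
  shows "\<forall>\<^sub>F y in nhds v. \<forall>x. f x = y \<longrightarrow> P x"
proof -
  define U where "U = \<Union>{S. open S \<and> (\<forall>x\<in>S. P x)}"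
  have "open U" unfolding U_def by (rule open_Union) auto
  then have "compact (- U)"
    using compact_Int_closed[OF compact_UNIV_option, of "- U"] by (simp add: closed_def)
  then have "compact (f ` (- U))"
    by (intro compact_continuous_image continuous_on_subset[OF assms(1)]) auto
  then have op: "open (- (f ` (- U)))"
    by (intro open_Compl compact_imp_closed)
  have UP: "P x" if "x \<in> U" for x using that by (auto simp: U_def)
  have "x \<in> U" if fx: "f x = v" for x
  proof -
    obtain S where "open S" "x \<in> S" "\<forall>y\<in>S. P y"
      using assms(2)[OF fx] unfolding eventually_nhds by blast
    then show ?thesis by (auto simp: U_def)
  qed
  then have "v \<in> - (f ` (- U))" by (auto simp: image_iff)
  with op have "\<forall>\<^sub>F y in nhds v. y \<in> - (f ` (- U))"
    by (rule eventually_nhds_in_open)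
  then show ?thesis
    by eventually_elim (use UP in auto)
qed

lemma chart_rep_local_inverse:
  assumes "sph_holo f" "sphere_deriv f x \<noteq> 0"
  obtains U g where "open U" "chart x x \<in> U" "chart_rep f x holomorphic_on U"
    "\<And>t. t \<in> U \<Longrightarrow> f (chart_inv x t) = chart_inv (f x) (chart_rep f x t)"
    "\<And>t. t \<in> U \<Longrightarrow> deriv (chart_rep f x) t \<noteq> 0"
    "open (chart_rep f x ` U)" "g holomorphic_on chart_rep f x ` U"
    "\<And>t. t \<in> U \<Longrightarrow> g (chart_rep f x t) = t"
proof -
  let ?F = "chart_rep f x"
  obtain A where A: "open A" "chart x x \<in> A" "?F holomorphic_on A"
    using sph_holoD(2)[OF assms(1), of x] by (auto simp: analytic_at)
  obtain B where B: "open B" "chart x x \<in> B" "\<And>t. t \<in> B \<Longrightarrow> f (chart_inv x t) = chart_inv (f x) (?F t)"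
    using eventually_chart_inv_rep[OF sph_holoD(1)[OF assms(1)], of x] by (auto simp: eventually_nhds)
  have hol: "?F holomorphic_on A \<inter> B" using A by (auto intro: holomorphic_on_subset)
  obtain r where r: "r > 0" "ball (chart x x) r \<subseteq> A \<inter> B" "open (?F ` ball (chart x x) r)" "inj_on ?F (ball (chart x x) r)"
    using has_complex_derivative_locally_invertible[OF hol, of "chart x x"] A B assms(2)
    by (auto simp: sphere_deriv_rep)
  let ?U = "ball (chart x x) r"
  have holU: "?F holomorphic_on ?U" using hol r holomorphic_on_subset by blast
  obtain g where g: "g holomorphic_on (?F ` ?U)"
    "\<And>z. z \<in> ?U \<Longrightarrow> deriv ?F z * deriv g (?F z) = 1" "\<And>z. z \<in> ?U \<Longrightarrow> g (?F z) = z"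
    using holomorphic_has_inverse[OF holU open_ball r(4)] by blast
  show ?thesis
  proof (rule that[of ?U g])
    show "f (chart_inv x t) = chart_inv (f x) (?F t)" if "t \<in> ?U" for t
      using that B r by blast
    show "deriv ?F t \<noteq> 0" if "t \<in> ?U" for t
      using g(2)[OF that] by auto
  qed (use r holU g in auto)
qed

text \<open>The sheets over a disc around \<open>v\<close> are indexed by the points \<open>x\<close> of the fibre of \<open>v\<close>;
  \<open>s x\<close> is the inverse branch with value \<open>x\<close> at \<open>v\<close>, in the charts at \<open>v\<close> and \<open>x\<close>.\<close>

definition even_cover :: "(sphere \<Rightarrow> sphere) \<Rightarrow> sphere \<Rightarrow> real \<Rightarrow> (sphere \<Rightarrow> complex set)
    \<Rightarrow> (sphere \<Rightarrow> complex \<Rightarrow> complex) \<Rightarrow> bool" where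
  "even_cover f v r U s \<longleftrightarrow> r > 0 \<and>
    (\<forall>x. f x = v \<longrightarrow> open (U x) \<and> chart_rep f x holomorphic_on U x \<and>
      (\<forall>t\<in>U x. deriv (chart_rep f x) t \<noteq> 0) \<and>
      s x holomorphic_on ball (chart v v) r \<and> s x ` ball (chart v v) r \<subseteq> U x \<and>
      open (s x ` ball (chart v v) r) \<and> s x (chart v v) = chart x x \<and>
      (\<forall>u\<in>ball (chart v v) r. chart_rep f x (s x u) = u \<and> f (chart_inv x (s x u)) = chart_inv v u)) \<and>
    (\<forall>u\<in>ball (chart v v) r. {x. f x = chart_inv v u} = (\<lambda>x. chart_inv x (s x u)) ` {x. f x = v} \<and>
      inj_on (\<lambda>x. chart_inv x (s x u)) {x. f x = v})"

lemma even_coverD: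
  assumes "even_cover f v r U s"
  shows "r > 0"
    "\<And>x. f x = v \<Longrightarrow> open (U x)" "\<And>x. f x = v \<Longrightarrow> chart_rep f x holomorphic_on U x"
    "\<And>x t. f x = v \<Longrightarrow> t \<in> U x \<Longrightarrow> deriv (chart_rep f x) t \<noteq> 0"
    "\<And>x. f x = v \<Longrightarrow> s x holomorphic_on ball (chart v v) r"
    "\<And>x. f x = v \<Longrightarrow> s x ` ball (chart v v) r \<subseteq> U x"
    "\<And>x. f x = v \<Longrightarrow> open (s x ` ball (chart v v) r)"
    "\<And>x. f x = v \<Longrightarrow> s x (chart v v) = chart x x"
    "\<And>x u. f x = v \<Longrightarrow> u \<in> ball (chart v v) r \<Longrightarrow> chart_rep f x (s x u) = u"
    "\<And>x u. f x = v \<Longrightarrow> u \<in> ball (chart v v) r \<Longrightarrow> f (chart_inv x (s x u)) = chart_inv v u"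
    "\<And>u. u \<in> ball (chart v v) r \<Longrightarrow>
      {x. f x = chart_inv v u} = (\<lambda>x. chart_inv x (s x u)) ` {x. f x = v}"
    "\<And>u. u \<in> ball (chart v v) r \<Longrightarrow> inj_on (\<lambda>x. chart_inv x (s x u)) {x. f x = v}"
  using assms unfolding even_cover_def by blast+

text \<open>The inverse function theorem gives one branch at each point of the fibre. The Hausdorff
  property and finiteness keep the branches apart, and \<open>fibre_nearby\<close> shows that they
  exhaust the fibres close to \<open>v\<close>.\<close>

lemma evenly_covered:
  fixes f :: "sphere \<Rightarrow> sphere"
  assumes f: "sph_holo f" and fin: "finite {x. f x = v}"
    and ncrit: "\<And>x. f x = v \<Longrightarrow> sphere_deriv f x \<noteq> 0"
  shows "\<exists>r U s. even_cover f v r U s"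
proof -
  let ?I = "{x. f x = v}"
  have "\<forall>x. \<exists>U g. f x = v \<longrightarrow> open U \<and> chart x x \<in> U \<and> chart_rep f x holomorphic_on U \<and>
     (\<forall>t\<in>U. f (chart_inv x t) = chart_inv v (chart_rep f x t)) \<and>
     (\<forall>t\<in>U. deriv (chart_rep f x) t \<noteq> 0) \<and>
     open (chart_rep f x ` U) \<and> g holomorphic_on chart_rep f x ` U \<and>
     (\<forall>t\<in>U. g (chart_rep f x t) = t)"
  proof
    fix x
    show "\<exists>U g. f x = v \<longrightarrow> open U \<and> chart x x \<in> U \<and> chart_rep f x holomorphic_on U \<and>
     (\<forall>t\<in>U. f (chart_inv x t) = chart_inv v (chart_rep f x t)) \<and>
     (\<forall>t\<in>U. deriv (chart_rep f x) t \<noteq> 0) \<and>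
     open (chart_rep f x ` U) \<and> g holomorphic_on chart_rep f x ` U \<and>
     (\<forall>t\<in>U. g (chart_rep f x t) = t)"
    proof (cases "f x = v")
      case True
      show ?thesis
        using chart_rep_local_inverse[OF f ncrit[OF True]] unfolding True by metis
    qed simp
  qed
  from choice[OF this] obtain U where "\<forall>x. \<exists>g. f x = v \<longrightarrow> open (U x) \<and> chart x x \<in> U x \<and> chart_rep f x holomorphic_on U x \<and>
     (\<forall>t\<in>U x. f (chart_inv x t) = chart_inv v (chart_rep f x t)) \<and>
     (\<forall>t\<in>U x. deriv (chart_rep f x) t \<noteq> 0) \<and>
     open (chart_rep f x ` U x) \<and> g holomorphic_on chart_rep f x ` U x \<and>
     (\<forall>t\<in>U x. g (chart_rep f x t) = t)" by (rule exE)
  from choice[OF this] obtain s where "\<forall>x. f x = v \<longrightarrow> open (U x) \<and> chart x x \<in> U x \<and> chart_rep f x holomorphic_on U x \<and>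
     (\<forall>t\<in>U x. f (chart_inv x t) = chart_inv v (chart_rep f x t)) \<and>
     (\<forall>t\<in>U x. deriv (chart_rep f x) t \<noteq> 0) \<and>
     open (chart_rep f x ` U x) \<and> s x holomorphic_on chart_rep f x ` U x \<and>
     (\<forall>t\<in>U x. s x (chart_rep f x t) = t)" by (rule exE)
  then have Us: "\<And>x. f x = v \<Longrightarrow> open (U x)" "\<And>x. f x = v \<Longrightarrow> chart x x \<in> U x"
    "\<And>x. f x = v \<Longrightarrow> chart_rep f x holomorphic_on U x"
     "\<And>x t. f x = v \<Longrightarrow> t \<in> U x \<Longrightarrow> f (chart_inv x t) = chart_inv v (chart_rep f x t)"
     "\<And>x t. f x = v \<Longrightarrow> t \<in> U x \<Longrightarrow> deriv (chart_rep f x) t \<noteq> 0"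
     "\<And>x. f x = v \<Longrightarrow> open (chart_rep f x ` U x)"
     "\<And>x. f x = v \<Longrightarrow> s x holomorphic_on chart_rep f x ` U x"
     "\<And>x t. f x = v \<Longrightarrow> t \<in> U x \<Longrightarrow> s x (chart_rep f x t) = t"
    by blast+
  let ?tv = "chart v v"
  have tvU: "?tv \<in> chart_rep f x ` U x" if "f x = v" for x
    using Us(2)[OF that] that chart_rep_self[of f x] by (metis imageI)
  have stv: "s x ?tv = chart x x" if "f x = v" for x
    using Us(8)[OF that Us(2)[OF that]] that by simp
  have ev1: "\<forall>\<^sub>F u in nhds ?tv. \<forall>x\<in>?I. u \<in> chart_rep f x ` U x"
    using fin Us(6) tvU by (intro eventually_ball_finite ballI eventually_nhds_in_open) auto
  have contc: "((\<lambda>u. chart_inv x (s x u)) \<longlongrightarrow> x) (nhds ?tv)" if "f x = v" for x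
  proof -
    have "isCont (s x) ?tv"
      using Us(6,7)[OF that] tvU[OF that] continuous_on_eq_continuous_at holomorphic_on_imp_continuous_on by blast
    then have "(s x \<longlongrightarrow> chart x x) (nhds ?tv)"
      using stv[OF that] isCont_tendsto_nhds by metis
    moreover have "(chart_inv x \<longlongrightarrow> x) (nhds (chart x x))"
      using isCont_tendsto_nhds[OF isCont_chart_inv[where a = x and t = "chart x x"]] by simp
    ultimately show ?thesis
      using filterlim_compose by blast
  qed
  have "\<forall>\<^sub>F u in nhds ?tv. chart_inv x (s x u) \<noteq> chart_inv y (s y u)"
    if xy: "x \<in> ?I" "y \<in> ?I" "x \<noteq> y" for x y
  proof -
    obtain A B where AB: "open A" "open B" "x \<in> A" "y \<in> B" "A \<inter> B = {}"
      using hausdorff[OF xy(3)] by blast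
    have "\<forall>\<^sub>F u in nhds ?tv. chart_inv x (s x u) \<in> A" "\<forall>\<^sub>F u in nhds ?tv. chart_inv y (s y u) \<in> B"
      using contc[of x] contc[of y] xy AB by (auto intro: topological_tendstoD)
    then show ?thesis by eventually_elim (use AB in auto)
  qed
  then have "\<forall>\<^sub>F u in nhds ?tv. \<forall>x\<in>?I. \<forall>y\<in>?I. x \<noteq> y \<longrightarrow> chart_inv x (s x u) \<noteq> chart_inv y (s y u)"
    using fin by (intro eventually_ball_finite ballI) (auto simp del: mem_Collect_eq)
  then have ev2: "\<forall>\<^sub>F u in nhds ?tv. inj_on (\<lambda>x. chart_inv x (s x u)) ?I"
    by eventually_elim (auto simp: inj_on_def)
  have "\<forall>\<^sub>F y in nhds v. \<forall>x'. f x' = y \<longrightarrow> (\<exists>x. f x = v \<and> x' \<in> chart_inv x ` U x)"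
  proof (rule fibre_nearby[OF sph_holo_continuous_on[OF f]])
    fix x assume x: "f x = v"
    have "\<forall>\<^sub>F x' in nhds x. x' \<in> chart_inv x ` U x"
      using Us(1,2)[OF x]
      by (intro eventually_nhds_in_open open_image_chart_inv) (auto intro!: image_eqI[of _ _ "chart x x"])
    then show "\<forall>\<^sub>F x' in nhds x. \<exists>x. f x = v \<and> x' \<in> chart_inv x ` U x"
      by eventually_elim (use x in blast)
  qed
  then have ev3: "\<forall>\<^sub>F u in nhds ?tv. \<forall>x'. f x' = chart_inv v u \<longrightarrow> (\<exists>x. f x = v \<and> x' \<in> chart_inv x ` U x)"
    by (simp add: eventually_sphere[of v v])
  have "\<forall>\<^sub>F u in nhds ?tv. (\<forall>x\<in>?I. u \<in> chart_rep f x ` U x) \<and> inj_on (\<lambda>x. chart_inv x (s x u)) ?I \<and>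
      (\<forall>x'. f x' = chart_inv v u \<longrightarrow> (\<exists>x. f x = v \<and> x' \<in> chart_inv x ` U x))"
    using ev1 ev2 ev3 by eventually_elim blast
  then obtain r where r: "r > 0" and N: "\<And>u. u \<in> ball ?tv r \<Longrightarrow> (\<forall>x\<in>?I. u \<in> chart_rep f x ` U x) \<and> inj_on (\<lambda>x. chart_inv x (s x u)) ?I \<and>
      (\<forall>x'. f x' = chart_inv v u \<longrightarrow> (\<exists>x. f x = v \<and> x' \<in> chart_inv x ` U x))"
    unfolding eventually_nhds_metric by (auto simp: dist_commute)
  have sub: "ball ?tv r \<subseteq> chart_rep f x ` U x" if "f x = v" for x using N that by blast
  have sU: "s x u \<in> U x \<and> chart_rep f x (s x u) = u" if "f x = v" "u \<in> ball ?tv r" for x u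
    using sub[OF that(1)] that Us(8)[OF that(1)] by force
  have hs: "s x holomorphic_on ball ?tv r" if "f x = v" for x
    using Us(7) that sub holomorphic_on_subset by blast
  have fs: "f (chart_inv x (s x u)) = chart_inv v u" if "f x = v" "u \<in> ball ?tv r" for x u
    using Us(4)[OF that(1)] sU[OF that] by auto
  have op: "open (s x ` ball (chart v v) r)" if "f x = v" for x
  proof (rule open_mapping_thm3[OF hs[OF that] open_ball])
    show "inj_on (s x) (ball (chart v v) r)"
      by (rule inj_on_inverseI[of _ "chart_rep f x"]) (use sU that in blast)
  qed
  have fib: "{x. f x = chart_inv v u} = (\<lambda>x. chart_inv x (s x u)) ` {x. f x = v} \<and>
      inj_on (\<lambda>x. chart_inv x (s x u)) {x. f x = v}" if u: "u \<in> ball (chart v v) r" for u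
  proof
    show "{x. f x = chart_inv v u} = (\<lambda>x. chart_inv x (s x u)) ` {x. f x = v}"
    proof (intro equalityI subsetI)
      fix x' assume "x' \<in> {x. f x = chart_inv v u}"
      then have x': "f x' = chart_inv v u" by simp
      then obtain x t where x: "f x = v" "t \<in> U x" "x' = chart_inv x t" using N[OF u] by blast
      then have "chart_inv v u = chart_inv v (chart_rep f x t)" using Us(4) x' by metis
      then have "u = chart_rep f x t" by (metis chart_chart_inv)
      then have "t = s x u" using Us(8) x by simp
      then show "x' \<in> (\<lambda>x. chart_inv x (s x u)) ` {x. f x = v}" using x by blast
    next
      fix x' assume "x' \<in> (\<lambda>x. chart_inv x (s x u)) ` {x. f x = v}"
      then show "x' \<in> {x. f x = chart_inv v u}" using fs[OF _ u] by blast
    qed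
    show "inj_on (\<lambda>x. chart_inv x (s x u)) {x. f x = v}" using N[OF u] by blast
  qed
  have "even_cover f v r U s"
    unfolding even_cover_def using r Us(1,3,5) sU hs fs stv op fib by blast
  then show ?thesis by blast
qed

section \<open>Rational maps\<close>

text \<open>For \<open>degree p\<close> at most \<open>D\<close> this is the polynomial
  \<open>t ^ D * p (1 / t)\<close>: \<open>p\<close> is regarded as a binary form of degree
  \<open>D\<close> and dehomogenised at infinity. The padding by \<open>monom\<close> keeps
  \<open>p\<close> and \<open>q\<close> at the same degree \<open>D\<close>, so their quotient is
  unaffected.\<close>

definition hrev :: "nat \<Rightarrow> 'a::comm_semiring_1 poly \<Rightarrow> 'a poly" where
  "hrev D p = monom 1 (D - degree p) * reflect_poly p"

definition hpoly :: "nat \<Rightarrow> sphere \<Rightarrow> complex poly \<Rightarrow> complex poly" where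
  "hpoly D x p = (case x of Some _ \<Rightarrow> p | None \<Rightarrow> hrev D p)"

text \<open>The numerator of the derivative of \<open>p / q\<close>; its zeros are the finite
  critical points.\<close>

definition wronskian :: "'a::idom poly \<Rightarrow> 'a poly \<Rightarrow> 'a poly" where
  "wronskian p q = pderiv p * q - p * pderiv q"

lemma poly_hrev:
  fixes p :: "'a::field poly"
  assumes "t \<noteq> 0" "degree p \<le> D"
  shows "poly (hrev D p) t = t ^ D * poly p (1 / t)"
proof -
  have "t ^ D = t ^ (D - degree p) * t ^ degree p"
    using assms(2) by (simp flip: power_add)
  then show ?thesis
    using assms(1) by (simp add: hrev_def poly_reflect_poly_nz poly_monom inverse_eq_divide)
qed

lemma poly_hrev_0:
  assumes "degree p \<le> D"
  shows "poly (hrev D p) 0 = coeff p D"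
proof (cases "degree p = D")
  case False
  then have "degree p < D" using assms by simp
  then show ?thesis by (simp add: hrev_def poly_monom coeff_eq_0 power_0_left)
qed (simp add: hrev_def)

lemma rat_map_Some: "rat_map p q (Some z) = (if poly q z = 0 then None else Some (poly p z / poly q z))"
  by (simp add: rat_map_def)

lemma poly_analytic: "poly (r :: complex poly) analytic_on S"
proof -
  have "poly r holomorphic_on UNIV"
    by (auto simp: holomorphic_on_def field_differentiable_def intro: poly_DERIV)
  then show ?thesis using analytic_on_open analytic_on_subset open_UNIV subset_UNIV by metis
qed

lemma eventually_poly_nonzero: "poly (r::complex poly) t \<noteq> 0 \<Longrightarrow> \<forall>\<^sub>F s in nhds t. poly r s \<noteq> 0"
  using isCont_tendsto_nhds[OF poly_isCont[of t r]] by (rule tendsto_imp_eventually_ne)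

locale rational =
  fixes p q :: "complex poly" and D :: nat
  assumes q0: "q \<noteq> 0" and cop: "coprime p q" and deg: "max (degree p) (degree q) = D" and D1: "D \<ge> 1"
begin

abbreviation f :: "sphere \<Rightarrow> sphere" where "f \<equiv> rat_map p q"

lemma degs: "degree p \<le> D" "degree q \<le> D" "degree p = D \<or> degree q = D"
  using deg by auto

text \<open>In the chart at infinity the map is again given by two polynomials without common zero.
  This is what allows finite and infinite points to be handled by the same formulas in all that
  follows.\<close>

lemma f_chart_inv: "f (chart_inv x t) = rat_map (hpoly D x p) (hpoly D x q) (Some t)"
proof (cases x)
  case [simp]: None
  show ?thesis
  proof (cases "t = 0")
    case [simp]: True
    have "coeff q D = 0 \<longleftrightarrow> degree q < D" using q0 degs by (metis coeff_eq_0 leading_coeff_0_iff le_neq_implies_less nat_neq_iff)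
    then show ?thesis using degs q0
      by (auto simp: rat_map_def hpoly_def poly_hrev_0)
  next
    case False
    then show ?thesis using degs by (simp add: chart_inv_None rat_map_def hpoly_def poly_hrev)
  qed
qed (simp add: hpoly_def)

lemma hpoly_no_common: "poly (hpoly D x p) t \<noteq> 0 \<or> poly (hpoly D x q) t \<noteq> 0"
proof (cases x)
  case [simp]: None
  show ?thesis
  proof (cases "t = 0")
    case True
    have "coeff p D \<noteq> 0 \<or> coeff q D \<noteq> 0"
      using degs D1 by (metis degree_0 leading_coeff_0_iff not_one_le_zero)
    then show ?thesis using True degs by (simp add: hpoly_def poly_hrev_0)
  next
    case False
    then show ?thesis using degs coprime_poly_0[OF cop, of "1/t"] by (simp add: hpoly_def poly_hrev)
  qed
qed (use coprime_poly_0[OF cop] in \<open>simp add: hpoly_def\<close>)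

lemma f_eq_None_iff: "f x = None \<longleftrightarrow> poly (hpoly D x q) (chart x x) = 0"
  using f_chart_inv[of x "chart x x"] by (simp add: rat_map_Some)

lemma chart_rep_f:
  "chart_rep f x t = (if f x = None then poly (hpoly D x q) t / poly (hpoly D x p) t
     else poly (hpoly D x p) t / poly (hpoly D x q) t)"
proof (cases "f x")
  case None
  then show ?thesis by (simp add: chart_rep_def f_chart_inv rat_map_Some)
next
  case (Some c)
  then show ?thesis by (simp add: chart_rep_def f_chart_inv rat_map_Some)
qed

lemma chart_rep_f_denom:
  "f x = None \<Longrightarrow> poly (hpoly D x p) (chart x x) \<noteq> 0"
  "f x \<noteq> None \<Longrightarrow> poly (hpoly D x q) (chart x x) \<noteq> 0"
  using hpoly_no_common[of x "chart x x"] by (auto simp: f_eq_None_iff)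

lemma f_in_dom: "\<forall>\<^sub>F t in nhds (chart x x). f (chart_inv x t) \<in> chart_dom (f x)"
proof (cases "f x")
  case None
  have "poly (hpoly D x p) (chart x x) \<noteq> 0" using None chart_rep_f_denom by blast
  from eventually_poly_nonzero[OF this] show ?thesis
    by eventually_elim (auto simp: None chart_dom_def f_chart_inv rat_map_Some)
next
  case (Some c)
  have "poly (hpoly D x q) (chart x x) \<noteq> 0" using Some chart_rep_f_denom by blast
  from eventually_poly_nonzero[OF this] show ?thesis
    by eventually_elim (auto simp: Some chart_dom_def f_chart_inv rat_map_Some)
qed

lemma analytic_rep: "chart_rep f x analytic_on {chart x x}"
proof -
  have "chart_rep f x = (if f x = None then (\<lambda>t. poly (hpoly D x q) t / poly (hpoly D x p) t)
     else (\<lambda>t. poly (hpoly D x p) t / poly (hpoly D x q) t))"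
    by (auto simp: chart_rep_f)
  then show ?thesis using chart_rep_f_denom[of x]
    by (auto intro!: analytic_intros poly_analytic)
qed

lemma sph_holo_f: "sph_holo f"
  unfolding sph_holo_def
proof (intro allI conjI analytic_rep)
  fix x
  have "isCont (chart_rep f x) (chart x x)"
    using analytic_rep[of x] analytic_at_imp_isCont by blast
  from isCont_tendsto_nhds[OF this]
  have "(chart_rep f x \<longlongrightarrow> chart (f x) (f x)) (nhds (chart x x))" by simp
  moreover have "(chart_inv (f x) \<longlongrightarrow> f x) (nhds (chart (f x) (f x)))"
    using isCont_tendsto_nhds[OF isCont_chart_inv[where a = "f x" and t = "chart (f x) (f x)"]] by simp
  ultimately have "((\<lambda>t. chart_inv (f x) (chart_rep f x t)) \<longlongrightarrow> f x) (nhds (chart x x))"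
    using filterlim_compose by blast
  moreover have "\<forall>\<^sub>F t in nhds (chart x x). chart_inv (f x) (chart_rep f x t) = f (chart_inv x t)"
    using f_in_dom[of x] by eventually_elim (simp add: chart_rep_def)
  ultimately have "((\<lambda>t. f (chart_inv x t)) \<longlongrightarrow> f x) (nhds (chart x x))"
    by (simp cong: tendsto_cong)
  then have "(f \<longlongrightarrow> f x) (nhds x)"
    by (simp add: nhds_chart[of x x] filterlim_filtermap)
  then show "isCont f x" by (simp add: isCont_def tendsto_at_iff_tendsto_nhds)
qed

lemma sphere_deriv_f:
  "sphere_deriv f x = (if f x = None then - poly (wronskian (hpoly D x p) (hpoly D x q)) (chart x x) / (poly (hpoly D x p) (chart x x))\<^sup>2
     else poly (wronskian (hpoly D x p) (hpoly D x q)) (chart x x) / (poly (hpoly D x q) (chart x x))\<^sup>2)"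
proof -
  have "chart_rep f x = (if f x = None then (\<lambda>t. poly (hpoly D x q) t / poly (hpoly D x p) t)
     else (\<lambda>t. poly (hpoly D x p) t / poly (hpoly D x q) t))"
    by (auto simp: chart_rep_f)
  moreover have "((\<lambda>t. poly a t / poly b t) has_field_derivative
        (poly (pderiv a) t * poly b t - poly a t * poly (pderiv b) t) / (poly b t)\<^sup>2) (at t)"
    if "poly b t \<noteq> 0" for a b :: "complex poly" and t
    using that by (auto intro!: derivative_eq_intros simp: power2_eq_square)
  ultimately show ?thesis using chart_rep_f_denom[of x]
    unfolding sphere_deriv_rep by (auto simp: wronskian_def DERIV_imp_deriv algebra_simps minus_divide_left)
qed

lemma critical_iff: "sphere_deriv f x = 0 \<longleftrightarrow> poly (wronskian (hpoly D x p) (hpoly D x q)) (chart x x) = 0"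
  using chart_rep_f_denom[of x] by (auto simp: sphere_deriv_f)

lemma critical_Some_iff: "sphere_deriv f (Some z) = 0 \<longleftrightarrow> poly (wronskian p q) z = 0"
  by (simp add: critical_iff hpoly_def)

lemma f_Some_eq_iff: "f (Some z) = Some y \<longleftrightarrow> poly (p - smult y q) z = 0"
  using coprime_poly_0[OF cop, of z] by (auto simp: rat_map_Some field_simps)

lemma f_Some_None_iff: "f (Some z) = None \<longleftrightarrow> poly q z = 0"
  by (simp add: rat_map_Some)

lemma pencil_nonzero: "p - smult y q \<noteq> 0"
proof
  assume "p - smult y q = 0"
  then have pq: "p = smult y q" by simp
  then have "q dvd p" by (simp add: dvd_smult)
  then have "is_unit q" using cop by (metis coprime_absorb_right)
  then have "degree q = 0" by (simp add: is_unit_iff_degree[OF q0])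
  moreover have "degree p \<le> degree q" using pq by simp
  ultimately show False using deg D1 by simp
qed

lemma finite_fibre: "finite {x. f x = v}"
proof -
  have fin: "finite {z. f (Some z) = v}"
  proof (cases v)
    case None
    then show ?thesis using q0 by (simp add: f_Some_None_iff poly_roots_finite)
  next
    case (Some y)
    show ?thesis unfolding Some f_Some_eq_iff using poly_roots_finite[OF pencil_nonzero] .
  qed
  have "{x. f x = v} \<subseteq> insert None (Some ` {z. f (Some z) = v})"
  proof
    fix x assume "x \<in> {x. f x = v}"
    then show "x \<in> insert None (Some ` {z. f (Some z) = v})" by (cases x) auto
  qed
  then show ?thesis using fin finite_subset by blast
qed

lemma card_fibre_le: "card {z. f (Some z) = Some y} \<le> D"
  unfolding f_Some_eq_iff
  by (rule order_trans[OF card_poly_roots_bound[OF pencil_nonzero]])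
     (rule degree_diff_le, use degs in \<open>auto intro: order_trans[OF degree_smult_le]\<close>)

text \<open>If the Wronskian vanishes, coprimality makes \<open>q\<close> divide its own derivative,
  which in characteristic zero forces \<open>q\<close> to be constant; then \<open>p\<close> is
  constant too, against \<open>D1\<close>.\<close>

lemma wronskian_nonzero: "wronskian p q \<noteq> 0"
proof
  assume "wronskian p q = 0"
  then have eq: "pderiv p * q = p * pderiv q" by (simp add: wronskian_def)
  have "q dvd p * pderiv q" by (metis eq dvd_triv_right)
  then have "q dvd pderiv q" using cop by (metis coprime_commute coprime_dvd_mult_right_iff)
  then have q': "pderiv q = 0" using not_dvd_pderiv[of q] by (metis pderiv_eq_0_iff)
  then have "pderiv p = 0" using eq q0 by simp
  with q' have "degree p = 0" "degree q = 0" by (auto simp: pderiv_eq_0_iff)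
  with deg D1 show False by simp
qed

lemma generic_fibre_card: "\<forall>\<^sub>\<infinity>y. card {z. f (Some z) = Some y} = D"
proof -
  \<comment> \<open>The finite critical values, where \<open>p - smult y q\<close> has a double
    root, and the value at infinity, where its degree drops below \<open>D\<close>.\<close>
  let ?bad = "(\<lambda>z. poly p z / poly q z) ` {z. poly (wronskian p q) z = 0} \<union> {y. coeff p D = y * coeff q D}"
  have "coeff p D \<noteq> 0 \<or> coeff q D \<noteq> 0"
    using degs D1 by (metis degree_0 leading_coeff_0_iff not_one_le_zero)
  then have "{y. coeff p D = y * coeff q D} \<subseteq> {coeff p D / coeff q D}"
    by (cases "coeff q D = 0") auto
  then have "finite {y. coeff p D = y * coeff q D}"
    by (rule finite_subset) simp
  then have "finite ?bad" using poly_roots_finite[OF wronskian_nonzero] by simp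
  moreover have "card {z. f (Some z) = Some y} = D" if "y \<notin> ?bad" for y
  proof -
    let ?r = "p - smult y q"
    have deg: "degree ?r = D"
    proof (rule antisym)
      show "degree ?r \<le> D" by (rule degree_diff_le, use degs in \<open>auto intro: order_trans[OF degree_smult_le]\<close>)
      show "D \<le> degree ?r" by (rule le_degree) (use that in auto)
    qed
    have rsf: "rsquarefree ?r"
      unfolding rsquarefree_roots
    proof (intro allI notI, elim conjE)
      fix z assume z: "poly ?r z = 0" "poly (pderiv ?r) z = 0"
      have "f (Some z) = Some y" using z f_Some_eq_iff by blast
      then have "poly q z \<noteq> 0" "y = poly p z / poly q z" by (auto simp: rat_map_Some split: if_splits)
      moreover have "poly (wronskian p q) z = 0"
        using z by (simp add: wronskian_def pderiv_diff pderiv_smult)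
      ultimately show False using that by blast
    qed
    have "degree ?r = degree (smult (lead_coeff ?r) (\<Prod>z|poly ?r z = 0. [:-z, 1:]))"
      by (subst complex_poly_decompose_rsquarefree[OF rsf]) simp
    also have "\<dots> = card {z. poly ?r z = 0}"
    proof -
      have "lead_coeff ?r \<noteq> 0" using pencil_nonzero[of y] by (simp only: leading_coeff_0_iff not_False_eq_True)
      then show ?thesis by (subst degree_smult_eq) (simp add: degree_prod_sum_eq)
    qed
    finally show ?thesis using deg by (simp add: f_Some_eq_iff)
  qed
  then have "{y. card {z. f (Some z) = Some y} \<noteq> D} \<subseteq> ?bad" by blast
  ultimately show ?thesis
    unfolding eventually_cofinite using finite_subset by blast
qed

end

lemma rational_mapE:
  assumes "rational_map D f" "D \<ge> 1"
  obtains p q where "rational p q D" "f = rat_map p q"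
  using assms unfolding rational_map_def rational_def by blast

section \<open>Quadratic differentials with simple poles and their push-forward\<close>

section \<open>Rational functions and quadratic differentials\<close>

abbreviation rf_num :: "quad_diff \<Rightarrow> complex poly" where "rf_num q \<equiv> fst (quot_of_fract q)"
abbreviation rf_den :: "quad_diff \<Rightarrow> complex poly" where "rf_den q \<equiv> snd (quot_of_fract q)"

lemma rf_den_nonzero [simp]: "rf_den q \<noteq> 0"
  by simp

lemma Fract_num_den: "Fract (rf_num q) (rf_den q) = q"
  by (metis Fract_quot_of_fract)

lemma rf_coprime: "coprime (rf_num q) (rf_den q)"
  by (rule coprime_quot_of_fract)

lemma rf_eval_Fract:
  assumes "B \<noteq> 0" "poly B z \<noteq> 0"
  shows "rf_eval (Fract A B) z = poly A z / poly B z" and "poly (rf_den (Fract A B)) z \<noteq> 0"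
proof -
  let ?q = "Fract A B"
  have "Fract (rf_num ?q) (rf_den ?q) = Fract A B" by (rule Fract_num_den)
  then have eq: "rf_num ?q * B = A * rf_den ?q"
    using assms(1) eq_fract(1) rf_den_nonzero by blast
  then have "rf_den ?q dvd rf_num ?q * B" by simp
  then have "rf_den ?q dvd B"
    using rf_coprime[of ?q] by (metis coprime_commute coprime_dvd_mult_right_iff)
  then show *: "poly (rf_den ?q) z \<noteq> 0" using assms(2) by (metis dvdE mult_eq_0_iff poly_mult)
  have "poly (rf_num ?q) z * poly B z = poly A z * poly (rf_den ?q) z"
    using eq by (metis poly_mult)
  then show "rf_eval ?q z = poly A z / poly B z"
    using assms * by (simp add: rf_eval_def field_simps)
qed

lemma rf_eval_0 [simp]: "rf_eval 0 z = 0"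
  by (simp add: rf_eval_def)

lemma cofinite_poly_nonzero: "p \<noteq> 0 \<Longrightarrow> \<forall>\<^sub>\<infinity>z. poly p z \<noteq> (0::complex)"
  by (simp add: eventually_cofinite poly_roots_finite)

lemma rf_eval_eqI:
  assumes "\<forall>\<^sub>\<infinity>z. rf_eval q z = rf_eval r z"
  shows "q = r"
proof -
  have "\<forall>\<^sub>\<infinity>z. poly (rf_num q * rf_den r - rf_num r * rf_den q) z = 0"
    using assms cofinite_poly_nonzero[OF rf_den_nonzero[of q]] cofinite_poly_nonzero[OF rf_den_nonzero[of r]]
    by eventually_elim (simp add: rf_eval_def field_simps)
  moreover have "\<not> (\<forall>\<^sub>\<infinity>z::complex. False)"
    by (simp add: eventually_cofinite infinite_UNIV_char_0)
  moreover have "\<forall>\<^sub>\<infinity>z::complex. False"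
    if "\<forall>\<^sub>\<infinity>z. poly s z = 0" "s \<noteq> 0" for s :: "complex poly"
    using that(1) cofinite_poly_nonzero[OF that(2)] by eventually_elim simp
  ultimately have "rf_num q * rf_den r - rf_num r * rf_den q = 0"
    by blast
  then have "Fract (rf_num q) (rf_den q) = Fract (rf_num r) (rf_den r)"
    unfolding eq_fract(1)[OF rf_den_nonzero rf_den_nonzero] by simp
  then show ?thesis unfolding Fract_num_den .
qed

lemma rf_eval_add: "\<forall>\<^sub>\<infinity>z. rf_eval (q + r) z = rf_eval q z + rf_eval r z"
proof -
  have eq: "q + r = Fract (rf_num q * rf_den r + rf_num r * rf_den q) (rf_den q * rf_den r)"
    by (metis Fract_num_den add_fract rf_den_nonzero)
  show ?thesis
    using cofinite_poly_nonzero[OF rf_den_nonzero[of q]] cofinite_poly_nonzero[OF rf_den_nonzero[of r]]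
  proof eventually_elim
    case (elim z)
    have "rf_eval (q + r) z = poly (rf_num q * rf_den r + rf_num r * rf_den q) z / poly (rf_den q * rf_den r) z"
      unfolding eq by (rule rf_eval_Fract) (use elim in auto)
    then show ?case using elim by (simp add: rf_eval_def add_frac_eq)
  qed
qed

lemma rf_eval_scale: "\<forall>\<^sub>\<infinity>z. rf_eval (qd_scale c q) z = c * rf_eval q z"
proof -
  have eq: "qd_scale c q = Fract ([:c:] * rf_num q) (1 * rf_den q)"
    by (metis Fract_num_den qd_scale_def mult_fract)
  show ?thesis
    using cofinite_poly_nonzero[OF rf_den_nonzero[of q]]
  proof eventually_elim
    case (elim z)
    have "rf_eval (qd_scale c q) z = poly ([:c:] * rf_num q) z / poly (1 * rf_den q) z"
      unfolding eq by (rule rf_eval_Fract) (use elim in auto)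
    then show ?case by (simp add: rf_eval_def)
  qed
qed

text \<open>The square of dz/dw for the chart coordinate w, expressed in z: with
  \<open>w = 1 / z\<close> it is \<open>1 / w ^ 4 = z ^ 4\<close>.\<close>

definition qd_jac :: "sphere \<Rightarrow> complex \<Rightarrow> complex" where
  "qd_jac x z = (case x of Some _ \<Rightarrow> 1 | None \<Rightarrow> z ^ 4)"

lemma qd_coeff_jac: "chart_inv x t = Some z \<Longrightarrow> qd_coeff q x t = rf_eval q z * qd_jac x z"
  by (cases x) (auto simp: qd_coeff_def qd_jac_def chart_inv_None power_one_over split: if_splits)

lemma cofinite_avoid: "\<forall>\<^sub>\<infinity>z. P z \<Longrightarrow> \<forall>\<^sub>F t in at (a::complex). P t"
proof -
  assume "\<forall>\<^sub>\<infinity>z. P z"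
  then have "finite ({z. \<not> P z} - {a})" by (simp add: eventually_cofinite)
  then have "\<forall>\<^sub>F t in nhds a. t \<in> - ({z. \<not> P z} - {a})"
    by (intro eventually_nhds_in_open open_Compl finite_imp_closed) auto
  then show ?thesis by (auto simp: eventually_at_filter elim: eventually_mono)
qed

text \<open>The bridge from identities between rational functions, which hold off a finite set, to
  punctured neighbourhoods of an arbitrary point of the sphere.\<close>

lemma cofinite_chart_inv:
  assumes "\<forall>\<^sub>\<infinity>z. P z"
  shows "\<forall>\<^sub>F t in at (chart x x). \<exists>z. chart_inv x t = Some z \<and> P z"
proof (cases x)
  case (Some c)
  show ?thesis using cofinite_avoid[OF assms, of c] by (simp add: Some)
next
  case None
  have "finite (inverse ` {z. \<not> P z})" using assms by (simp add: eventually_cofinite)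
  then have "\<forall>\<^sub>\<infinity>t. t \<notin> inverse ` {z. \<not> P z}" by (simp add: eventually_cofinite)
  from cofinite_avoid[OF this, of 0]
  have "\<forall>\<^sub>F t in at 0. t \<notin> inverse ` {z. \<not> P z}" .
  moreover have "\<forall>\<^sub>F t in at (0::complex). t \<noteq> 0" by (simp add: eventually_at_filter)
  ultimately show ?thesis unfolding None chart_simps
  proof eventually_elim
    case (elim t)
    have "P (inverse t)" using elim(1) by (metis (mono_tags) image_eqI inverse_inverse_eq mem_Collect_eq)
    then show ?case using elim(2) by (simp add: chart_inv_None inverse_eq_divide)
  qed
qed

lemma qd_coeff_add: "\<forall>\<^sub>F t in at (chart x x). qd_coeff (q + r) x t = qd_coeff q x t + qd_coeff r x t"
  using cofinite_chart_inv[OF rf_eval_add[of q r], of x]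
  by eventually_elim (auto simp: qd_coeff_jac algebra_simps)

lemma qd_coeff_scale: "\<forall>\<^sub>F t in at (chart x x). qd_coeff (qd_scale c q) x t = c * qd_coeff q x t"
  using cofinite_chart_inv[OF rf_eval_scale[of c q], of x]
  by eventually_elim (auto simp: qd_coeff_jac algebra_simps)

lemma qd_coeff_0 [simp]: "qd_coeff 0 x t = 0"
  by (simp add: qd_coeff_def split: option.splits)

text \<open>The order is read off from a local normal form: a quotient of polynomials nonvanishing
  at the centre, times a power of the coordinate. At infinity the two polynomials are the reflected
  ones, and the summand -4 is the pole of (dz)^2.\<close>

lemma qd_order_expansion:
  assumes "q \<noteq> 0"
  shows "qd_order q x = (case x of Some z \<Rightarrow> int (order z (rf_num q)) - int (order z (rf_den q))
      | None \<Rightarrow> int (degree (rf_den q)) - int (degree (rf_num q)) - 4)" (is "_ = ?n")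
    and "\<exists>h. isCont h (chart x x) \<and> h (chart x x) \<noteq> 0 \<and>
     (\<forall>\<^sub>F t in at (chart x x). qd_coeff q x t = h t * (t - chart x x) powi qd_order q x)"
proof -
  have *: "\<exists>A B. poly A (chart x x) \<noteq> 0 \<and> poly B (chart x x) \<noteq> 0 \<and>
     (\<forall>\<^sub>F t in at (chart x x). qd_coeff q x t = poly A t / poly B t * (t - chart x x) powi ?n)"
  proof (cases x)
    case (Some z)
    obtain A where A: "rf_num q = [:-z,1:] ^ order z (rf_num q) * A" "\<not> [:-z, 1:] dvd A"
      using order_decomp[of "rf_num q" z] assms by auto
    obtain B where B: "rf_den q = [:-z,1:] ^ order z (rf_den q) * B" "\<not> [:-z, 1:] dvd B"
      using order_decomp[of "rf_den q" z] by auto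
    have "\<forall>\<^sub>F t in at z. t \<noteq> z" by (simp add: eventually_at_filter)
    then have "\<forall>\<^sub>F t in at z. rf_eval q t = poly A t / poly B t * (t - z) powi (int (order z (rf_num q)) - int (order z (rf_den q)))"
    proof eventually_elim
      case (elim t)
      have "rf_eval q t = poly ([:-z,1:] ^ order z (rf_num q) * A) t / poly ([:-z,1:] ^ order z (rf_den q) * B) t"
        unfolding rf_eval_def using A(1) B(1) by metis
      then show ?case using elim by (simp add: power_int_diff mult.commute)
    qed
    then show ?thesis using A B unfolding Some
      by (intro exI[of _ A] exI[of _ B]) (simp add: qd_coeff_def poly_eq_0_iff_dvd)
  next
    case None
    have "\<forall>\<^sub>F t in at (0::complex). t \<noteq> 0" by (simp add: eventually_at_filter)
    then have "\<forall>\<^sub>F t in at 0. rf_eval q (1 / t) / t ^ 4 = poly (reflect_poly (rf_num q)) t / poly (reflect_poly (rf_den q)) t *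
       t powi (int (degree (rf_den q)) - int (degree (rf_num q)) - 4)"
    proof eventually_elim
      case (elim t)
      let ?a = "degree (rf_num q)" and ?b = "degree (rf_den q)"
      have "int ?b - int ?a - 4 = int ?b - int (?a + 4)" by simp
      then have "t powi (int ?b - int ?a - 4) = t powi (int ?b - int (?a + 4))" by (simp only:)
      also have "\<dots> = t ^ ?b / (t ^ ?a * t ^ 4)"
        using elim by (subst power_int_diff) (simp_all add: power_add del: of_nat_add)
      finally show ?case
        using elim by (simp add: rf_eval_def poly_reflect_poly_nz inverse_eq_divide)
    qed
    then show ?thesis using assms unfolding None
      by (intro exI[of _ "reflect_poly (rf_num q)"] exI[of _ "reflect_poly (rf_den q)"]) (simp add: qd_coeff_def)
  qed
  then obtain A B where AB: "poly A (chart x x) \<noteq> 0" "poly B (chart x x) \<noteq> 0"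
     "\<forall>\<^sub>F t in at (chart x x). qd_coeff q x t = poly A t / poly B t * (t - chart x x) powi ?n" by blast
  have "\<forall>\<^sub>F t in nhds (chart x x). poly B t \<noteq> 0 \<and> (t \<noteq> chart x x \<longrightarrow> qd_coeff q x t = poly A t / poly B t * (t - chart x x) powi ?n)"
    using eventually_poly_nonzero[OF AB(2)] AB(3)[unfolded eventually_at_filter] by eventually_elim auto
  then obtain S where S: "open S" "chart x x \<in> S" "\<And>t. t \<in> S \<Longrightarrow> poly B t \<noteq> 0"
    "\<And>t. t \<in> S \<Longrightarrow> t \<noteq> chart x x \<Longrightarrow> qd_coeff q x t = poly A t / poly B t * (t - chart x x) powi ?n"
    unfolding eventually_nhds by blast
  show ord: "qd_order q x = ?n" unfolding qd_order_def
  proof (rule zorder_eqI[OF S(1,2)])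
    show "(\<lambda>t. poly A t / poly B t) holomorphic_on S"
      using S(3) poly_analytic analytic_imp_holomorphic by (intro holomorphic_on_divide) blast+
  qed (use AB S in auto)
  show "\<exists>h. isCont h (chart x x) \<and> h (chart x x) \<noteq> 0 \<and>
     (\<forall>\<^sub>F t in at (chart x x). qd_coeff q x t = h t * (t - chart x x) powi qd_order q x)"
    unfolding ord using AB
    by (intro exI[of _ "\<lambda>t. poly A t / poly B t"]) (auto intro!: continuous_intros)
qed

section \<open>Simple poles and residues\<close>

text \<open>At worst a simple pole, expressed by a limit. Unlike \<open>qd_order\<close> this makes
  sense for the zero differential and passes to sums and multiples without case
  distinctions.\<close>

definition qd_tame :: "quad_diff \<Rightarrow> sphere \<Rightarrow> bool" where
  "qd_tame q x \<longleftrightarrow> ((\<lambda>t. (t - chart x x)\<^sup>2 * qd_coeff q x t) \<longlongrightarrow> 0) (at (chart x x))"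

text \<open>The coefficient of (dt)^2 / t. For quadratic differentials it depends on the coordinate:
  replacing t by a t divides it by a. Hence the residues of a push-forward acquire the factor
  \<open>1 / f'\<close>.\<close>

definition qres :: "quad_diff \<Rightarrow> sphere \<Rightarrow> complex" where
  "qres q x = Lim (at (chart x x)) (\<lambda>t. (t - chart x x) * qd_coeff q x t)"

lemma tendsto_diff_at: "((\<lambda>t. t - a) \<longlongrightarrow> 0) (at (a::complex))"
  using tendsto_diff[OF tendsto_ident_at tendsto_const[of a], of a UNIV] by simp

lemma qd_order_res:
  assumes "q \<noteq> 0" "qd_order q x \<ge> - 1"
  shows "\<exists>l. ((\<lambda>t. (t - chart x x) * qd_coeff q x t) \<longlongrightarrow> l) (at (chart x x)) \<and> (l \<noteq> 0 \<longleftrightarrow> qd_order q x < 0)"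
proof -
  let ?a = "chart x x"
  obtain h where h: "isCont h ?a" "h ?a \<noteq> 0"
     "\<forall>\<^sub>F t in at ?a. qd_coeff q x t = h t * (t - ?a) powi qd_order q x"
    using qd_order_expansion(2)[OF assms(1)] by blast
  define k where "k = nat (qd_order q x + 1)"
  have k: "int k = qd_order q x + 1" using assms by (simp add: k_def)
  have "((\<lambda>t. h t * (t - ?a) ^ k) \<longlongrightarrow> h ?a * 0 ^ k) (at ?a)"
    using h(1) by (intro tendsto_intros tendsto_diff_at) (simp add: isCont_def)
  moreover have "\<forall>\<^sub>F t in at ?a. t \<noteq> ?a" by (simp add: eventually_at_filter)
  with h(3) have "\<forall>\<^sub>F t in at ?a. h t * (t - ?a) ^ k = (t - ?a) * qd_coeff q x t"
  proof eventually_elim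
    case (elim t)
    have "(t - ?a) ^ k = (t - ?a) powi (qd_order q x + 1)" using k by (metis power_int_of_nat)
    also have "\<dots> = (t - ?a) powi qd_order q x * (t - ?a)" using elim(2) by (simp add: power_int_add)
    finally show ?case using elim by simp
  qed
  ultimately have "((\<lambda>t. (t - ?a) * qd_coeff q x t) \<longlongrightarrow> h ?a * 0 ^ k) (at ?a)"
    by (rule Lim_transform_eventually)
  moreover have "h ?a * 0 ^ k \<noteq> 0 \<longleftrightarrow> qd_order q x < 0"
    using h(2) k by (cases "k = 0") auto
  ultimately show ?thesis by blast
qed

lemma qd_tame_iff:
  assumes "q \<noteq> 0"
  shows "qd_tame q x \<longleftrightarrow> qd_order q x \<ge> - 1"
proof
  let ?a = "chart x x"
  assume "qd_order q x \<ge> - 1"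
  from qd_order_res[OF assms this] obtain l where l: "((\<lambda>t. (t - ?a) * qd_coeff q x t) \<longlongrightarrow> l) (at ?a)" by blast
  have "((\<lambda>t. (t - ?a) * ((t - ?a) * qd_coeff q x t)) \<longlongrightarrow> 0 * l) (at ?a)"
    by (intro tendsto_mult tendsto_diff_at l)
  then show "qd_tame q x" by (simp add: qd_tame_def power2_eq_square mult.assoc)
next
  let ?a = "chart x x"
  assume t: "qd_tame q x"
  show "qd_order q x \<ge> - 1"
  proof (rule ccontr)
    assume n: "\<not> qd_order q x \<ge> - 1"
    define k where "k = nat (- 2 - qd_order q x)"
    have k: "int k = - 2 - qd_order q x" using n by (simp add: k_def)
    obtain h where h: "isCont h ?a" "h ?a \<noteq> 0"
       "\<forall>\<^sub>F t in at ?a. qd_coeff q x t = h t * (t - ?a) powi qd_order q x"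
      using qd_order_expansion(2)[OF assms(1)] by blast
    have "((\<lambda>t. ((t - ?a)\<^sup>2 * qd_coeff q x t) * (t - ?a) ^ k) \<longlongrightarrow> 0 * 0 ^ k) (at ?a)"
      using t unfolding qd_tame_def by (intro tendsto_intros tendsto_diff_at)
    moreover have "\<forall>\<^sub>F t in at ?a. t \<noteq> ?a" by (simp add: eventually_at_filter)
    with h(3) have "\<forall>\<^sub>F t in at ?a. ((t - ?a)\<^sup>2 * qd_coeff q x t) * (t - ?a) ^ k = h t"
    proof eventually_elim
      case (elim t)
      have "(t - ?a)\<^sup>2 * (t - ?a) powi qd_order q x * (t - ?a) ^ k = (t - ?a) powi (2 + qd_order q x + int k)"
        using elim(2) by (simp add: power_int_add)
      also have "\<dots> = 1" using k by simp
      finally show ?case using elim(1) by (simp add: mult.assoc mult.left_commute)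
    qed
    ultimately have "(h \<longlongrightarrow> 0 * 0 ^ k) (at ?a)"
      by (rule Lim_transform_eventually)
    then have "(h \<longlongrightarrow> 0) (at ?a)" by simp
    moreover have "(h \<longlongrightarrow> h ?a) (at ?a)" using h(1) by (simp add: isCont_def)
    ultimately show False using h(2) LIM_unique by blast
  qed
qed

lemma qd_tame_0 [simp]: "qd_tame 0 x"
  by (simp add: qd_tame_def)

lemma QD_iff_tame: "q \<in> QD \<longleftrightarrow> (\<forall>x. qd_tame q x)"
proof (cases "q = 0")
  case False
  have "(qd_order q x < 0 \<longrightarrow> qd_order q x = - 1) \<longleftrightarrow> qd_order q x \<ge> - 1" for x by linarith
  then show ?thesis using False by (auto simp: QD_def qd_poles_def qd_tame_iff)
qed (simp add: QD_def qd_poles_def)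

lemma qres_tendsto:
  assumes "q \<in> QD"
  shows "((\<lambda>t. (t - chart x x) * qd_coeff q x t) \<longlongrightarrow> qres q x) (at (chart x x))"
    and "x \<in> qd_poles q \<longleftrightarrow> qres q x \<noteq> 0"
proof -
  let ?a = "chart x x"
  have "\<exists>l. ((\<lambda>t. (t - ?a) * qd_coeff q x t) \<longlongrightarrow> l) (at ?a) \<and> (l \<noteq> 0 \<longleftrightarrow> x \<in> qd_poles q)"
  proof (cases "q = 0")
    case True
    then show ?thesis by (intro exI[of _ 0]) (simp add: qd_poles_def)
  next
    case False
    then have "qd_order q x \<ge> -1" using assms by (simp add: QD_iff_tame qd_tame_iff)
    from qd_order_res[OF False this] show ?thesis using False by (simp add: qd_poles_def)
  qed
  then obtain l where l: "((\<lambda>t. (t - ?a) * qd_coeff q x t) \<longlongrightarrow> l) (at ?a)" "l \<noteq> 0 \<longleftrightarrow> x \<in> qd_poles q" by blast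
  then have "qres q x = l" unfolding qres_def by (intro tendsto_Lim) auto
  with l show "((\<lambda>t. (t - ?a) * qd_coeff q x t) \<longlongrightarrow> qres q x) (at ?a)" "x \<in> qd_poles q \<longleftrightarrow> qres q x \<noteq> 0"
    by auto
qed

lemma qres_eqI:
  "((\<lambda>t. (t - chart x x) * qd_coeff q x t) \<longlongrightarrow> l) (at (chart x x)) \<Longrightarrow> qres q x = l"
  unfolding qres_def by (intro tendsto_Lim) auto

lemma QD_0 [simp]: "0 \<in> QD"
  by (simp add: QD_iff_tame)

lemma qres_0 [simp]: "qres 0 x = 0"
  by (rule qres_eqI) simp

lemma QD_add:
  assumes "q \<in> QD" "r \<in> QD"
  shows "q + r \<in> QD" "qres (q + r) x = qres q x + qres r x"
proof -
  have "qd_tame (q + r) x" for x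
  proof -
    let ?a = "chart x x"
    have "((\<lambda>t. (t - ?a)\<^sup>2 * qd_coeff q x t + (t - ?a)\<^sup>2 * qd_coeff r x t) \<longlongrightarrow> 0 + 0) (at ?a)"
      using assms unfolding QD_iff_tame qd_tame_def by (intro tendsto_add) auto
    moreover have "\<forall>\<^sub>F t in at ?a. (t - ?a)\<^sup>2 * qd_coeff q x t + (t - ?a)\<^sup>2 * qd_coeff r x t = (t - ?a)\<^sup>2 * qd_coeff (q + r) x t"
      using qd_coeff_add[of q r x] by eventually_elim (simp add: algebra_simps)
    ultimately show ?thesis unfolding qd_tame_def
      using Lim_transform_eventually by fastforce
  qed
  then show "q + r \<in> QD" by (simp add: QD_iff_tame)
  show "qres (q + r) x = qres q x + qres r x"
  proof (rule qres_eqI, rule Lim_transform_eventually)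
    show "((\<lambda>t. (t - chart x x) * qd_coeff q x t + (t - chart x x) * qd_coeff r x t) \<longlongrightarrow> qres q x + qres r x) (at (chart x x))"
      by (intro tendsto_add qres_tendsto assms)
    show "\<forall>\<^sub>F t in at (chart x x). (t - chart x x) * qd_coeff q x t + (t - chart x x) * qd_coeff r x t = (t - chart x x) * qd_coeff (q + r) x t"
      using qd_coeff_add[of q r x] by eventually_elim (simp add: algebra_simps)
  qed
qed

lemma QD_scale:
  assumes "q \<in> QD"
  shows "qd_scale c q \<in> QD" "qres (qd_scale c q) x = c * qres q x"
proof -
  have "qd_tame (qd_scale c q) x" for x
  proof -
    let ?a = "chart x x"
    have "((\<lambda>t. c * ((t - ?a)\<^sup>2 * qd_coeff q x t)) \<longlongrightarrow> c * 0) (at ?a)"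
      using assms unfolding QD_iff_tame qd_tame_def by (intro tendsto_mult tendsto_const) auto
    moreover have "\<forall>\<^sub>F t in at ?a. c * ((t - ?a)\<^sup>2 * qd_coeff q x t) = (t - ?a)\<^sup>2 * qd_coeff (qd_scale c q) x t"
      using qd_coeff_scale[of c q x] by eventually_elim (simp add: algebra_simps)
    ultimately show ?thesis unfolding qd_tame_def
      using Lim_transform_eventually by fastforce
  qed
  then show "qd_scale c q \<in> QD" by (simp add: QD_iff_tame)
  show "qres (qd_scale c q) x = c * qres q x"
  proof (rule qres_eqI, rule Lim_transform_eventually)
    show "((\<lambda>t. c * ((t - chart x x) * qd_coeff q x t)) \<longlongrightarrow> c * qres q x) (at (chart x x))"
      by (intro tendsto_mult tendsto_const qres_tendsto assms)
    show "\<forall>\<^sub>F t in at (chart x x). c * ((t - chart x x) * qd_coeff q x t) = (t - chart x x) * qd_coeff (qd_scale c q) x t"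
      using qd_coeff_scale[of c q x] by eventually_elim (simp add: algebra_simps)
  qed
qed

lemma qd_scale_minus: "qd_scale (-1) q = - q"
proof -
  have 1: "[:-1:] = - (1 :: complex poly)"
    by (rule poly_eqI) (auto simp: coeff_pCons split: nat.split)
  have "Fract [:-1:] 1 = - (1 :: quad_diff)"
    unfolding 1 One_fract_def by (rule minus_fract[symmetric])
  then have "qd_scale (-1) q = - 1 * q" unfolding qd_scale_def by (rule arg_cong)
  also have "\<dots> = - q" by (rule mult_minus1)
  finally show ?thesis .
qed

lemma QD_diff:
  assumes "q \<in> QD" "r \<in> QD"
  shows "q - r \<in> QD" "qres (q - r) x = qres q x - qres r x"
  using QD_add[OF assms(1) QD_scale(1)[OF assms(2), of "-1"]] QD_scale(2)[OF assms(2), of "-1"]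
  by (simp_all add: qd_scale_minus)

lemma QD_sum:
  assumes "\<And>i. i \<in> I \<Longrightarrow> q i \<in> QD"
  shows "(\<Sum>i\<in>I. q i) \<in> QD \<and> qres (\<Sum>i\<in>I. q i) x = (\<Sum>i\<in>I. qres (q i) x)"
  using assms
proof (induction I rule: infinite_finite_induct)
  case (insert i I)
  then have "q i \<in> QD" "(\<Sum>i\<in>I. q i) \<in> QD" "qres (\<Sum>i\<in>I. q i) x = (\<Sum>i\<in>I. qres (q i) x)" by auto
  then show ?case using insert.hyps by (simp add: QD_add)
qed auto

lemma finite_qd_poles: "finite (qd_poles q)"
proof (cases "q = 0")
  case False
  have "qd_poles q \<subseteq> insert None (Some ` {z. poly (rf_den q) z = 0})"
  proof
    fix x assume x: "x \<in> qd_poles q"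
    show "x \<in> insert None (Some ` {z. poly (rf_den q) z = 0})"
    proof (cases x)
      case (Some z)
      then have "order z (rf_den q) > 0" using x False by (simp add: qd_poles_def qd_order_expansion(1) split: if_splits)
      then show ?thesis using Some by (auto simp: order_root)
    qed simp
  qed
  then show ?thesis using finite_subset poly_roots_finite[OF rf_den_nonzero, of q] by blast
qed (simp add: qd_poles_def)

text \<open>Simple poles make the denominator squarefree, so its degree is the number of finite
  poles. The order condition at infinity demands degree at least 3, and at least 4 if infinity is
  not a pole; either way there are four poles.\<close>

lemma QD_few_poles:
  assumes "q \<in> QD" "card (qd_poles q) \<le> 3"
  shows "q = 0"
proof (rule ccontr)
  assume q: "q \<noteq> 0"
  let ?A = "rf_num q" and ?B = "rf_den q"
  have ord: "qd_order q x \<ge> -1" for x using assms q by (simp add: QD_iff_tame qd_tame_iff)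
  have num0: "order z ?A = 0" if "poly ?B z = 0" for z
    using coprime_poly_0[OF rf_coprime[of q], of z] that by (simp add: order_0I)
  have "rsquarefree ?B" unfolding rsquarefree_def
  proof (intro conjI allI)
    fix z
    show "order z ?B = 0 \<or> order z ?B = 1"
      using ord[of "Some z"] num0[of z] q by (cases "poly ?B z = 0") (auto simp: qd_order_expansion(1) order_0I)
  qed simp
  then have "degree ?B = degree (smult (lead_coeff ?B) (\<Prod>z|poly ?B z = 0. [:-z, 1:]))"
    by (subst complex_poly_decompose_rsquarefree) auto
  also have "\<dots> = card {z. poly ?B z = 0}"
    by (subst degree_smult_eq) (simp add: degree_prod_sum_eq)
  also have "\<dots> = card (Some ` {z. poly ?B z = 0})" by (simp add: card_image)
  finally have deg: "degree ?B = card (Some ` {z. poly ?B z = 0})" .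
  have sub: "Some ` {z. poly ?B z = 0} \<subseteq> qd_poles q - {None}"
  proof
    fix x assume "x \<in> Some ` {z. poly ?B z = 0}"
    then obtain z where z: "x = Some z" "poly ?B z = 0" by blast
    then have "order z ?B > 0" by (simp add: order_root)
    then show "x \<in> qd_poles q - {None}" using z q num0[of z] by (simp add: qd_poles_def qd_order_expansion(1))
  qed
  have le: "degree ?B \<le> card (qd_poles q - {None})"
    unfolding deg by (rule card_mono[OF _ sub]) (simp add: finite_qd_poles)
  have inf: "int (degree ?B) - int (degree ?A) - 4 \<ge> -1" using ord[of None] q by (simp add: qd_order_expansion(1))
  show False
  proof (cases "None \<in> qd_poles q")
    case True
    then have "card (qd_poles q - {None}) < card (qd_poles q)" by (intro card_Diff1_less finite_qd_poles)
    then show False using le inf assms(2) by linarith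
  next
    case False
    then have "qd_order q None \<ge> 0" using q by (simp add: qd_poles_def)
    then show False using le assms(2) False q by (simp add: qd_order_expansion(1))
  qed
qed

text \<open>The differential is (dz)^2 divided by the product of \<open>z - u\<close> over the
  finite points \<open>u\<close> of \<open>S\<close>. The order at infinity comes out right by
  itself: it is 3 - 4 or 4 - 4 according to whether infinity belongs to \<open>S\<close>.\<close>

lemma QD_four_poles:
  assumes "card S = 4"
  obtains q where "q \<in> QD" "qd_poles q = S"
proof -
  have finS: "finite S" using assms card.infinite by force
  define F where "F = Some -` S"
  have F: "finite F" unfolding F_def using finS by (intro finite_vimageI) auto
  define N where "N = (\<Prod>u\<in>F. [:-u, 1::complex:])"
  have N0: "N \<noteq> 0" using F by (simp add: N_def)
  have degN: "degree N = card F" using F by (simp add: N_def degree_prod_sum_eq)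
  have ordN: "order z N = (if z \<in> F then 1 else 0)" for z
  proof -
    have "order z N = (\<Sum>u\<in>F. order z [:-u, 1:])" unfolding N_def using F
    proof (induction F rule: finite_induct)
      case (insert x F)
      have "order z ([:-x, 1:] * (\<Prod>u\<in>F. [:- u, 1:])) = order z [:-x, 1:] + order z (\<Prod>u\<in>F. [:- u, 1:])"
        by (rule order_mult) (use insert.hyps in \<open>simp del: mult_pCons_left\<close>)
      then show ?case using insert by (simp del: mult_pCons_left)
    qed simp
    also have "\<dots> = (\<Sum>u\<in>F. if z = u then 1 else 0)"
    proof (intro sum.cong refl)
      fix u show "order z [:-u, 1:] = (if z = u then 1 else 0)"
        using order_power_n_n[of z 1] by (auto intro: order_0I)
    qed
    finally show ?thesis using F by simp
  qed
  have S_eq: "S = Some ` F \<union> (S \<inter> {None})"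
  proof (rule set_eqI)
    fix x show "x \<in> S \<longleftrightarrow> x \<in> Some ` F \<union> (S \<inter> {None})" by (cases x) (auto simp: F_def)
  qed
  have "card S = card (Some ` F) + card (S \<inter> {None})"
    using F by (subst S_eq, subst card_Un_disjoint) auto
  then have cF: "card F = (if None \<in> S then 3 else 4)" using assms by (auto simp: card_image split: if_splits)
  define q where "q = Fract 1 N"
  have q0: "q \<noteq> 0" using N0 by (simp add: q_def Zero_fract_def eq_fract)
  have eqN: "rf_num q * N = rf_den q"
    using Fract_num_den[of q] N0 by (metis q_def eq_fract(1) mult_1 rf_den_nonzero mult.commute)
  have "rf_num q dvd rf_den q" using eqN by (metis dvd_triv_left)
  then have "is_unit (rf_num q)" using rf_coprime[of q] coprime_absorb_left by blast
  then have dn: "degree (rf_num q) = 0" "rf_num q \<noteq> 0"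
    using q0 is_unit_iff_degree[of "rf_num q"] by auto
  have on: "order z (rf_num q) = 0" for z
    using order_degree[OF dn(2), of z] dn(1) by simp
  have ord: "qd_order q x = (if x \<in> S then -1 else 0)" for x
  proof (cases x)
    case (Some z)
    have "order z (rf_den q) = order z N" using eqN dn N0 on by (metis add_0 no_zero_divisors order_mult)
    then show ?thesis using Some q0 by (simp add: qd_order_expansion(1) on ordN F_def)
  next
    case None
    have "degree (rf_den q) = degree N" using eqN dn N0 by (metis add_0 degree_mult_eq)
    then show ?thesis using None q0 cF by (simp add: qd_order_expansion(1) dn degN)
  qed
  show ?thesis
  proof (rule that[of q])
    show "q \<in> QD" using q0 by (simp add: QD_iff_tame qd_tame_iff ord)
    show "qd_poles q = S" using q0 by (auto simp: qd_poles_def ord)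
  qed
qed

section \<open>The pushforward operator\<close>

lemma DERIV_transfer:
  assumes "(F has_field_derivative d) (at t)" "\<forall>\<^sub>F u in nhds t. F u = G u"
  shows "(G has_field_derivative d) (at t)"
  by (rule iffD1[OF DERIV_cong_ev[OF refl assms(2) refl] assms(1)])

text \<open>If \<open>F t - F a\<close> vanishes to order n at \<open>a\<close>, the quotient tends
  to 1 / n. It therefore stays bounded at critical points too, where \<open>deriv F\<close> alone
  would spoil the estimates for the push-forward.\<close>

lemma log_deriv_limit:
  fixes F :: "complex \<Rightarrow> complex"
  assumes F: "F analytic_on {a}" and nc: "\<not> (\<forall>\<^sub>F t in nhds a. F t = F a)"
  shows "\<exists>l. ((\<lambda>t. (F t - F a) / (deriv F t * (t - a))) \<longlongrightarrow> l) (at a)"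
proof -
  obtain r where r: "r > 0" "F holomorphic_on ball a r"
    using F by (auto simp: analytic_on_def)
  let ?G = "\<lambda>t. F t - F a"
  have nc': "\<exists>w\<in>ball a r. ?G w \<noteq> 0"
  proof (rule ccontr)
    assume "\<not> ?thesis"
    then have eq: "F t = F a" if "t \<in> ball a r" for t using that by simp
    have "\<forall>\<^sub>F t in nhds a. t \<in> ball a r" using r(1) by (intro eventually_nhds_in_open) auto
    then have "\<forall>\<^sub>F t in nhds a. F t = F a" by eventually_elim (rule eq)
    with nc show False by blast
  qed
  have holG: "?G holomorphic_on ball a r" using r by (intro holomorphic_intros)
  define g where "g = zor_poly ?G a"
  define n where "n = zorder ?G a"
  have "n > 0 \<and> (\<exists>s. s>0 \<and> cball a s \<subseteq> ball a r \<and> g holomorphic_on cball a s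
    \<and> (\<forall>w\<in>cball a s. ?G w  = g w * (w-a) ^ nat n \<and> g w \<noteq> 0))"
    using zorder_exist_zero[OF holG open_ball connected_ball _ nc'] r(1) unfolding g_def n_def by simp
  then obtain s where n: "n > 0" and s: "s > 0" "cball a s \<subseteq> ball a r" "g holomorphic_on cball a s"
    "\<And>w. w \<in> cball a s \<Longrightarrow> ?G w = g w * (w - a) ^ nat n \<and> g w \<noteq> 0" by blast
  obtain m where m: "nat n = Suc m" using n by (metis gr0_implies_Suc zero_less_nat_eq)
  have holg: "g holomorphic_on ball a s" using s(3) by (rule holomorphic_on_subset) auto
  have dg: "deriv g holomorphic_on ball a s" by (rule holomorphic_deriv[OF holg open_ball])
  have ga: "g a \<noteq> 0" using s by auto
  have "isCont g a" "isCont (deriv g) a"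
    using continuous_on_eq_continuous_at[OF open_ball, of a s g] continuous_on_eq_continuous_at[OF open_ball, of a s "deriv g"]
      holomorphic_on_imp_continuous_on[OF holg] holomorphic_on_imp_continuous_on[OF dg] s(1) by auto
  then have "((\<lambda>t. g t / (of_nat (Suc m) * g t + (t - a) * deriv g t)) \<longlongrightarrow> g a / (of_nat (Suc m) * g a + 0 * deriv g a)) (at a)"
    using ga by (intro tendsto_intros tendsto_diff_at) (auto simp: isCont_def simp del: of_nat_Suc)
  moreover have "\<forall>\<^sub>F t in at a. g t / (of_nat (Suc m) * g t + (t - a) * deriv g t) = (F t - F a) / (deriv F t * (t - a))"
  proof -
    have "\<forall>\<^sub>F t in nhds a. t \<in> ball a s" using s(1) by (intro eventually_nhds_in_open) auto
    then have "\<forall>\<^sub>F t in at a. t \<in> ball a s \<and> t \<noteq> a" by (auto simp: eventually_at_filter elim: eventually_mono)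
    then show ?thesis
    proof eventually_elim
      case (elim t)
      have "(g has_field_derivative deriv g t) (at t)"
        using holg elim by (meson holomorphic_derivI open_ball)
      then have "((\<lambda>t. g t * (t - a) ^ Suc m + F a) has_field_derivative
          deriv g t * (t - a) ^ Suc m + g t * (of_nat (Suc m) * (t - a) ^ m)) (at t)"
        by (auto intro!: derivative_eq_intros simp del: of_nat_Suc power_Suc)
      moreover have "\<forall>\<^sub>F u in nhds t. g u * (u - a) ^ Suc m + F a = F u"
      proof -
        have "\<forall>\<^sub>F u in nhds t. u \<in> ball a s" using elim by (intro eventually_nhds_in_open) auto
        then show ?thesis
        proof eventually_elim
          case (elim u)
          then have "u \<in> cball a s" by auto
          from s(4)[OF this] show ?case unfolding m by (simp add: algebra_simps)
        qed
      qed
      ultimately have "(F has_field_derivative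
          deriv g t * (t - a) ^ Suc m + g t * (of_nat (Suc m) * (t - a) ^ m)) (at t)"
        by (rule DERIV_transfer)
      then have dF: "deriv F t * (t - a) = (t - a) ^ Suc m * (of_nat (Suc m) * g t + (t - a) * deriv g t)"
        by (simp add: DERIV_imp_deriv algebra_simps del: of_nat_Suc)
      have "F t - F a = g t * (t - a) ^ Suc m" using s(4)[of t] elim unfolding m by auto
      then show ?case unfolding dF using elim by (simp del: of_nat_Suc)
    qed
  qed
  ultimately show ?thesis by (intro exI) (rule Lim_transform_eventually)
qed

lemma chart_None_eq: "chart None s = 1 / chart (Some c) s"
  by (cases s) auto

lemma qd_jac_simps [simp]: "qd_jac (Some c) z = 1" "qd_jac None z = z ^ 4"
  by (simp_all add: qd_jac_def)

context rational
begin

definition push_term :: "quad_diff \<Rightarrow> complex \<Rightarrow> complex" where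
  "push_term w z = rf_eval w z / (sphere_deriv f (Some z))\<^sup>2"

definition push_sum :: "quad_diff \<Rightarrow> complex \<Rightarrow> complex" where
  "push_sum w y = (\<Sum>z | f (Some z) = Some y. push_term w z)"

lemma finite_Some_fibre: "finite {z. f (Some z) = v}"
  using finite_vimageI[OF finite_fibre[of v], of Some] by (simp add: vimage_def)

lemma cofinite_not_value: "\<forall>\<^sub>\<infinity>z. f (Some z) \<noteq> v"
  using finite_Some_fibre[of v] by (simp add: eventually_cofinite)

text \<open>Each summand of the push-forward is independent of coordinates. By the chain rule the
  changes of chart at source and target contribute their derivatives, and these enter squared,
  matching \<open>qd_jac\<close>.\<close>

lemma push_term_chart:
  assumes z: "chart_inv x t = Some z" and y: "f (Some z) = Some y" and z0: "x = None \<Longrightarrow> t \<noteq> 0"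
    and dom: "f (Some z) \<in> chart_dom (f x)"
  shows "push_term w z * qd_jac (f x) y = qd_coeff w x t / (deriv (chart_rep f x) t)\<^sup>2"
    and "chart_rep f x t = chart (f x) (Some y)"
proof -
  let ?g = "chart_rep f (Some z)"
  have g: "?g = (\<lambda>u. chart (Some 0) (f (Some u)))" by (auto simp: chart_rep_def y chart_def)
  define d where "d = sphere_deriv f (Some z)"
  have dg: "(?g has_field_derivative d) (at z)"
    using sph_holo_has_deriv[OF sph_holo_f, of "Some z"] by (simp add: d_def)
  have gz: "?g z = y" by (simp add: g y)
  show rep: "chart_rep f x t = chart (f x) (Some y)" by (simp add: chart_rep_def z y)
  have y0: "y \<noteq> 0" if "f x = None" using dom that y by (simp add: chart_dom_def)
  \<comment> \<open>\<open>b\<close> is dz/dt at the source and \<open>a\<close> is the derivative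
    of the target coordinate with respect to y; the minus signs come from inversion and disappear on
    squaring.\<close>
  define b where "b = (if x = None then - (z ^ 2) else 1)"
  define a where "a = (if f x = None then - (1 / y ^ 2) else 1)"
  define c where "c = (\<lambda>u. if x = None then 1 / u else (u::complex))"
  have zt: "z = c t" and zne: "x = None \<Longrightarrow> z \<noteq> 0" using z z0 by (cases x; auto simp: c_def chart_inv_None split: if_splits)+
  have dc: "(c has_field_derivative b) (at t)"
  proof (cases x)
    case None
    have "((\<lambda>u. 1 / u) has_field_derivative - (1 / t ^ 2)) (at t)"
      using z0[OF None] by (auto intro!: derivative_eq_intros simp: power2_eq_square)
    then show ?thesis using None zt z0 by (simp add: b_def c_def power_divide)
  qed (simp add: b_def c_def)
  have dgc: "((\<lambda>u. ?g (c u)) has_field_derivative d * b) (at t)"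
    using DERIV_chain2[OF _ dc, of ?g d] dg zt by simp
  have dgca: "((\<lambda>u. if f x = None then 1 / ?g (c u) else ?g (c u)) has_field_derivative a * (d * b)) (at t)"
  proof (cases "f x = None")
    case True
    have "((\<lambda>u. 1 / ?g (c u)) has_field_derivative - (d * b / y ^ 2)) (at t)"
    proof -
      have gct: "?g (c t) = y" using gz zt by simp
      have "((\<lambda>u. 1 / ?g (c u)) has_field_derivative (0 * ?g (c t) - 1 * (d * b)) / (?g (c t) * ?g (c t))) (at t)"
        by (rule DERIV_divide[OF DERIV_const dgc]) (simp add: gct y0[OF True])
      then show ?thesis by (simp add: gct power2_eq_square)
    qed
    then show ?thesis using True by (simp add: a_def)
  next
    case False
    show ?thesis using dgc by (simp only: a_def if_not_P[OF False] mult_1)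
  qed
  have "\<forall>\<^sub>F u in nhds t. x = None \<longrightarrow> u \<noteq> 0"
  proof (cases x)
    case None
    have "\<forall>\<^sub>F u in nhds t. u \<in> - {0}" using z0[OF None] by (intro eventually_nhds_in_open) auto
    then show ?thesis by eventually_elim simp
  qed simp
  then have "\<forall>\<^sub>F u in nhds t. (if f x = None then 1 / ?g (c u) else ?g (c u)) = chart_rep f x u"
  proof eventually_elim
    case (elim u)
    have "chart_inv x u = Some (c u)" using elim by (cases x) (auto simp: c_def chart_inv_None)
    then show ?case unfolding g chart_rep_def
      by (cases "f x") (auto simp: chart_None_eq[of _ 0] chart_def[of "Some _"])
  qed
  with dgca have "(chart_rep f x has_field_derivative a * (d * b)) (at t)"
    by (rule DERIV_transfer)
  then have D: "deriv (chart_rep f x) t = a * (d * b)" by (rule DERIV_imp_deriv)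
  have b2: "b\<^sup>2 = qd_jac x z" by (cases x) (auto simp: b_def)
  have a2: "a\<^sup>2 * qd_jac (f x) y = 1" using y0 by (cases "f x") (auto simp: a_def power_divide)
  have jx: "qd_jac x z \<noteq> 0" using zne by (cases x) auto
  have "qd_coeff w x t / (deriv (chart_rep f x) t)\<^sup>2 = rf_eval w z * qd_jac x z / (a\<^sup>2 * (d\<^sup>2 * qd_jac x z))"
    by (simp add: qd_coeff_jac[OF z] D power_mult_distrib b2)
  also have "\<dots> = rf_eval w z / (a\<^sup>2 * d\<^sup>2)" using jx by simp
  also have "\<dots> = rf_eval w z / d\<^sup>2 * qd_jac (f x) y"
  proof -
    have "a\<^sup>2 \<noteq> 0" using a2 by auto
    with a2 have "qd_jac (f x) y = 1 / a\<^sup>2" by (simp add: field_simps)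
    then show ?thesis by simp
  qed
  finally show "push_term w z * qd_jac (f x) y = qd_coeff w x t / (deriv (chart_rep f x) t)\<^sup>2"
    by (simp add: push_term_def d_def)
qed

lemma push_term_chart_ev:
  "\<forall>\<^sub>F t in at (chart x x). \<exists>z y. chart_inv x t = Some z \<and> f (Some z) = Some y \<and>
     chart_rep f x t = chart (f x) (Some y) \<and>
     push_term w z * qd_jac (f x) y = qd_coeff w x t / (deriv (chart_rep f x) t)\<^sup>2"
proof -
  have "\<forall>\<^sub>F t in at (chart x x). t \<noteq> chart x x" by (simp add: eventually_at_filter)
  moreover have "\<forall>\<^sub>F t in at (chart x x). f (chart_inv x t) \<in> chart_dom (f x)"
    using f_in_dom[of x] by (auto simp: eventually_at_filter elim: eventually_mono)
  ultimately show ?thesis using cofinite_chart_inv[OF cofinite_not_value[of None], of x]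
  proof eventually_elim
    case (elim t)
    then obtain z y where zy: "chart_inv x t = Some z" "f (Some z) = Some y" by auto
    have "x = None \<Longrightarrow> t \<noteq> 0" using elim(1) by auto
    from push_term_chart[OF zy this] show ?case using elim(2) zy by auto
  qed
qed

definition push_chart :: "quad_diff \<Rightarrow> sphere \<Rightarrow> complex \<Rightarrow> complex" where
  "push_chart w v s = (case chart_inv v s of Some y \<Rightarrow> push_sum w y * qd_jac v y | None \<Rightarrow> 0)"

lemma chart_rep_not_const: "\<not> (\<forall>\<^sub>F t in nhds (chart x x). chart_rep f x t = chart_rep f x (chart x x))"
proof
  assume "\<forall>\<^sub>F t in nhds (chart x x). chart_rep f x t = chart_rep f x (chart x x)"
  then have "\<forall>\<^sub>F t in nhds (chart x x). f (chart_inv x t) = f x"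
    using f_in_dom[of x] by eventually_elim (metis chart_dom_self chart_eq_iff chart_rep_def chart_rep_self)
  then have "\<forall>\<^sub>F t in at (chart x x). f (chart_inv x t) = f x"
    by (auto simp: eventually_at_filter elim: eventually_mono)
  with cofinite_chart_inv[OF cofinite_not_value[of "f x"], of x]
  have "\<forall>\<^sub>F t in at (chart x x). False" by eventually_elim auto
  then show False by simp
qed

text \<open>The expression is the square of the quotient of \<open>log_deriv_limit\<close> times
  \<open>(t - a)\<^sup>2\<close> times the coefficient of \<open>w\<close>. The first factor
  converges and the second tends to zero by tameness, whether or not \<open>x\<close> is
  critical.\<close>

lemma push_term_small:
  assumes "w \<in> QD"
  shows "((\<lambda>t. (chart_rep f x t - chart_rep f x (chart x x))\<^sup>2 * (qd_coeff w x t / (deriv (chart_rep f x) t)\<^sup>2)) \<longlongrightarrow> 0) (at (chart x x))"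
proof -
  let ?F = "chart_rep f x" and ?a = "chart x x"
  obtain l where l: "((\<lambda>t. (?F t - ?F ?a) / (deriv ?F t * (t - ?a))) \<longlongrightarrow> l) (at ?a)"
    using log_deriv_limit[OF analytic_rep chart_rep_not_const] by blast
  have "((\<lambda>t. ((?F t - ?F ?a) / (deriv ?F t * (t - ?a)))\<^sup>2 * ((t - ?a)\<^sup>2 * qd_coeff w x t)) \<longlongrightarrow> l\<^sup>2 * 0) (at ?a)"
    using assms by (intro tendsto_mult tendsto_power l) (auto simp: QD_iff_tame qd_tame_def)
  moreover have "\<forall>\<^sub>F t in at ?a. t \<noteq> ?a" by (simp add: eventually_at_filter)
  then have "\<forall>\<^sub>F t in at ?a. ((?F t - ?F ?a) / (deriv ?F t * (t - ?a)))\<^sup>2 * ((t - ?a)\<^sup>2 * qd_coeff w x t) =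
     (?F t - ?F ?a)\<^sup>2 * (qd_coeff w x t / (deriv ?F t)\<^sup>2)"
    by eventually_elim (simp add: power_divide power_mult_distrib)
  ultimately show ?thesis using Lim_transform_eventually by fastforce
qed

text \<open>Over a critical value the fibre cannot be followed by single-valued branches, so the
  terms are estimated one by one: \<open>fibre_nearby\<close> places every preimage close to the
  fibre of \<open>v\<close>, where \<open>push_term_small\<close> applies, and there are at most
  \<open>D\<close> terms.\<close>

lemma push_chart_tame:
  assumes "w \<in> QD"
  shows "((\<lambda>s. (s - chart v v)\<^sup>2 * push_chart w v s) \<longlongrightarrow> 0) (at (chart v v))"
proof (rule tendstoI)
  fix e :: real assume "e > 0"
  \<comment> \<open>Chosen so that \<open>D\<close> terms of size at most \<open>e'\<close> add up
    to less than \<open>e\<close>; the 1 makes the inequality strict.\<close>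
  define e' where "e' = e / (real D + 1)"
  have e': "e' > 0" "real D * e' < e" using \<open>e > 0\<close> by (auto simp: e'_def field_simps)
  define good where "good = (\<lambda>x t. \<exists>z y. chart_inv x t = Some z \<and> f (Some z) = Some y \<and>
     norm ((chart v (Some y) - chart v v)\<^sup>2 * (push_term w z * qd_jac v y)) < e')"
  have good: "\<forall>\<^sub>F t in nhds (chart x x). t \<noteq> chart x x \<longrightarrow> good x t" if x: "f x = v" for x
  proof -
    have "\<forall>\<^sub>F t in at (chart x x). dist ((chart_rep f x t - chart_rep f x (chart x x))\<^sup>2 * (qd_coeff w x t / (deriv (chart_rep f x) t)\<^sup>2)) 0 < e'"
      using push_term_small[OF assms, of x] e'(1) by (rule tendstoD)
    with push_term_chart_ev[of x w] have "\<forall>\<^sub>F t in at (chart x x). good x t"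
    proof eventually_elim
      case (elim t)
      then show ?case unfolding good_def using x by (fastforce simp: dist_norm)
    qed
    then show ?thesis by (simp add: eventually_at_filter)
  qed
  have "\<forall>\<^sub>F y in nhds v. \<forall>x'. f x' = y \<longrightarrow> (\<exists>x t. f x = v \<and> x' = chart_inv x t \<and> (t \<noteq> chart x x \<longrightarrow> good x t))"
  proof (rule fibre_nearby[OF sph_holo_continuous_on[OF sph_holo_f]])
    fix x assume x: "f x = v"
    have "\<forall>\<^sub>F t in nhds (chart x x). \<exists>x'' t'. f x'' = v \<and> chart_inv x t = chart_inv x'' t' \<and> (t' \<noteq> chart x'' x'' \<longrightarrow> good x'' t')"
      using good[OF x] by eventually_elim (use x in blast)
    then show "\<forall>\<^sub>F x' in nhds x. \<exists>x t. f x = v \<and> x' = chart_inv x t \<and> (t \<noteq> chart x x \<longrightarrow> good x t)"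
      by (simp add: eventually_sphere[of x x])
  qed
  then have "\<forall>\<^sub>F s in nhds (chart v v). \<forall>x'. f x' = chart_inv v s \<longrightarrow> (\<exists>x t. f x = v \<and> x' = chart_inv x t \<and> (t \<noteq> chart x x \<longrightarrow> good x t))"
    by (simp add: eventually_sphere[of v v])
  then have "\<forall>\<^sub>F s in at (chart v v). s \<noteq> chart v v \<and> (\<forall>x'. f x' = chart_inv v s \<longrightarrow> (\<exists>x t. f x = v \<and> x' = chart_inv x t \<and> (t \<noteq> chart x x \<longrightarrow> good x t)))"
    by (auto simp: eventually_at_filter elim: eventually_mono)
  then show "\<forall>\<^sub>F s in at (chart v v). dist ((s - chart v v)\<^sup>2 * push_chart w v s) 0 < e"
    using cofinite_chart_inv[of "\<lambda>_. True" v, simplified]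
  proof eventually_elim
    case (elim s)
    then obtain y where y: "chart_inv v s = Some y" by blast
    have sy: "chart v (Some y) = s" using y chart_chart_inv by metis
    have yv: "Some y \<noteq> v" using elim(1) sy by auto
    have bd: "norm ((s - chart v v)\<^sup>2 * (push_term w z * qd_jac v y)) \<le> e'" if z: "f (Some z) = Some y" for z
    proof -
      obtain x t where xt: "f x = v" "Some z = chart_inv x t" "t \<noteq> chart x x \<longrightarrow> good x t"
        using elim(1) z y by metis
      have "t \<noteq> chart x x" using xt z yv by (metis chart_dom_self chart_inv_chart)
      then have "good x t" using xt by blast
      then show ?thesis unfolding good_def using xt z sy by auto
    qed
    have "(s - chart v v)\<^sup>2 * push_chart w v s = (\<Sum>z | f (Some z) = Some y. (s - chart v v)\<^sup>2 * (push_term w z * qd_jac v y))"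
      by (simp add: push_chart_def y push_sum_def sum_distrib_left sum_distrib_right)
    also have "norm \<dots> \<le> real (card {z. f (Some z) = Some y}) * e'"
      by (rule order_trans[OF sum_norm_le[OF bd]]) auto
    also have "\<dots> \<le> real D * e'" using card_fibre_le[of y] e'(1) by (intro mult_right_mono) auto
    finally show ?case using e'(2) by simp
  qed
qed

definition push_local :: "quad_diff \<Rightarrow> sphere \<Rightarrow> complex" where
  "push_local w x' = (case x' of Some z \<Rightarrow> push_term w z | None \<Rightarrow> 0)"

lemma push_sum_local:
  assumes fib: "{x'. f x' = Some y} = (\<lambda>x. chart_inv x (s x)) ` I"
    and inj: "inj_on (\<lambda>x. chart_inv x (s x)) I" and ne: "f None \<noteq> Some y"
  shows "push_sum w y = (\<Sum>x\<in>I. push_local w (chart_inv x (s x)))"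
proof -
  have "(\<Sum>x\<in>I. push_local w (chart_inv x (s x))) = (\<Sum>x'\<in>(\<lambda>x. chart_inv x (s x)) ` I. push_local w x')"
    by (simp add: sum.reindex[OF inj])
  also have "(\<lambda>x. chart_inv x (s x)) ` I = Some ` {z. f (Some z) = Some y}"
    unfolding fib[symmetric]
  proof (rule set_eqI)
    fix x' show "x' \<in> {x'. f x' = Some y} \<longleftrightarrow> x' \<in> Some ` {z. f (Some z) = Some y}"
      using ne by (cases x') auto
  qed
  also have "(\<Sum>x'\<in>\<dots>. push_local w x') = (\<Sum>z | f (Some z) = Some y. push_term w z)"
    by (subst sum.reindex) (auto simp: push_local_def)
  finally show ?thesis by (simp add: push_sum_def)
qed

text \<open>Along the inverse branch through \<open>x\<close>, the summand times
  \<open>u - v\<close> is the difference quotient of \<open>f\<close> times \<open>(t - x)\<close>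
  times the coefficient of \<open>w\<close>, divided by the square of \<open>f'\<close>. The limit
  is the residue times \<open>f' / f'\<^sup>2\<close>.\<close>

lemma push_chart_residue:
  assumes "w \<in> QD" and ncrit: "\<And>x. f x = v \<Longrightarrow> sphere_deriv f x \<noteq> 0"
  shows "((\<lambda>s. (s - chart v v) * push_chart w v s) \<longlongrightarrow> (\<Sum>x | f x = v. qres w x / sphere_deriv f x)) (at (chart v v))"
proof -
  let ?tv = "chart v v"
  obtain r U s where "even_cover f v r U s"
    using evenly_covered[OF sph_holo_f finite_fibre ncrit] by blast
  note c = even_coverD[OF this]
  note r = c(1) and hU = c(2-4) and hs = c(5-12)
  have ball: "\<forall>\<^sub>F u in at ?tv. u \<in> ball ?tv r \<and> u \<noteq> ?tv"
  proof -
    have "\<forall>\<^sub>F u in nhds ?tv. u \<in> ball ?tv r" using r by (intro eventually_nhds_in_open) auto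
    then show ?thesis by (auto simp: eventually_at_filter elim: eventually_mono)
  qed
  have s_at: "filterlim (s x) (at (chart x x)) (at ?tv)" if x: "f x = v" for x
  proof (rule filterlim_atI)
    have "isCont (s x) ?tv"
      using holomorphic_on_imp_continuous_on[OF hs(1)[OF x]] r by (simp add: continuous_on_eq_continuous_at)
    then show "(s x \<longlongrightarrow> chart x x) (at ?tv)" using hs(4)[OF x] by (simp add: isCont_def)
    show "\<forall>\<^sub>F u in at ?tv. s x u \<noteq> chart x x"
      using ball by eventually_elim (metis centre_in_ball hs(4,5) r x)
  qed
  have trm: "((\<lambda>u. (u - ?tv) * (push_local w (chart_inv x (s x u)) * qd_jac v (the (chart_inv v u)))) \<longlongrightarrow> qres w x / sphere_deriv f x) (at ?tv)"
    if x: "f x = v" for x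
  proof -
    let ?F = "chart_rep f x" and ?a = "chart x x"
    have Fa: "?F ?a = ?tv" using x by simp
    have aU: "?a \<in> U x" using hs(2)[OF x] r unfolding hs(4)[OF x, symmetric] by (simp add: image_subset_iff)
    have dF: "(deriv ?F \<longlongrightarrow> deriv ?F ?a) (at ?a)"
    proof -
      have "deriv ?F holomorphic_on U x" using hU x by (intro holomorphic_deriv) auto
      then have "isCont (deriv ?F) ?a"
        using holomorphic_on_imp_continuous_on aU hU(1)[OF x] continuous_on_eq_continuous_at by blast
      then show ?thesis by (simp add: isCont_def)
    qed
    have d0: "deriv ?F ?a \<noteq> 0" using hU(3)[OF x aU] .
    have q: "((\<lambda>t. (?F t - ?F ?a) / (t - ?a)) \<longlongrightarrow> sphere_deriv f x) (at ?a)"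
      using sph_holo_has_deriv[OF sph_holo_f, of x] by (simp only: has_field_derivative_iff)
    have "((\<lambda>t. (?F t - ?F ?a) / (t - ?a) * ((t - ?a) * qd_coeff w x t) / (deriv ?F t)\<^sup>2) \<longlongrightarrow>
      sphere_deriv f x * qres w x / (deriv ?F ?a)\<^sup>2) (at ?a)"
      using d0 by (intro tendsto_intros q dF qres_tendsto(1)[OF assms(1)]) auto
    then have "((\<lambda>t. (?F t - ?F ?a) / (t - ?a) * ((t - ?a) * qd_coeff w x t) / (deriv ?F t)\<^sup>2) \<longlongrightarrow>
      qres w x / sphere_deriv f x) (at ?a)"
      using d0 by (simp add: sphere_deriv_rep power2_eq_square)
    from filterlim_compose[OF this s_at[OF x]]
    have 1: "((\<lambda>u. (?F (s x u) - ?F ?a) / (s x u - ?a) * ((s x u - ?a) * qd_coeff w x (s x u)) / (deriv ?F (s x u))\<^sup>2) \<longlongrightarrow>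
      qres w x / sphere_deriv f x) (at ?tv)" .
    have T: "\<forall>\<^sub>F u in at ?tv. \<exists>z y. chart_inv x (s x u) = Some z \<and> f (Some z) = Some y \<and>
     chart_rep f x (s x u) = chart (f x) (Some y) \<and>
     push_term w z * qd_jac (f x) y = qd_coeff w x (s x u) / (deriv (chart_rep f x) (s x u))\<^sup>2"
      using push_term_chart_ev[of x w] s_at[OF x] by (rule eventually_compose_filterlim)
    have ne: "\<forall>\<^sub>F u in at ?tv. s x u \<noteq> ?a"
      using s_at[OF x] by (simp add: filterlim_at)
    have "\<forall>\<^sub>F u in at ?tv. (?F (s x u) - ?F ?a) / (s x u - ?a) * ((s x u - ?a) * qd_coeff w x (s x u)) / (deriv ?F (s x u))\<^sup>2 =
       (u - ?tv) * (push_local w (chart_inv x (s x u)) * qd_jac v (the (chart_inv v u)))"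
      using T ne ball
    proof eventually_elim
      case (elim u)
      then obtain z y where zy: "chart_inv x (s x u) = Some z" "f (Some z) = Some y"
        "push_term w z * qd_jac v y = qd_coeff w x (s x u) / (deriv ?F (s x u))\<^sup>2" using x by auto
      have "chart_inv v u = Some y" using hs(6)[OF x, of u] zy elim by auto
      moreover have "?F (s x u) = u" using hs(5)[OF x] elim by blast
      ultimately show ?case using elim(2) zy Fa by (simp add: push_local_def)
    qed
    with 1 show ?thesis by (rule Lim_transform_eventually)
  qed
  have "((\<lambda>u. \<Sum>x | f x = v. (u - ?tv) * (push_local w (chart_inv x (s x u)) * qd_jac v (the (chart_inv v u)))) \<longlongrightarrow>
     (\<Sum>x | f x = v. qres w x / sphere_deriv f x)) (at ?tv)"
    using trm by (intro tendsto_sum) auto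
  moreover have "\<forall>\<^sub>\<infinity>y. f None \<noteq> Some y"
    by (cases "f None") (auto simp: eventually_cofinite)
  then have "\<forall>\<^sub>F u in at ?tv. \<exists>y. chart_inv v u = Some y \<and> f None \<noteq> Some y"
    by (rule cofinite_chart_inv)
  with ball have "\<forall>\<^sub>F u in at ?tv. (\<Sum>x | f x = v. (u - ?tv) * (push_local w (chart_inv x (s x u)) * qd_jac v (the (chart_inv v u)))) =
     (u - ?tv) * push_chart w v u"
  proof eventually_elim
    case (elim u)
    then obtain y where y: "chart_inv v u = Some y" "f None \<noteq> Some y" by blast
    have "push_sum w y = (\<Sum>x | f x = v. push_local w (chart_inv x (s x u)))"
      using hs(7,8)[of u] elim(1) y by (intro push_sum_local) auto
    then show ?case by (simp add: push_chart_def y sum_distrib_left sum_distrib_right)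
  qed
  ultimately show ?thesis by (rule Lim_transform_eventually)
qed

lemma push_sum_analytic:
  assumes inf: "f None \<noteq> Some y0" and ncrit: "\<And>z. f (Some z) = Some y0 \<Longrightarrow> sphere_deriv f (Some z) \<noteq> 0"
    and nopole: "\<And>z. f (Some z) = Some y0 \<Longrightarrow> poly (rf_den w) z \<noteq> 0"
  shows "push_sum w analytic_on {y0}"
proof -
  let ?v = "Some y0"
  have I: "\<exists>z. x = Some z \<and> f (Some z) = Some y0" if "f x = ?v" for x using that inf by (cases x) auto
  have ncrit': "sphere_deriv f x \<noteq> 0" if "f x = ?v" for x using I[OF that] ncrit by auto
  obtain r U s where "even_cover f ?v r U s"
    using evenly_covered[OF sph_holo_f finite_fibre ncrit'] by blast
  note c = even_coverD[OF this, unfolded chart_simps]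
  note r = c(1) and hU = c(2-4) and hs = c(5-12)
  have s_an: "s x analytic_on {y0}" if "f x = ?v" for x
    unfolding analytic_at using hs(1)[OF that] r by (intro exI[of _ "ball y0 r"]) auto
  have an: "(\<lambda>u. \<Sum>x | f x = ?v. rf_eval w (s x u) / (deriv (chart_rep f x) (s x u))\<^sup>2) analytic_on {y0}"
  proof (intro analytic_on_sum)
    fix x assume "x \<in> {x. f x = ?v}"
    then have x: "f x = ?v" by simp
    then obtain z where z: "x = Some z" "f (Some z) = Some y0" using I by blast
    have sy: "s x y0 = z" using hs(4)[OF x] z by simp
    have zU: "z \<in> U x" using hs(2)[OF x] r unfolding sy[symmetric] by (simp add: image_subset_iff)
    have "deriv (chart_rep f x) holomorphic_on U x" using hU x by (intro holomorphic_deriv) auto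
    then have "deriv (chart_rep f x) analytic_on {z}" using zU hU(1)[OF x] by (auto simp: analytic_at)
    then have A: "deriv (chart_rep f x) \<circ> s x analytic_on {y0}"
      using s_an[OF x] sy by (intro analytic_on_compose) auto
    have P: "poly p \<circ> s x analytic_on {y0}" for p
      using s_an[OF x] by (intro analytic_on_compose poly_analytic)
    have "(\<lambda>u. (poly (rf_num w) \<circ> s x) u / (poly (rf_den w) \<circ> s x) u / ((deriv (chart_rep f x) \<circ> s x) u)\<^sup>2) analytic_on {y0}"
      using hU(3)[OF x zU] nopole[OF z(2)] by (intro analytic_on_divide analytic_on_power A P) (simp_all add: sy)
    then show "(\<lambda>u. rf_eval w (s x u) / (deriv (chart_rep f x) (s x u))\<^sup>2) analytic_on {y0}"
      by (simp add: rf_eval_def)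
  qed
  have "\<forall>\<^sub>F u in nhds y0. u \<in> ball y0 r" using r by (intro eventually_nhds_in_open) auto
  moreover have "\<forall>\<^sub>F u in nhds y0. f None \<noteq> Some u"
  proof (cases "f None")
    case (Some c)
    then have "\<forall>\<^sub>F u in nhds y0. u \<in> - {c}" using inf by (intro eventually_nhds_in_open) auto
    then show ?thesis by eventually_elim (use Some in auto)
  qed simp
  ultimately have "\<forall>\<^sub>F u in nhds y0. (\<Sum>x | f x = ?v. rf_eval w (s x u) / (deriv (chart_rep f x) (s x u))\<^sup>2) = push_sum w u"
  proof eventually_elim
    case (elim u)
    have "push_sum w u = (\<Sum>x | f x = ?v. push_local w (chart_inv x (s x u)))"
      using hs(7,8)[of u] elim by (intro push_sum_local) auto
    also have "\<dots> = (\<Sum>x | f x = ?v. rf_eval w (s x u) / (deriv (chart_rep f x) (s x u))\<^sup>2)"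
    proof (intro sum.cong refl)
      fix x assume "x \<in> {x. f x = ?v}"
      then have x: "f x = ?v" by simp
      then obtain z where z: "x = Some z" using I by blast
      have y: "f (Some (s x u)) = Some u" using hs(6)[OF x, of u] elim z by simp
      have "push_term w (s x u) * qd_jac (f x) u = qd_coeff w x (s x u) / (deriv (chart_rep f x) (s x u))\<^sup>2"
        by (rule push_term_chart(1)) (use z x y in \<open>auto simp: chart_dom_def\<close>)
      then show "push_local w (chart_inv x (s x u)) = rf_eval w (s x u) / (deriv (chart_rep f x) (s x u))\<^sup>2"
        using x z by (simp add: push_local_def qd_coeff_def)
    qed
    finally show ?case by simp
  qed
  from analytic_at_cong[OF this refl] an show ?thesis by simp
qed

lemma push_sum_holomorphic: "\<exists>V. finite V \<and> push_sum w holomorphic_on - V"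
proof -
  define V where "V = {y. f None = Some y} \<union> {y. \<exists>z. f (Some z) = Some y \<and> poly (wronskian p q) z = 0} \<union>
     {y. \<exists>z. f (Some z) = Some y \<and> poly (rf_den w) z = 0}"
  have fin: "finite {y. \<exists>z. f (Some z) = Some y \<and> poly a z = 0}" if "a \<noteq> 0" for a
    by (rule finite_subset[of _ "(\<lambda>z. the (f (Some z))) ` {z. poly a z = 0}"])
      (use poly_roots_finite[OF that] in \<open>force+\<close>)
  have "{y. f None = Some y} \<subseteq> {the (f None)}" by auto
  then have "finite {y. f None = Some y}" by (rule finite_subset) simp
  then have V: "finite V" unfolding V_def using fin[OF wronskian_nonzero] fin[OF rf_den_nonzero] by simp
  have "push_sum w analytic_on {y}" if "y \<notin> V" for y
    using that by (intro push_sum_analytic) (auto simp: V_def critical_Some_iff)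
  then have "push_sum w analytic_on - V"
    using analytic_on_analytic_at by blast
  then show ?thesis using V analytic_imp_holomorphic by blast
qed

end

lemma extend_over_finite:
  assumes "finite V" "h holomorphic_on - V" "\<And>v. v \<in> V \<Longrightarrow> ((\<lambda>z. (z - v) * h z) \<longlongrightarrow> 0) (at v)"
  shows "\<exists>g. g holomorphic_on UNIV \<and> (\<forall>z. z \<notin> V \<longrightarrow> g z = h z)"
  using assms
proof (induction V arbitrary: h rule: finite_induct)
  case empty
  then show ?case by auto
next
  case (insert v V)
  have "- insert v V = - V - {v}" by auto
  then have hol: "h holomorphic_on (- V - {v})" using insert.prems by simp
  have "open (- V)" using insert.hyps by (intro open_Compl finite_imp_closed)
  then have "v \<in> interior (- V)" using insert.hyps by (simp add: interior_open)
  from holomorphic_on_extend_lim[OF hol this] insert.prems(2)[of v]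
  obtain g where g: "g holomorphic_on - V" "\<forall>z\<in>- V - {v}. g z = h z" by auto
  have "((\<lambda>z. (z - u) * g z) \<longlongrightarrow> 0) (at u)" if u: "u \<in> V" for u
  proof (rule Lim_transform_eventually[OF insert.prems(2)])
    have "\<forall>\<^sub>F z in at u. z \<notin> insert v V"
      by (rule cofinite_avoid) (use insert.hyps in \<open>simp add: eventually_cofinite\<close>)
    then show "\<forall>\<^sub>F z in at u. (z - u) * h z = (z - u) * g z"
      by eventually_elim (use g(2) in auto)
  qed (use u in simp)
  from insert.IH[OF g(1) this] obtain g' where "g' holomorphic_on UNIV" "\<forall>z. z \<notin> V \<longrightarrow> g' z = g z" by blast
  then show ?case using g(2) by (intro exI[of _ g']) auto
qed

context rational
begin

text \<open>Tameness makes the finitely many singularities at worst simple poles, so multiplying by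
  the product of \<open>y - u\<close> over \<open>V\<close> gives an entire function. Tameness at
  infinity bounds its growth by a power, and Liouville's theorem makes it a polynomial.\<close>

lemma push_sum_rational:
  assumes "w \<in> QD"
  shows "\<exists>r. \<forall>\<^sub>\<infinity>y. rf_eval r y = push_sum w y"
proof -
  obtain V where V: "finite V" "push_sum w holomorphic_on - V" using push_sum_holomorphic by blast
  define h where "h = (\<lambda>y. push_sum w y * (\<Prod>u\<in>V. (y - u)))"
  have "\<exists>g. g holomorphic_on UNIV \<and> (\<forall>z. z \<notin> V \<longrightarrow> g z = h z)"
  proof (rule extend_over_finite[OF V(1)])
    show "h holomorphic_on - V" unfolding h_def by (intro holomorphic_intros V(2))
    fix v assume v: "v \<in> V"
    have "((\<lambda>y. (y - v)\<^sup>2 * push_chart w (Some v) y) \<longlongrightarrow> 0) (at v)"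
      using push_chart_tame[OF assms, of "Some v"] by simp
    then have "((\<lambda>y. (y - v)\<^sup>2 * push_sum w y) \<longlongrightarrow> 0) (at v)" by (simp add: push_chart_def)
    then have "((\<lambda>y. (y - v)\<^sup>2 * push_sum w y * (\<Prod>u\<in>V - {v}. (y - u))) \<longlongrightarrow> 0 * (\<Prod>u\<in>V - {v}. (v - u))) (at v)"
      by (intro tendsto_mult tendsto_prod tendsto_intros)
    moreover have "(y - v)\<^sup>2 * push_sum w y * (\<Prod>u\<in>V - {v}. (y - u)) = (y - v) * h y" for y
      unfolding h_def prod.remove[OF V(1) v] by (simp add: power2_eq_square)
    ultimately show "((\<lambda>y. (y - v) * h y) \<longlongrightarrow> 0) (at v)" by simp
  qed
  then obtain g where g: "g holomorphic_on UNIV" "\<And>z. z \<notin> V \<Longrightarrow> g z = h z" by blast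
  \<comment> \<open>In the chart at infinity the coefficient carries \<open>y ^ 4\<close> and
    \<open>s\<^sup>2\<close> is \<open>1 / y\<^sup>2\<close>. So \<open>y\<^sup>2\<close> times the
    sum tends to zero, and in particular the sum has modulus below 1 for large
    \<open>y\<close>.\<close>
  have "((\<lambda>s. s\<^sup>2 * push_chart w None s) \<longlongrightarrow> 0) (at 0)"
    using push_chart_tame[OF assms, of None] by simp
  then have "\<forall>\<^sub>F s in at 0. dist (s\<^sup>2 * push_chart w None s) 0 < 1"
    by (rule tendstoD) simp
  then have "\<forall>\<^sub>F y in at_infinity. norm ((1 / y)\<^sup>2 * push_chart w None (1 / y)) < 1"
    by (simp add: at_to_infinity eventually_filtermap inverse_eq_divide)
  then have ev: "\<forall>\<^sub>F y in at_infinity. norm (push_sum w y) < 1"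
  proof -
    assume a: "\<forall>\<^sub>F y in at_infinity. norm ((1 / y)\<^sup>2 * push_chart w None (1 / y)) < 1"
    have "\<forall>\<^sub>F y::complex in at_infinity. norm y \<ge> 1" by (auto simp: eventually_at_infinity)
    with a show ?thesis
    proof eventually_elim
      case (elim y)
      then have y0: "y \<noteq> 0" by auto
      have "(1 / y)\<^sup>2 * push_chart w None (1 / y) = y\<^sup>2 * push_sum w y"
        using y0 by (simp add: push_chart_def chart_inv_None power2_eq_square power4_eq_xxxx)
      then have "norm (y\<^sup>2 * push_sum w y) < 1" using elim(1) by simp
      moreover have "norm (push_sum w y) \<le> norm (y\<^sup>2 * push_sum w y)"
        using elim(2) by (simp add: norm_mult norm_power mult_le_cancel_right1)
      ultimately show ?case by linarith
    qed
  qed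
  moreover have "\<forall>\<^sub>F y::complex in at_infinity. \<forall>u\<in>V. norm u \<le> norm y"
    using V(1) by (intro eventually_ball_finite) (auto simp: eventually_at_infinity)
  moreover have "\<forall>\<^sub>F y::complex in at_infinity. y \<notin> V"
  proof -
    obtain b where "\<And>u. u \<in> V \<Longrightarrow> norm u \<le> b" using finite_imp_bounded[OF V(1)] by (auto simp: bounded_iff)
    then have "\<forall>y. b + 1 \<le> norm y \<longrightarrow> y \<notin> V" by force
    then show ?thesis unfolding eventually_at_infinity by blast
  qed
  ultimately have "\<forall>\<^sub>F y in at_infinity. norm (g y) \<le> 2 ^ card V * norm y ^ card V"
  proof eventually_elim
    case (elim y)
    have "norm (\<Prod>u\<in>V. (y - u)) = (\<Prod>u\<in>V. norm (y - u))" by (simp add: prod_norm)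
    also have "\<dots> \<le> (\<Prod>u\<in>V. 2 * norm y)"
    proof (rule prod_mono)
      fix u assume "u \<in> V"
      then have "norm u \<le> norm y" using elim by blast
      then show "0 \<le> norm (y - u) \<and> norm (y - u) \<le> 2 * norm y" using norm_triangle_ineq4[of y u] by simp
    qed
    finally have "norm (\<Prod>u\<in>V. (y - u)) \<le> 2 ^ card V * norm y ^ card V" by (simp add: power_mult_distrib)
    then have "norm (push_sum w y) * norm (\<Prod>u\<in>V. (y - u)) \<le> 1 * (2 ^ card V * norm y ^ card V)"
      using elim(1) by (intro mult_mono) auto
    then show ?case using g(2) elim by (simp add: h_def norm_mult)
  qed
  then obtain A where A: "\<And>y. A \<le> norm y \<Longrightarrow> norm (g y) \<le> 2 ^ card V * norm y ^ card V"
    by (auto simp: eventually_at_infinity)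
  define E where "E = (\<Sum>k\<le>card V. monom ((deriv ^^ k) g 0 / fact k) k)"
  have E: "poly E y = g y" for y
    using Liouville_polynomial[OF g(1) A, where \<xi> = y] by (simp add: E_def poly_sum poly_monom)
  define N where "N = (\<Prod>u\<in>V. [:-u, 1:])"
  have N: "N \<noteq> 0" "poly N y = (\<Prod>u\<in>V. (y - u))" for y
    using V(1) by (auto simp: N_def poly_prod)
  have "\<forall>\<^sub>\<infinity>y. y \<notin> V" using V(1) by (simp add: eventually_cofinite)
  then have "\<forall>\<^sub>\<infinity>y. rf_eval (Fract E N) y = push_sum w y"
  proof eventually_elim
    case (elim y)
    have Ny: "poly N y \<noteq> 0" using N(2) V(1) elim by auto
    have "rf_eval (Fract E N) y = poly E y / poly N y" by (rule rf_eval_Fract[OF N(1) Ny])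
    also have "\<dots> = push_sum w y"
      using Ny E[of y] g(2)[OF elim] by (simp add: h_def N(2))
    finally show ?case .
  qed
  then show ?thesis by blast
qed

text \<open>Justifies the definite description in \<open>pushforward\<close>: existence is
  \<open>push_sum_rational\<close>, and a rational function is determined by its values off a finite
  set.\<close>

lemma pushforward_eval:
  assumes "w \<in> QD"
  shows "\<forall>\<^sub>\<infinity>y. rf_eval (pushforward f w) y = push_sum w y"
proof -
  obtain r where r: "\<forall>\<^sub>\<infinity>y. rf_eval r y = push_sum w y" using push_sum_rational[OF assms] by blast
  have "pushforward f w = (THE r. \<forall>\<^sub>\<infinity>y. rf_eval r y = push_sum w y)"
    by (simp add: pushforward_def push_sum_def push_term_def)
  also have "\<dots> = r"
  proof (rule the_equality[of "\<lambda>r. \<forall>\<^sub>\<infinity>y. rf_eval r y = push_sum w y", OF r])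
    fix r' assume "\<forall>\<^sub>\<infinity>y. rf_eval r' y = push_sum w y"
    with r have "\<forall>\<^sub>\<infinity>y. rf_eval r' y = rf_eval r y" by eventually_elim simp
    then show "r' = r" by (rule rf_eval_eqI)
  qed
  finally show ?thesis using r by simp
qed

lemma pushforward_coeff:
  assumes "w \<in> QD"
  shows "\<forall>\<^sub>F s in at (chart v v). push_chart w v s = qd_coeff (pushforward f w) v s"
  using cofinite_chart_inv[OF pushforward_eval[OF assms], of v]
  by eventually_elim (auto simp: push_chart_def qd_coeff_jac)

theorem pushforward_QD:
  assumes "w \<in> QD"
  shows "pushforward f w \<in> QD"
  unfolding QD_iff_tame qd_tame_def
proof
  fix v
  have "\<forall>\<^sub>F s in at (chart v v). (s - chart v v)\<^sup>2 * push_chart w v s = (s - chart v v)\<^sup>2 * qd_coeff (pushforward f w) v s"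
    using pushforward_coeff[OF assms, of v] by eventually_elim simp
  with push_chart_tame[OF assms, of v]
  show "((\<lambda>t. (t - chart v v)\<^sup>2 * qd_coeff (pushforward f w) v t) \<longlongrightarrow> 0) (at (chart v v))"
    by (rule Lim_transform_eventually)
qed

theorem qres_pushforward:
  assumes "w \<in> QD" "\<And>x. f x = v \<Longrightarrow> sphere_deriv f x \<noteq> 0"
  shows "qres (pushforward f w) v = (\<Sum>x | f x = v. qres w x / sphere_deriv f x)"
proof (rule qres_eqI)
  have "\<forall>\<^sub>F s in at (chart v v). (s - chart v v) * push_chart w v s = (s - chart v v) * qd_coeff (pushforward f w) v s"
    using pushforward_coeff[OF assms(1), of v] by eventually_elim simp
  with push_chart_residue[OF assms]
  show "((\<lambda>t. (t - chart v v) * qd_coeff (pushforward f w) v t) \<longlongrightarrow> (\<Sum>x | f x = v. qres w x / sphere_deriv f x)) (at (chart v v))"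
    by (rule Lim_transform_eventually)
qed

end

lemma sphere_deriv_ident [simp]: "sphere_deriv (\<lambda>x. x) y = 1"
  using sphere_deriv_id[of y] by (simp only: id_def)

section \<open>From eigenvectors to cycles and back\<close>

section \<open>Eigenvalues in terms of residues\<close>

locale pcf = rational +
  assumes D2: "D \<ge> 2" and finite_postcritical: "finite (postcritical_set (rat_map p q))"
begin

abbreviation P :: "sphere set" where "P \<equiv> postcritical_set f"

lemma critical_value_in_P: "sphere_deriv f x = 0 \<Longrightarrow> f x \<in> P"
proof -
  assume "sphere_deriv f x = 0"
  then have "f x \<in> (f ^^ 1) ` critical_set f" by (auto simp: critical_set_def)
  then show ?thesis unfolding postcritical_set_def by (intro UN_I[of 1]) simp_all
qed

lemma P_forward: "x \<in> P \<Longrightarrow> f x \<in> P"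
proof -
  assume "x \<in> P"
  then obtain n y where "n \<ge> 1" "y \<in> critical_set f" "x = (f ^^ n) y"
    unfolding postcritical_set_def by auto
  then have "f x = (f ^^ Suc n) y" "Suc n \<ge> 1" by auto
  with \<open>y \<in> critical_set f\<close> show ?thesis unfolding postcritical_set_def by blast
qed

lemma P_forward_funpow: "x \<in> P \<Longrightarrow> (f ^^ n) x \<in> P"
  by (induction n) (auto simp: P_forward)

lemma not_P_preimage: "f x \<notin> P \<Longrightarrow> sphere_deriv f x \<noteq> 0 \<and> x \<notin> P"
  using critical_value_in_P P_forward by blast

lemma QD_post_iff: "w \<in> QD_post f \<longleftrightarrow> w \<in> QD \<and> (\<forall>v. v \<notin> P \<longrightarrow> qres w v = 0)"
  unfolding QD_post_def using qres_tendsto(2)[of w] by blast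

lemma quot_rel_iff: "(w, r) \<in> quot_rel f \<longleftrightarrow> w \<in> QD \<and> r \<in> QD \<and> (\<forall>v. v \<notin> P \<longrightarrow> qres w v = qres r v)"
  using QD_diff[of w r] by (auto simp: quot_rel_def QD_post_iff)

lemma class_eq_iff:
  assumes "w \<in> QD" "r \<in> QD"
  shows "quot_rel f `` {w} = quot_rel f `` {r} \<longleftrightarrow> (\<forall>v. v \<notin> P \<longrightarrow> qres w v = qres r v)"
proof
  assume "quot_rel f `` {w} = quot_rel f `` {r}"
  moreover have "w \<in> quot_rel f `` {w}" using assms by (simp add: quot_rel_iff)
  ultimately have "(r, w) \<in> quot_rel f" by blast
  then show "\<forall>v. v \<notin> P \<longrightarrow> qres w v = qres r v" by (simp add: quot_rel_iff)
next
  assume "\<forall>v. v \<notin> P \<longrightarrow> qres w v = qres r v"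
  then show "quot_rel f `` {w} = quot_rel f `` {r}" using assms by (auto simp: quot_rel_iff)
qed

lemma UN_class:
  assumes "w \<in> QD" and "\<And>r. r \<in> QD \<Longrightarrow> T r \<in> QD"
    and "\<And>r. r \<in> QD \<Longrightarrow> (\<And>v. v \<notin> P \<Longrightarrow> qres w v = qres r v) \<Longrightarrow> (\<And>v. v \<notin> P \<Longrightarrow> qres (T r) v = qres (T w) v)"
  shows "(\<Union>r\<in>quot_rel f `` {w}. quot_rel f `` {T r}) = quot_rel f `` {T w}"
proof -
  have "quot_rel f `` {T r} = quot_rel f `` {T w}" if "r \<in> quot_rel f `` {w}" for r
  proof -
    have "(w, r) \<in> quot_rel f" using that by simp
    then have r: "r \<in> QD" "\<And>v. v \<notin> P \<Longrightarrow> qres w v = qres r v" by (auto simp: quot_rel_iff)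
    show ?thesis unfolding class_eq_iff[OF assms(2)[OF r(1)] assms(2)[OF assms(1)]]
      using assms(3)[OF r] by blast
  qed
  moreover have "w \<in> quot_rel f `` {w}" using assms(1) by (simp add: quot_rel_iff)
  ultimately show ?thesis by blast
qed

lemma qres_push:
  assumes "w \<in> QD" "v \<notin> P"
  shows "qres (pushforward f w) v = (\<Sum>x | f x = v. qres w x / sphere_deriv f x)"
  using assms not_P_preimage by (intro qres_pushforward) auto

lemma quot_pushforward_class:
  assumes "w \<in> QD"
  shows "quot_pushforward f (quot_rel f `` {w}) = quot_rel f `` {pushforward f w}"
  unfolding quot_pushforward_def
proof (rule UN_class[OF assms pushforward_QD])
  fix r v assume r: "r \<in> QD" "\<And>v. v \<notin> P \<Longrightarrow> qres w v = qres r v" and v: "v \<notin> P"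
  show "qres (pushforward f r) v = qres (pushforward f w) v"
    unfolding qres_push[OF r(1) v] qres_push[OF assms v]
    by (intro sum.cong refl) (use r(2) v not_P_preimage in auto)
qed

lemma quot_scale_class:
  assumes "w \<in> QD"
  shows "quot_scale f c (quot_rel f `` {w}) = quot_rel f `` {qd_scale c w}"
  unfolding quot_scale_def by (rule UN_class[OF assms QD_scale(1)]) (auto simp: QD_scale assms)

text \<open>Membership of \<open>w\<close> in \<open>QD\<close> is the only global condition left;
  the rest is a linear system for the residues outside \<open>P\<close>. All fibres over such points
  are free of critical points and of points of \<open>P\<close>, so the system does not see the
  residues in \<open>P\<close>.\<close>

lemma eigenvalue_iff:
  "c \<in> quot_eigenvalues f \<longleftrightarrow> (\<exists>w\<in>QD. (\<exists>v. v \<notin> P \<and> qres w v \<noteq> 0) \<and>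
     (\<forall>v. v \<notin> P \<longrightarrow> (\<Sum>x | f x = v. qres w x / sphere_deriv f x) = c * qres w v))"
proof -
  have "c \<in> quot_eigenvalues f \<longleftrightarrow> (\<exists>w\<in>QD. quot_rel f `` {w} \<noteq> quot_rel f `` {0} \<and>
     quot_rel f `` {pushforward f w} = quot_rel f `` {qd_scale c w})"
    unfolding quot_eigenvalues_def QD_quot_def quotient_def quot_zero_def
    by (auto simp: quot_pushforward_class quot_scale_class)
  also have "\<dots> \<longleftrightarrow> (\<exists>w\<in>QD. (\<exists>v. v \<notin> P \<and> qres w v \<noteq> 0) \<and>
     (\<forall>v. v \<notin> P \<longrightarrow> (\<Sum>x | f x = v. qres w x / sphere_deriv f x) = c * qres w v))"
    by (intro bex_cong refl) (auto simp: class_eq_iff pushforward_QD QD_scale qres_push)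
  finally show ?thesis .
qed

section \<open>Eigenvectors and cycles\<close>

text \<open>As \<open>c\<close> is nonzero, each pole outside \<open>P\<close> has a preimage that
  is again such a pole. On a finite set this makes \<open>f\<close> a permutation, so each fibre sum
  in the eigenvector equation has a single nonzero term, and the equation can be iterated around a
  cycle.\<close>

lemma eigenvalue_imp_cycle:
  assumes "c \<in> quot_eigenvalues f" "c \<noteq> 0"
  shows "\<exists>m\<ge>1. \<exists>C. is_cycle f m C \<and> \<not> C \<subseteq> P \<and> is_multiplier f m C (1 / c ^ m)"
proof -
  obtain w where w: "w \<in> QD" "\<exists>v. v \<notin> P \<and> qres w v \<noteq> 0"
    "\<And>v. v \<notin> P \<Longrightarrow> (\<Sum>x | f x = v. qres w x / sphere_deriv f x) = c * qres w v"
    using assms(1) unfolding eigenvalue_iff by blast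
  define S where "S = {x. x \<notin> P \<and> qres w x \<noteq> 0}"
  have "S \<subseteq> qd_poles w" using qres_tendsto(2)[OF w(1)] by (auto simp: S_def)
  then have fin: "finite S" using finite_qd_poles finite_subset by blast
  have "\<exists>x\<in>S. f x = v" if v: "v \<in> S" for v
  proof -
    have "(\<Sum>x | f x = v. qres w x / sphere_deriv f x) \<noteq> 0" using v w(3)[of v] assms(2) by (auto simp: S_def)
    then obtain x where "f x = v" "qres w x / sphere_deriv f x \<noteq> 0"
      by (metis (mono_tags, lifting) mem_Collect_eq sum.neutral)
    then show ?thesis using v not_P_preimage[of x] by (auto simp: S_def)
  qed
  then have sub: "S \<subseteq> f ` S" by blast
  \<comment> \<open>A finite set contained in its own image equals it, and the map is then injective
    on it.\<close>
  have fS: "f ` S = S" using card_seteq[OF finite_imageI[OF fin] sub card_image_le[OF fin]] by simp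
  have inj: "inj_on f S" using fS fin by (simp add: eq_card_imp_inj_on)
  have step: "qres w x = c * sphere_deriv f x * qres w (f x)" if x: "x \<in> S" for x
  proof -
    have fx: "f x \<in> S" using x fS by blast
    have "(\<Sum>x' | f x' = f x. qres w x' / sphere_deriv f x') = (\<Sum>x'\<in>{x}. qres w x' / sphere_deriv f x')"
    proof (rule sum.mono_neutral_right[OF finite_fibre])
      show "\<forall>x'\<in>{x'. f x' = f x} - {x}. qres w x' / sphere_deriv f x' = 0"
      proof
        fix x' assume x': "x' \<in> {x'. f x' = f x} - {x}"
        then have "x' \<notin> S" using inj x by (auto dest: inj_onD)
        moreover have "x' \<notin> P" using x' fx not_P_preimage[of x'] by (auto simp: S_def)
        ultimately show "qres w x' / sphere_deriv f x' = 0" by (simp add: S_def)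
      qed
    qed auto
    then have "qres w x / sphere_deriv f x = c * qres w (f x)" using w(3)[of "f x"] fx by (simp add: S_def)
    then show ?thesis using not_P_preimage[of x] fx by (auto simp: S_def field_simps)
  qed
  have iter: "(f ^^ n) x \<in> S \<and> qres w x = c ^ n * sphere_deriv (f ^^ n) x * qres w ((f ^^ n) x)" if x: "x \<in> S" for n x
  proof (induction n)
    case 0
    then show ?case using x by (simp add: sphere_deriv_funpow[OF sph_holo_f])
  next
    case (Suc n)
    then have "(f ^^ Suc n) x \<in> S" using fS by auto
    moreover have dS: "sphere_deriv (f ^^ Suc n) x = sphere_deriv f ((f ^^ n) x) * sphere_deriv (f ^^ n) x"
      unfolding funpow.simps by (rule sphere_deriv_comp[OF sph_holo_funpow[OF sph_holo_f] sph_holo_f])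
    have "qres w x = c ^ n * sphere_deriv (f ^^ n) x * (c * sphere_deriv f ((f ^^ n) x) * qres w (f ((f ^^ n) x)))"
      using Suc step[of "(f ^^ n) x"] by metis
    then have "qres w x = c ^ Suc n * sphere_deriv (f ^^ Suc n) x * qres w ((f ^^ Suc n) x)"
      unfolding dS by (simp add: mult_ac)
    ultimately show ?case by blast
  qed
  have injn: "inj_on (f ^^ n) S" for n
  proof (induction n)
    case (Suc n)
    show ?case unfolding funpow.simps
      by (rule comp_inj_on[OF Suc]) (use inj iter in \<open>auto intro: inj_on_subset\<close>)
  qed simp
  obtain x where x: "x \<in> S" using w(2) by (auto simp: S_def)
  have "\<not> inj (\<lambda>n. (f ^^ n) x)"
  proof
    assume "inj (\<lambda>n. (f ^^ n) x)"
    moreover have "range (\<lambda>n. (f ^^ n) x) \<subseteq> S" using iter[OF x] by blast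
    ultimately show False using fin by (meson finite_imageD finite_subset infinite_UNIV_nat)
  qed
  then obtain i j where ij: "i < j" "(f ^^ i) x = (f ^^ j) x" unfolding inj_def by (metis nat_neq_iff)
  have "(f ^^ i) ((f ^^ (j - i)) x) = (f ^^ i) x"
    using ij by (simp add: funpow_add[symmetric, THEN fun_cong, unfolded o_def])
  then have "(f ^^ (j - i)) x = x" using injn[of i] iter[OF x] x by (auto dest: inj_onD)
  then have ex: "\<exists>n. n \<ge> 1 \<and> (f ^^ n) x = x" using ij(1) by (intro exI[of _ "j - i"]) auto
  \<comment> \<open>\<open>is_cycle\<close> asks for the exact period, hence the least return
    time.\<close>
  define m where "m = (LEAST n. n \<ge> 1 \<and> (f ^^ n) x = x)"
  have m: "m \<ge> 1" "(f ^^ m) x = x" using LeastI_ex[OF ex] unfolding m_def by auto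
  have least: "(f ^^ i) x \<noteq> x" if "0 < i" "i < m" for i
    using not_less_Least[of i "\<lambda>n. n \<ge> 1 \<and> (f ^^ n) x = x"] that unfolding m_def by auto
  define C where "C = (\<lambda>i. (f ^^ i) x) ` {..<m}"
  have "is_cycle f m C" unfolding is_cycle_def C_def using m least by blast
  moreover have CS: "C \<subseteq> S" using iter[OF x] by (auto simp: C_def)
  have "x \<in> C" unfolding C_def using m(1) by (intro image_eqI[of _ _ 0]) auto
  then have "\<not> C \<subseteq> P" using x by (auto simp: S_def)
  moreover have "is_multiplier f m C (1 / c ^ m)" unfolding is_multiplier_def
  proof
    fix y assume y: "y \<in> C"
    then obtain i where "y = (f ^^ i) x" by (auto simp: C_def)
    then have "(f ^^ m) y = (f ^^ i) ((f ^^ m) x)" by (metis add.commute comp_apply funpow_add)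
    then have "(f ^^ m) y = y" using m \<open>y = (f ^^ i) x\<close> by simp
    moreover have "qres w y = c ^ m * sphere_deriv (f ^^ m) y * qres w ((f ^^ m) y)" "qres w y \<noteq> 0"
      using iter y CS by (auto simp: S_def)
    ultimately show "sphere_deriv (f ^^ m) y = 1 / c ^ m" using assms(2) by (simp add: field_simps)
  qed
  ultimately show ?thesis using m by blast
qed

lemma cycle_disjoint_P:
  assumes "is_cycle f m C" "\<not> C \<subseteq> P"
  shows "C \<inter> P = {}"
proof -
  obtain x where x: "m \<ge> 1" "(f ^^ m) x = x" "C = (\<lambda>i. (f ^^ i) x) ` {..<m}"
    using assms(1) unfolding is_cycle_def by blast
  show ?thesis
  proof (rule ccontr)
    assume "C \<inter> P \<noteq> {}"
    then obtain i where i: "i < m" "(f ^^ i) x \<in> P" using x by auto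
    have "(f ^^ j) x \<in> P" for j
    proof -
      have "(f ^^ (m - i + j)) ((f ^^ i) x) = (f ^^ j) ((f ^^ m) x)"
        using i by (simp add: funpow_add[symmetric, THEN fun_cong, unfolded o_def] add.commute)
      then show ?thesis using P_forward_funpow[OF i(2)] x(2) by metis
    qed
    then show False using assms(2) x(3) by auto
  qed
qed

text \<open>On the cycle the equation reads \<open>a y / f' y = c * a (f y)\<close>, a recursion
  that determines \<open>a\<close> from its value at one point. It closes up after \<open>m\<close>
  steps exactly because the multiplier is \<open>1 / c ^ m\<close>. Off the cycle \<open>a\<close>
  is zero, which is consistent because \<open>f\<close> is injective on the cycle and points outside
  it have no preimage in it.\<close>

lemma cycle_residues:
  assumes cyc: "is_cycle f m C" and CP: "\<not> C \<subseteq> P" and mult: "is_multiplier f m C (1 / c ^ m)" and c: "c \<noteq> 0"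
  shows "\<exists>a. (\<forall>y. a y \<noteq> 0 \<longleftrightarrow> y \<in> C) \<and> (\<forall>v. v \<notin> P \<longrightarrow> (\<Sum>x | f x = v. a x / sphere_deriv f x) = c * a v)"
proof -
  obtain x where x: "m \<ge> 1" "(f ^^ m) x = x" "C = (\<lambda>i. (f ^^ i) x) ` {..<m}"
    and least: "\<And>i. 0 < i \<Longrightarrow> i < m \<Longrightarrow> (f ^^ i) x \<noteq> x"
    using cyc unfolding is_cycle_def by blast
  have disj: "C \<inter> P = {}" using cycle_disjoint_P[OF cyc CP] .
  have fin: "finite C" using x by simp
  have inj: "inj_on (\<lambda>i. (f ^^ i) x) {..<m}"
  proof -
    have "False" if "i < j" "j < m" "(f ^^ i) x = (f ^^ j) x" for i j
    proof -
      have "(f ^^ (m - j + i)) x = (f ^^ (m - j)) ((f ^^ i) x)" by (simp add: funpow_add)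
      also have "\<dots> = (f ^^ (m - j + j)) x" using that(3) by (simp only: funpow_add comp_apply)
      also have "\<dots> = x" using that(2) x(2) by simp
      finally have fx: "(f ^^ (m - j + i)) x = x" .
      have "0 < m - j + i" "m - j + i < m" using that(1,2) by linarith+
      from least[OF this] fx show False by contradiction
    qed
    then show ?thesis unfolding inj_on_def by (metis lessThan_iff nat_neq_iff)
  qed
  have xC: "x \<in> C" unfolding x(3) using x(1) by (intro image_eqI[of _ _ 0]) auto
  have fC: "f y \<in> C" if "y \<in> C" for y
  proof -
    obtain i where i: "i < m" "y = (f ^^ i) x" using \<open>y \<in> C\<close> x(3) by auto
    show ?thesis
    proof (cases "Suc i = m")
      case True
      then have "f y = x" using i x(2) by (metis comp_apply funpow.simps(2))
      then show ?thesis using xC by simp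
    next
      case False
      then show ?thesis unfolding x(3) using i by (intro image_eqI[of _ _ "Suc i"]) auto
    qed
  qed
  have "C \<subseteq> f ` C"
  proof
    fix y assume "y \<in> C"
    then obtain i where i: "i < m" "y = (f ^^ i) x" using x(3) by auto
    show "y \<in> f ` C"
    proof (cases i)
      case 0
      have "y = f ((f ^^ (m - 1)) x)" using i 0 x(1,2) by (metis comp_apply funpow.simps(2) Suc_pred' One_nat_def Suc_le_eq funpow_0)
      then show ?thesis using x by auto
    next
      case (Suc k)
      then have "y = f ((f ^^ k) x)" using i by simp
      then show ?thesis using x(3) i Suc by auto
    qed
  qed
  then have "f ` C = C" using fC by blast
  then have injf: "inj_on f C" using fin by (simp add: eq_card_imp_inj_on)
  have ncrit: "sphere_deriv f y \<noteq> 0" if "y \<in> C" for y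
    using fC[OF that] disj not_P_preimage[of y] by blast
  define \<delta> where "\<delta> = (\<lambda>i. sphere_deriv (f ^^ i) x)"
  have \<delta>0: "\<delta> i \<noteq> 0" if "i \<le> m" for i
  proof -
    have "sphere_deriv f ((f ^^ j) x) \<noteq> 0" if "j < i" for j
      using that \<open>i \<le> m\<close> x(3) by (intro ncrit) auto
    then show ?thesis by (simp add: \<delta>_def sphere_deriv_funpow[OF sph_holo_f])
  qed
  have \<delta>S: "\<delta> (Suc i) = \<delta> i * sphere_deriv f ((f ^^ i) x)" for i
    by (simp only: \<delta>_def sphere_deriv_funpow[OF sph_holo_f] prod.lessThan_Suc)
  have \<delta>m: "\<delta> m = 1 / c ^ m" using mult xC by (simp add: \<delta>_def is_multiplier_def)
  define k where "k = the_inv_into {..<m} (\<lambda>i. (f ^^ i) x)"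
  have k: "k ((f ^^ i) x) = i" if "i < m" for i
    unfolding k_def using the_inv_into_f_f[OF inj, of i] that by simp
  \<comment> \<open>Solution of the recursion with value 1 at \<open>x\<close>; \<open>k y\<close>
    is the number of steps from \<open>x\<close> to \<open>y\<close> and \<open>\<delta>\<close> the
    derivative accumulated on the way.\<close>
  define a where "a = (\<lambda>y. if y \<in> C then 1 / (c ^ k y * \<delta> (k y)) else 0)"
  have a_nz: "a y \<noteq> 0 \<longleftrightarrow> y \<in> C" for y
    using c \<delta>0 k x(3) by (auto simp: a_def)
  have rel: "a y / sphere_deriv f y = c * a (f y)" if y: "y \<in> C" for y
  proof -
    obtain i where i: "i < m" "y = (f ^^ i) x" using y x(3) by auto
    have ay: "a y = 1 / (c ^ i * \<delta> i)" using y i k by (simp add: a_def)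
    show ?thesis
    proof (cases "Suc i = m")
      case True
      have fy: "f y = (f ^^ 0) x" using i x(2) True by (metis comp_apply funpow.simps(2) funpow_0)
      then have "a (f y) = 1" using k[of 0] x(1) xC by (simp add: a_def \<delta>_def sphere_deriv_funpow[OF sph_holo_f])
      moreover have "\<delta> i * sphere_deriv f y = 1 / (c ^ i * c)" using \<delta>m \<delta>S[of i] True i by (metis power_Suc2)
      moreover have "a y / sphere_deriv f y = 1 / (c ^ i * (\<delta> i * sphere_deriv f y))" using ay by (simp add: mult.assoc)
      ultimately show ?thesis using c by simp
    next
      case False
      then have "Suc i < m" using i by simp
      moreover have "f y = (f ^^ Suc i) x" using i by simp
      ultimately have "a (f y) = 1 / (c ^ Suc i * \<delta> (Suc i))" using k[of "Suc i"] fC[OF y] by (simp add: a_def)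
      then show ?thesis using ay \<delta>S[of i] i c by simp
    qed
  qed
  have "(\<Sum>y | f y = v. a y / sphere_deriv f y) = c * a v" for v
  proof (cases "v \<in> C")
    case True
    then have "v \<in> f ` C" using \<open>f ` C = C\<close> by simp
    then obtain y where y: "y \<in> C" "f y = v" by (metis imageE)
    have "(\<Sum>y' | f y' = v. a y' / sphere_deriv f y') = (\<Sum>y'\<in>{y}. a y' / sphere_deriv f y')"
    proof (rule sum.mono_neutral_right[OF finite_fibre])
      show "\<forall>y'\<in>{y'. f y' = v} - {y}. a y' / sphere_deriv f y' = 0"
      proof
        fix y' assume y': "y' \<in> {y'. f y' = v} - {y}"
        then have "y' \<notin> C" using inj_onD[OF injf _ _ y(1)] y(2) by auto
        then show "a y' / sphere_deriv f y' = 0" by (simp add: a_def)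
      qed
    qed (use y in auto)
    then show ?thesis using rel[OF y(1)] y(2) by simp
  next
    case False
    have "(\<Sum>y | f y = v. a y / sphere_deriv f y) = 0"
    proof (rule sum.neutral, rule ballI)
      fix y assume "y \<in> {y. f y = v}"
      then have "f y = v" by simp
      then have "y \<notin> C" using False fC[of y] by metis
      then show "a y / sphere_deriv f y = 0" by (simp add: a_def)
    qed
    then show ?thesis using False by (simp add: a_def)
  qed
  then show ?thesis using a_nz by blast
qed

section \<open>Differentials with prescribed residues\<close>

lemma QD_pole_residue:
  assumes "card S = 4" "x \<in> S"
  obtains w where "w \<in> QD" "qres w x = 1" "\<And>v. v \<notin> S \<Longrightarrow> qres w v = 0"
proof -
  obtain w where w: "w \<in> QD" "qd_poles w = S" using QD_four_poles[OF assms(1)] by blast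
  have 1: "qres w x \<noteq> 0" "\<And>v. v \<notin> S \<Longrightarrow> qres w v = 0"
    using w assms qres_tendsto(2)[OF w(1)] by auto
  show ?thesis
    by (rule that[of "qd_scale (1 / qres w x) w"]) (use 1 w in \<open>auto simp: QD_scale\<close>)
qed

text \<open>For each \<open>x\<close> in \<open>A\<close> there is a differential with poles exactly
  in \<open>U\<close> and \<open>x\<close>, scaled to residue 1 at \<open>x\<close>. Their
  combination has the desired residues on \<open>A\<close>; the three points of \<open>U\<close>
  serve as a waste bin whose residues are not controlled.\<close>

lemma QD_prescribed:
  assumes U: "card U = 3" "P \<inter> A = {}" "finite A" "A \<inter> U = {}"
    and a: "\<And>v. a v \<noteq> 0 \<Longrightarrow> v \<in> A"
  obtains w where "w \<in> QD" "\<And>v. v \<notin> U \<Longrightarrow> qres w v = a v"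
proof -
  have finU: "finite U" using U(1) card.infinite by force
  have "\<exists>w. w \<in> QD \<and> qres w x = 1 \<and> (\<forall>v. v \<notin> insert x U \<longrightarrow> qres w v = 0)" if "x \<in> A" for x
    using QD_pole_residue[of "insert x U" x] that U finU by (metis Int_iff card_insert_disjoint empty_iff insertI1 numeral_3_eq_3 numeral_eq_Suc pred_numeral_simps(2) semiring_norm(26,27))
  then obtain w where w: "\<And>x. x \<in> A \<Longrightarrow> w x \<in> QD" "\<And>x. x \<in> A \<Longrightarrow> qres (w x) x = 1"
    "\<And>x v. x \<in> A \<Longrightarrow> v \<notin> insert x U \<Longrightarrow> qres (w x) v = 0" by metis
  let ?w = "\<Sum>x\<in>A. qd_scale (a x) (w x)"
  have s: "?w \<in> QD \<and> qres ?w v = (\<Sum>x\<in>A. qres (qd_scale (a x) (w x)) v)" for v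
    using w by (intro QD_sum QD_scale)
  have "qres ?w v = a v" if v: "v \<notin> U" for v
  proof -
    have "qres ?w v = (\<Sum>x\<in>A. if v = x then a v else 0)"
      unfolding conjunct2[OF s] using w v by (intro sum.cong refl) (auto simp: QD_scale)
    also have "\<dots> = a v" using U(3) a by auto
    finally show ?thesis .
  qed
  then show ?thesis using that s by blast
qed

text \<open>Serves the case of two postcritical points, where the third free pole has to be taken
  from a cycle and the resulting error is cancelled by means of a second cycle.\<close>

definition two_cycles :: "complex \<Rightarrow> bool" where
  "two_cycles c \<longleftrightarrow> (\<exists>m1 C1 m2 C2. is_cycle f m1 C1 \<and> is_cycle f m2 C2 \<and> C1 \<inter> C2 = {} \<and>
     \<not> C1 \<subseteq> P \<and> \<not> C2 \<subseteq> P \<and> is_multiplier f m1 C1 (1 / c ^ m1) \<and> is_multiplier f m2 C2 (1 / c ^ m2))"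

lemma cycle_imp_eigenvalue:
  assumes cyc: "is_cycle f m C" and CP: "\<not> C \<subseteq> P" and mult: "is_multiplier f m C (1 / c ^ m)" and c: "c \<noteq> 0"
    and P: "card P \<ge> 3 \<or> card P = 2 \<and> two_cycles c"
  shows "c \<in> quot_eigenvalues f"
proof -
  have finC: "finite C'" "C' \<noteq> {}" if cyc': "is_cycle f m' C'" for m' C'
  proof -
    obtain x where "m' \<ge> 1" "C' = (\<lambda>i. (f ^^ i) x) ` {..<m'}" using cyc' unfolding is_cycle_def by blast
    then show "finite C'" "C' \<noteq> {}" by (simp_all add: lessThan_empty_iff)
  qed
  show ?thesis using P
  proof
    assume "card P \<ge> 3"
    then obtain U where U: "U \<subseteq> P" "card U = 3" by (metis obtain_subset_with_card_n)
    obtain a where a: "\<And>y. a y \<noteq> 0 \<longleftrightarrow> y \<in> C" "\<And>v. v \<notin> P \<Longrightarrow> (\<Sum>x | f x = v. a x / sphere_deriv f x) = c * a v"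
      using cycle_residues[OF cyc CP mult c] by blast
    have d: "P \<inter> C = {}" using cycle_disjoint_P[OF cyc CP] by blast
    obtain w where w: "w \<in> QD" "\<And>v. v \<notin> U \<Longrightarrow> qres w v = a v"
      by (rule QD_prescribed[OF U(2) d finC(1)[OF cyc], of a]) (use U d a in auto)
    have wa: "qres w v = a v" if "v \<notin> P" for v using w(2) U that by blast
    obtain y where "y \<in> C" using finC(2)[OF cyc] by blast
    then have "\<exists>v. v \<notin> P \<and> qres w v \<noteq> 0" using d wa a(1) by (metis Int_iff empty_iff)
    moreover have "(\<Sum>x | f x = v. qres w x / sphere_deriv f x) = c * qres w v" if v: "v \<notin> P" for v
    proof -
      have "(\<Sum>x | f x = v. qres w x / sphere_deriv f x) = (\<Sum>x | f x = v. a x / sphere_deriv f x)"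
        using v not_P_preimage wa by (intro sum.cong refl) auto
      then show ?thesis using a(2)[OF v] wa[OF v] by simp
    qed
    ultimately show ?thesis unfolding eigenvalue_iff using w(1) by blast
  next
    assume "card P = 2 \<and> two_cycles c"
    then obtain m1 C1 m2 C2 where P2: "card P = 2" and cy: "is_cycle f m1 C1" "is_cycle f m2 C2" "C1 \<inter> C2 = {}"
     "\<not> C1 \<subseteq> P" "\<not> C2 \<subseteq> P" "is_multiplier f m1 C1 (1 / c ^ m1)" "is_multiplier f m2 C2 (1 / c ^ m2)"
      unfolding two_cycles_def by blast
    obtain a where a: "\<And>y. a y \<noteq> 0 \<longleftrightarrow> y \<in> C1" "\<And>v. v \<notin> P \<Longrightarrow> (\<Sum>x | f x = v. a x / sphere_deriv f x) = c * a v"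
      using cycle_residues[OF cy(1,4,6) c] by blast
    obtain b where b: "\<And>y. b y \<noteq> 0 \<longleftrightarrow> y \<in> C2" "\<And>v. v \<notin> P \<Longrightarrow> (\<Sum>x | f x = v. b x / sphere_deriv f x) = c * b v"
      using cycle_residues[OF cy(2,5,7) c] by blast
    have d: "P \<inter> C1 = {}" "P \<inter> C2 = {}" using cycle_disjoint_P cy by blast+
    obtain x1 x2 where x12: "x1 \<in> C1" "x2 \<in> C2" using finC(2) cy(1,2) by blast
    let ?U = "insert x1 P"
    have U: "card ?U = 3" using P2 d x12 finite_postcritical by (subst card_insert_disjoint) auto
    obtain w where w: "w \<in> QD" "\<And>v. v \<notin> ?U \<Longrightarrow> qres w v = (if v = x1 then 0 else a v)"
      by (rule QD_prescribed[OF U, of "C1 - {x1}" "\<lambda>v. if v = x1 then 0 else a v"]) (use d a finC(1)[OF cy(1)] in \<open>auto split: if_splits\<close>)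
    obtain r where r: "r \<in> QD" "\<And>v. v \<notin> ?U \<Longrightarrow> qres r v = b v"
      by (rule QD_prescribed[OF U, of "C2" b]) (use d b finC(1)[OF cy(2)] x12 cy(3) in auto)
    \<comment> \<open>The third free pole is \<open>x1\<close>, on the first cycle, so both
      differentials may have a wrong residue there. \<open>\<alpha>\<close> and
      \<open>\<beta>\<close> are these errors with opposite sign conventions, and a combination with
      \<open>s * \<beta> = t * \<alpha>\<close> has the right residue at \<open>x1\<close>. It is
      not trivial outside \<open>P\<close> because the cycles are disjoint.\<close>
    define \<alpha> where "\<alpha> = qres r x1 - b x1"
    define \<beta> where "\<beta> = a x1 - qres w x1"
    define s t where "s = (if \<alpha> = 0 then 0 else \<alpha>)" and "t = (if \<alpha> = 0 then 1 else \<beta>)"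
    have st: "s * \<beta> = t * \<alpha>" "s \<noteq> 0 \<or> t \<noteq> 0" by (auto simp: s_def t_def)
    let ?g = "qd_scale s w + qd_scale t r"
    have g: "?g \<in> QD" "\<And>v. qres ?g v = s * qres w v + t * qres r v"
      using w r by (simp_all add: QD_add QD_scale)
    have gv: "qres ?g v = s * a v + t * b v" if v: "v \<notin> P" for v
    proof (cases "v = x1")
      case True
      then show ?thesis using st(1) unfolding g(2) \<alpha>_def \<beta>_def by (simp add: algebra_simps)
    next
      case False
      then show ?thesis using v w(2)[of v] r(2)[of v] g(2) by simp
    qed
    have a2: "a x2 = 0" "b x1 = 0" using a(1) b(1) x12 cy(3) by blast+
    have "\<exists>v. v \<notin> P \<and> qres ?g v \<noteq> 0"
    proof (cases "s = 0")
      case True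
      have x2P: "x2 \<notin> P" using x12 d by blast
      have "qres ?g x2 = s * a x2 + t * b x2" by (rule gv[OF x2P])
      also have "\<dots> = t * b x2" using True by simp
      also have "\<dots> \<noteq> 0" using st(2) True b(1)[of x2] x12 by simp
      finally show ?thesis using x2P by blast
    next
      case False
      have x1P: "x1 \<notin> P" using x12 d by blast
      have "qres ?g x1 = s * a x1 + t * b x1" by (rule gv[OF x1P])
      also have "\<dots> = s * a x1" using a2 by simp
      also have "\<dots> \<noteq> 0" using False a(1)[of x1] x12 by simp
      finally show ?thesis using x1P by blast
    qed
    moreover have "(\<Sum>x | f x = v. qres ?g x / sphere_deriv f x) = c * qres ?g v" if v: "v \<notin> P" for v
    proof -
      have "(\<Sum>x | f x = v. qres ?g x / sphere_deriv f x) = (\<Sum>x | f x = v. s * (a x / sphere_deriv f x) + t * (b x / sphere_deriv f x))"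
      proof (intro sum.cong refl)
        fix x assume "x \<in> {x. f x = v}"
        then have "x \<notin> P" using v not_P_preimage by auto
        then show "qres ?g x / sphere_deriv f x = s * (a x / sphere_deriv f x) + t * (b x / sphere_deriv f x)"
          by (simp add: gv add_divide_distrib)
      qed
      also have "\<dots> = s * (\<Sum>x | f x = v. a x / sphere_deriv f x) + t * (\<Sum>x | f x = v. b x / sphere_deriv f x)"
        by (simp only: sum.distrib sum_distrib_left)
      also have "\<dots> = s * (c * a v) + t * (c * b v)"
        by (simp only: a(2)[OF v] b(2)[OF v])
      finally show ?thesis using gv[OF v] by (simp add: algebra_simps)
    qed
    ultimately show ?thesis unfolding eigenvalue_iff using g(1) by blast
  qed
qed

text \<open>Two distinct points over the same value outside \<open>P\<close> can carry residues
  whose images cancel. With three points in \<open>P\<close> such residues are prescribed directly;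
  with two, a differential with exactly the four poles \<open>x1\<close>, \<open>x2\<close> and
  \<open>P\<close> is annihilated outright.\<close>

lemma zero_eigenvalue:
  assumes P: "card P \<ge> 2"
  shows "0 \<in> quot_eigenvalues f"
proof -
  have "finite {y. Some y \<in> P}" using finite_vimageI[OF finite_postcritical, of Some] by (simp add: vimage_def)
  then have "\<forall>\<^sub>\<infinity>y. Some y \<notin> P" by (simp add: eventually_cofinite)
  with generic_fibre_card have "\<forall>\<^sub>\<infinity>y. card {z. f (Some z) = Some y} = D \<and> Some y \<notin> P"
    by eventually_elim simp
  then have "finite {y. \<not> (card {z. f (Some z) = Some y} = D \<and> Some y \<notin> P)}"
    by (simp only: eventually_cofinite)
  from ex_new_if_finite[OF infinite_UNIV_char_0 this]
  obtain y where y: "card {z. f (Some z) = Some y} = D" "Some y \<notin> P" by blast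
  have "\<not> card {z. f (Some z) = Some y} \<le> 1" using y D2 by simp
  then obtain z1 z2 where z: "f (Some z1) = Some y" "f (Some z2) = Some y" "z1 \<noteq> z2"
    by (auto simp: card_le_Suc0_iff_eq[OF finite_Some_fibre])
  let ?v = "Some y"
  define x1 x2 where "x1 = Some z1" and "x2 = Some z2"
  have x: "f x1 = ?v" "f x2 = ?v" "x1 \<noteq> x2" using z by (auto simp: x1_def x2_def)
  have xP: "x1 \<notin> P" "x2 \<notin> P" "sphere_deriv f x1 \<noteq> 0" "sphere_deriv f x2 \<noteq> 0"
    using not_P_preimage[of x1] not_P_preimage[of x2] x y by auto
  show ?thesis
  proof (cases "card P \<ge> 3")
    case True
    then obtain U where U: "U \<subseteq> P" "card U = 3" by (metis obtain_subset_with_card_n)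
    define a where "a = (\<lambda>v. if v = x1 then sphere_deriv f x1 else if v = x2 then - sphere_deriv f x2 else 0)"
    obtain w where w: "w \<in> QD" "\<And>v. v \<notin> U \<Longrightarrow> qres w v = a v"
      by (rule QD_prescribed[OF U(2), of "{x1, x2}" a]) (use U xP in \<open>auto simp: a_def split: if_splits\<close>)
    have wa: "qres w v = a v" if "v \<notin> P" for v using w(2) U that by blast
    have "(\<Sum>x | f x = v. qres w x / sphere_deriv f x) = 0" if v: "v \<notin> P" for v
    proof -
      have "(\<Sum>x | f x = v. qres w x / sphere_deriv f x) = (\<Sum>x | f x = v. (if x = x1 then 1 else 0) + (if x = x2 then -1 else 0))"
      proof (intro sum.cong refl)
        fix x assume "x \<in> {x. f x = v}"
        then have "x \<notin> P" using v not_P_preimage by auto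
        then show "qres w x / sphere_deriv f x = (if x = x1 then 1 else 0) + (if x = x2 then -1 else 0)"
          using xP x(3) by (auto simp: wa a_def)
      qed
      also have "\<dots> = 0" using finite_fibre[of v] x by (simp add: sum.distrib)
      finally show ?thesis .
    qed
    moreover have "qres w x1 \<noteq> 0" using wa[OF xP(1)] xP by (simp add: a_def)
    ultimately show ?thesis unfolding eigenvalue_iff using w(1) xP(1) by auto
  next
    case False
    then have P2: "card P = 2" using P by simp
    have "card (insert x1 (insert x2 P)) = 4" using P2 xP x(3) finite_postcritical by simp
    then obtain w where w: "w \<in> QD" "qd_poles w = insert x1 (insert x2 P)" using QD_four_poles by blast
    have zero: "(\<Sum>x | f x = v. qres w x / sphere_deriv f x) = 0" if v: "v \<notin> P" "v \<noteq> ?v" for v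
    proof (rule sum.neutral, rule ballI)
      fix x assume "x \<in> {x. f x = v}"
      then have "x \<notin> insert x1 (insert x2 P)" using x v not_P_preimage by auto
      then show "qres w x / sphere_deriv f x = 0" using w qres_tendsto(2)[OF w(1), of x] by simp
    qed
    \<comment> \<open>The push-forward has at most three poles and therefore vanishes. The
      cancellation over \<open>?v\<close> is thus obtained without computing the two
      residues.\<close>
    have "qd_poles (pushforward f w) \<subseteq> insert ?v P"
    proof (rule subsetI, rule ccontr)
      fix u assume u: "u \<in> qd_poles (pushforward f w)" "u \<notin> insert ?v P"
      then have "qres (pushforward f w) u = 0" using qres_push[OF w(1), of u] zero[of u] by simp
      then show False using u(1) qres_tendsto(2)[OF pushforward_QD[OF w(1)]] by blast
    qed
    then have "card (qd_poles (pushforward f w)) \<le> card (insert ?v P)" using finite_postcritical by (intro card_mono) auto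
    also have "\<dots> \<le> 3" using P2 finite_postcritical by (simp add: card_insert_if)
    finally have "pushforward f w = 0" using QD_few_poles pushforward_QD[OF w(1)] by blast
    then have "(\<Sum>x | f x = v. qres w x / sphere_deriv f x) = 0 * qres w v" if "v \<notin> P" for v
      using qres_push[OF w(1) that] by simp
    moreover have "qres w x1 \<noteq> 0" using w qres_tendsto(2)[OF w(1), of x1] by simp
    ultimately show ?thesis unfolding eigenvalue_iff using w(1) xP(1) by blast
  qed
qed

end

section \<open>The exceptional case of two postcritical points\<close>

section \<open>Counting critical points\<close>

lemma degree_eq_sum_order:
  fixes r :: "complex poly"
  assumes "r \<noteq> 0" "finite S" "{z. poly r z = 0} \<subseteq> S"
  shows "degree r = (\<Sum>z\<in>S. order z r)"
proof -
  have "degree r = degree (smult (lead_coeff r) (\<Prod>z|poly r z = 0. [:-z, 1:] ^ order z r))"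
    by (simp only: complex_poly_decompose)
  also have "\<dots> = degree (\<Prod>z|poly r z = 0. [:-z, 1:] ^ order z r)"
    using assms(1) by (subst degree_smult_eq) simp
  also have "\<dots> = (\<Sum>z|poly r z = 0. degree ([:-z, 1:] ^ order z r))"
    by (rule degree_prod_sum_eq) auto
  also have "\<dots> = (\<Sum>z|poly r z = 0. order z r)"
    by (intro sum.cong refl) (simp add: degree_power_eq)
  also have "\<dots> = (\<Sum>z\<in>S. order z r)"
    by (rule sum.mono_neutral_left) (use assms in \<open>auto simp: order_0I\<close>)
  finally show ?thesis .
qed

lemma wronskian_swap: "wronskian b a = - wronskian a b"
  by (simp add: wronskian_def algebra_simps)

text \<open>Local ramification: writing \<open>a\<close> as the power \<open>Suc e\<close> of the
  linear factor times \<open>a1\<close>, the Wronskian is the power \<open>e\<close> times a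
  cofactor whose value at \<open>z\<close> is \<open>Suc e * a1 * b\<close>, nonzero in
  characteristic zero.\<close>

lemma order_wronskian:
  fixes a b :: "complex poly"
  assumes "poly a z = 0" "poly b z \<noteq> 0" "a \<noteq> 0"
  shows "Suc (order z (wronskian a b)) = order z a"
proof -
  obtain a1 where a1: "a = [:-z,1:] ^ order z a * a1" "\<not> [:-z, 1:] dvd a1"
    using order_decomp[of a z] assms by auto
  obtain e where e: "order z a = Suc e" using assms order_root[of a z] by (metis gr0_implies_Suc not_gr_zero)
  let ?l = "[:-z, 1:]"
  let ?g = "(smult (of_nat (Suc e)) a1 + ?l * pderiv a1) * b - ?l * a1 * pderiv b"
  have a: "a = ?l ^ Suc e * a1" using a1(1) e by simp
  have dl: "pderiv (?l ^ Suc e) = smult (of_nat (Suc e)) (?l ^ e)"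
    by (simp add: pderiv_power_Suc pderiv_pCons del: power_Suc of_nat_Suc)
  have "pderiv a = ?l ^ e * (smult (of_nat (Suc e)) a1 + ?l * pderiv a1)"
    unfolding a pderiv_mult dl by (simp add: algebra_simps del: mult_pCons_left mult_pCons_right of_nat_Suc)
  then have W: "wronskian a b = ?l ^ e * ?g"
    unfolding wronskian_def by (subst (2) a) (simp add: algebra_simps del: mult_pCons_left mult_pCons_right of_nat_Suc)
  have "poly ?g z = of_nat (Suc e) * poly a1 z * poly b z" by (simp del: of_nat_Suc)
  then have g: "poly ?g z \<noteq> 0" using a1(2) assms(2) by (simp add: poly_eq_0_iff_dvd del: of_nat_Suc)
  then have "?g \<noteq> 0" by (metis poly_0)
  then have "order z (wronskian a b) = order z (?l ^ e) + order z ?g"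
    unfolding W by (intro order_mult) (simp del: mult_pCons_left mult_pCons_right of_nat_Suc)
  also have "order z ?g = 0" using g by (rule order_0I)
  finally show ?thesis using e by (simp add: order_power_n_n)
qed

text \<open>The coefficient in degree \<open>degree a + degree b - 1\<close> is the difference of
  the degrees times both leading coefficients.\<close>

lemma degree_wronskian_ge:
  fixes a b :: "complex poly"
  assumes "a \<noteq> 0" "b \<noteq> 0" "degree a \<noteq> degree b"
  shows "degree a + degree b - 1 \<le> degree (wronskian a b)"
proof (rule le_degree)
  have *: "coeff (pderiv r * s) (degree r + degree s - 1) = of_nat (degree r) * lead_coeff r * lead_coeff s" for r s :: "complex poly"
  proof (cases "degree r = 0")
    case True
    then have "pderiv r = 0" by (simp add: pderiv_eq_0_iff)
    then show ?thesis using True by simp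
  next
    case False
    then have "degree r + degree s - 1 = degree (pderiv r) + degree s" by (simp add: degree_pderiv)
    then have "coeff (pderiv r * s) (degree r + degree s - 1) = lead_coeff (pderiv r) * lead_coeff s"
      by (simp only: coeff_mult_degree_sum)
    then show ?thesis using False by (simp add: degree_pderiv coeff_pderiv)
  qed
  have "coeff (wronskian a b) (degree a + degree b - 1) = (of_nat (degree a) - of_nat (degree b)) * (lead_coeff a * lead_coeff b)"
    using *[of a b] *[of b a] by (simp add: wronskian_def mult.commute add.commute algebra_simps)
  moreover have "of_nat (degree a) - of_nat (degree b) \<noteq> (0::complex)" using assms(3) by simp
  ultimately show "coeff (wronskian a b) (degree a + degree b - 1) \<noteq> 0" using assms by simp
qed

lemma coeff_hrev: "degree r \<le> D \<Longrightarrow> i \<le> D \<Longrightarrow> coeff (hrev D r) i = coeff r (D - i)"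
  by (auto simp: hrev_def coeff_monom_mult coeff_reflect_poly coeff_eq_0)

text \<open>The linear form with zero \<open>u\<close>; for infinity it dehomogenises to the
  constant 1.\<close>

definition mlin :: "sphere \<Rightarrow> complex poly" where
  "mlin u = (case u of Some c \<Rightarrow> [:-c, 1:] | None \<Rightarrow> 1)"

lemma mlin_simps [simp]: "mlin (Some c) = [:-c, 1:]" "mlin None = 1"
  by (simp_all add: mlin_def)

lemma single_root_poly:
  fixes r :: "complex poly"
  assumes "r \<noteq> 0" "{z. poly r z = 0} \<subseteq> {c}"
  shows "\<exists>\<alpha>. \<alpha> \<noteq> 0 \<and> r = smult \<alpha> ([:-c, 1:] ^ degree r)"
proof -
  have d: "degree r = order c r" using degree_eq_sum_order[OF assms(1) _ assms(2)] by simp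
  obtain s where s: "r = [:-c, 1:] ^ order c r * s" using order_1[of c r] by (auto elim: dvdE)
  then have s0: "s \<noteq> 0" using assms(1) by auto
  have "degree r = order c r + degree s"
    using s0 by (subst s, subst degree_mult_eq) (auto simp: degree_linear_power)
  then have "degree s = 0" using d by simp
  then obtain \<alpha> where "s = [:\<alpha>:]" by (rule degree_eq_zeroE)
  then have "r = smult \<alpha> ([:-c, 1:] ^ degree r)" "\<alpha> \<noteq> 0" using s s0 d by auto
  then show ?thesis by blast
qed

text \<open>By the Riemann--Hurwitz count, the fibres over the two branch points are single points.\<close>

lemma (in rational) two_branch_points:
  assumes crit: "\<And>x. sphere_deriv f x = 0 \<Longrightarrow> f x = Some 0 \<or> f x = None"
  shows "\<exists>\<alpha> \<beta> c1 c2. \<alpha> \<noteq> 0 \<and> \<beta> \<noteq> 0 \<and> c1 \<noteq> c2 \<and> p = smult \<alpha> (mlin c1 ^ D) \<and> q = smult \<beta> (mlin c2 ^ D)"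
proof -
  let ?W = "wronskian p q"
  have p0: "p \<noteq> 0"
  proof
    assume "p = 0"
    then have "is_unit q" using cop by simp
    then show False using \<open>p = 0\<close> deg D1 is_unit_iff_degree[OF q0] by simp
  qed
  have Wnz: "?W \<noteq> 0" by (rule wronskian_nonzero)
  define R where "R = {z. poly p z = 0} \<union> {z. poly q z = 0}"
  have finR: "finite R" using p0 q0 by (simp add: R_def poly_roots_finite)
  have disj: "poly p z = 0 \<Longrightarrow> poly q z \<noteq> 0" for z using coprime_poly_0[OF cop, of z] by auto
  have WR: "{z. poly ?W z = 0} \<subseteq> R"
  proof
    fix z assume "z \<in> {z. poly ?W z = 0}"
    then have "f (Some z) = Some 0 \<or> f (Some z) = None" using crit[of "Some z"] by (simp add: critical_Some_iff)
    then show "z \<in> R" by (auto simp: R_def rat_map_Some split: if_splits)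
  qed
  \<comment> \<open>A zero or pole of order e contributes e - 1 to the degree of the Wronskian and 1
    to the cardinality of \<open>R\<close>, and by assumption the Wronskian has no roots
    elsewhere.\<close>
  have "degree ?W + card R = (\<Sum>z\<in>R. order z ?W + 1)"
    unfolding degree_eq_sum_order[OF Wnz finR WR] by (simp only: sum.distrib card_eq_sum)
  also have "\<dots> = (\<Sum>z\<in>R. order z p + order z q)"
  proof (intro sum.cong refl)
    fix z assume "z \<in> R"
    then consider "poly p z = 0" "poly q z \<noteq> 0" | "poly q z = 0" "poly p z \<noteq> 0" using disj by (auto simp: R_def)
    then show "order z ?W + 1 = order z p + order z q"
    proof cases
      case 1
      then show ?thesis using order_wronskian[OF 1 p0] by (simp add: order_0I)
    next
      case 2
      have "order z (wronskian q p) = order z ?W" by (simp only: wronskian_swap[of q p] order_uminus)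
      then show ?thesis using order_wronskian[OF 2 q0] 2 by (simp add: order_0I)
    qed
  qed
  also have "\<dots> = degree p + degree q"
    using degree_eq_sum_order[OF p0 finR] degree_eq_sum_order[OF q0 finR] by (simp add: R_def sum.distrib)
  finally have RH: "degree ?W + card R = degree p + degree q" .
  have root: "\<exists>z. poly r z = 0" if "degree r \<ge> 1" for r :: "complex poly"
    using fundamental_theorem_of_algebra[of r] that by (simp add: constant_degree)
  show ?thesis
  proof (cases "degree p = degree q")
    case False
    \<comment> \<open>Unequal degrees mean that infinity itself is a zero or a pole, which leaves
      room for a single finite one.\<close>
    then have "card R \<le> 1" using RH degree_wronskian_ge[OF p0 q0] D1 deg by linarith
    moreover have "R \<noteq> {}"
    proof -
      have "degree p \<ge> 1 \<or> degree q \<ge> 1" using deg D1 by auto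
      then show ?thesis using root[of p] root[of q] by (auto simp: R_def)
    qed
    ultimately obtain c where R: "R = {c}"
    proof -
      assume R1: "card R \<le> 1" and "R \<noteq> {}" and th: "\<And>c. R = {c} \<Longrightarrow> thesis"
      then obtain c where "c \<in> R" by blast
      then have "R = {c}" using R1 card_le_Suc0_iff_eq[OF finR] by auto
      then show thesis by (rule th)
    qed
    obtain \<alpha> where \<alpha>: "\<alpha> \<noteq> 0" "p = smult \<alpha> ([:-c, 1:] ^ degree p)" using single_root_poly[OF p0, of c] R by (auto simp: R_def)
    obtain \<beta> where \<beta>: "\<beta> \<noteq> 0" "q = smult \<beta> ([:-c, 1:] ^ degree q)" using single_root_poly[OF q0, of c] R by (auto simp: R_def)
    have "degree p = 0 \<or> degree q = 0"
    proof (rule ccontr)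
      assume nz: "\<not> ?thesis"
      then have "poly (smult \<alpha> ([:-c, 1:] ^ degree p)) c = 0" "poly (smult \<beta> ([:-c, 1:] ^ degree q)) c = 0" by simp_all
      then have "poly p c = 0" "poly q c = 0" by (simp_all only: \<alpha>(2)[symmetric] \<beta>(2)[symmetric])
      then show False using disj by blast
    qed
    then show ?thesis
    proof
      assume "degree p = 0"
      then have "p = smult \<alpha> (mlin None ^ D)" "q = smult \<beta> (mlin (Some c) ^ D)" using \<alpha> \<beta> deg by auto
      then show ?thesis using \<alpha>(1) \<beta>(1) by (metis option.distinct(1))
    next
      assume "degree q = 0"
      then have "p = smult \<alpha> (mlin (Some c) ^ D)" "q = smult \<beta> (mlin None ^ D)" using \<alpha> \<beta> deg by auto
      then show ?thesis using \<alpha>(1) \<beta>(1) by (metis option.distinct(1))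
    qed
  next
    case True
    then have dD: "degree p = D" "degree q = D" using deg by auto
    have fN: "f None = Some (lead_coeff p / lead_coeff q)" using True by (simp add: rat_map_def)
    have "sphere_deriv f None \<noteq> 0" using crit[of None] fN p0 q0 by auto
    then have "poly (wronskian (hrev D p) (hrev D q)) 0 \<noteq> 0" by (simp add: critical_iff hpoly_def)
    moreover have "poly (pderiv (hrev D r)) 0 = coeff r (D - 1)" if "degree r \<le> D" for r :: "complex poly"
      using D1 by (simp add: poly_0_coeff_0 coeff_pderiv coeff_hrev[OF that])
    ultimately have ne: "coeff p (D - 1) * coeff q D - coeff p D * coeff q (D - 1) \<noteq> 0"
      using degs by (simp add: wronskian_def poly_hrev_0)
    \<comment> \<open>\<open>k\<close> is the value at infinity. Subtracting
      \<open>smult k q\<close> leaves the Wronskian unchanged and lowers the degree of the numerator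
      to exactly \<open>D - 1\<close>, because infinity is not critical. So the Wronskian has degree
      at least \<open>2 * D - 2\<close>.\<close>
    define k where "k = lead_coeff p / lead_coeff q"
    define p1 where "p1 = p - smult k q"
    have "coeff q D \<noteq> 0" using q0 dD by (metis leading_coeff_0_iff)
    then have kD: "coeff p D = k * coeff q D" by (simp add: k_def dD)
    have c1: "coeff p1 (D - 1) \<noteq> 0" using ne by (auto simp: p1_def kD algebra_simps)
    have "degree p1 \<le> D" unfolding p1_def by (rule degree_diff_le) (use dD in \<open>auto intro: order_trans[OF degree_smult_le]\<close>)
    moreover have "coeff p1 D = 0" by (simp add: p1_def kD)
    moreover have "p1 \<noteq> 0" using c1 by auto
    ultimately have "degree p1 \<noteq> D" by (metis leading_coeff_0_iff)
    then have "degree p1 \<noteq> degree q" using dD by simp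
    from degree_wronskian_ge[OF \<open>p1 \<noteq> 0\<close> q0 this]
    have "degree p1 + degree q - 1 \<le> degree (wronskian p1 q)" .
    moreover have "wronskian p1 q = ?W" by (simp add: wronskian_def p1_def pderiv_diff pderiv_smult algebra_simps)
    moreover have "degree p1 \<ge> D - 1" using c1 by (rule le_degree)
    ultimately have cR: "card R \<le> 2" using RH dD D1 by simp
    obtain z1 z2 where z: "poly p z1 = 0" "poly q z2 = 0" using root[of p] root[of q] dD D1 by auto
    have "z1 \<noteq> z2" using z disj by auto
    have sub: "{z1, z2} \<subseteq> R" using z by (simp add: R_def)
    have R: "R = {z1, z2}" using card_seteq[OF finR sub] cR \<open>z1 \<noteq> z2\<close> by simp
    have "{z. poly p z = 0} \<subseteq> {z1}" "{z. poly q z = 0} \<subseteq> {z2}" using R disj z by (auto simp: R_def)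
    then obtain \<alpha> \<beta> where ab: "\<alpha> \<noteq> 0" "\<beta> \<noteq> 0" "p = smult \<alpha> ([:-z1, 1:] ^ degree p)" "q = smult \<beta> ([:-z2, 1:] ^ degree q)"
      using single_root_poly[OF p0] single_root_poly[OF q0] by metis
    then have "p = smult \<alpha> (mlin (Some z1) ^ D)" "q = smult \<beta> (mlin (Some z2) ^ D)" using dD by auto
    moreover have "Some z1 \<noteq> Some z2" using \<open>z1 \<noteq> z2\<close> by simp
    ultimately show ?thesis using ab(1,2) by blast
  qed
qed

section \<open>Two postcritical points\<close>

definition mob :: "sphere \<Rightarrow> sphere \<Rightarrow> sphere \<Rightarrow> sphere" where
  "mob u v = rat_map (mlin u) (mlin v)"

lemma coprime_polyI:
  fixes a b :: "complex poly"
  assumes "\<And>z. poly a z = 0 \<Longrightarrow> poly b z \<noteq> 0" "a \<noteq> 0"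
  shows "coprime a b"
proof (rule coprimeI)
  fix c assume c: "c dvd a" "c dvd b"
  show "is_unit c"
  proof (rule ccontr)
    assume nu: "\<not> is_unit c"
    have "c \<noteq> 0" using c(1) assms(2) by auto
    with nu have "degree c \<noteq> 0" by (simp add: is_unit_iff_degree)
    then obtain z where "poly c z = 0" using fundamental_theorem_of_algebra[of c] by (auto simp: constant_degree)
    then show False using c assms(1)[of z] by (auto elim!: dvdE)
  qed
qed

lemma rational_mob: "u \<noteq> v \<Longrightarrow> rational (mlin u) (mlin v) 1"
  by unfold_locales (cases u; cases v; auto intro!: coprime_polyI simp: max_def)+

lemma sphere_deriv_mob:
  assumes "u \<noteq> v"
  shows "sphere_deriv (mob u v) x \<noteq> 0"
proof -
  interpret rational "mlin u" "mlin v" 1 by (rule rational_mob[OF assms])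
  have h: "hrev (Suc 0) [:-c, 1:] = [:1, -c:]" "hrev (Suc 0) 1 = [:0, 1::complex:]" for c :: complex
    by (auto simp: hrev_def reflect_poly_def monom_Suc)
  show ?thesis unfolding mob_def critical_iff using assms
    by (cases x; cases u; cases v) (auto simp: hpoly_def h wronskian_def pderiv_pCons pderiv_1)
qed

lemma sph_holo_mob: "u \<noteq> v \<Longrightarrow> sph_holo (mob u v)"
  unfolding mob_def by (rule rational.sph_holo_f[OF rational_mob])

lemma mob_simps:
  "mob u v (Some z) = (if poly (mlin v) z = 0 then None else Some (poly (mlin u) z / poly (mlin v) z))"
  "mob (Some a) (Some b) None = Some 1" "mob None (Some b) None = Some 0" "mob (Some a) None None = None"
  by (auto simp: mob_def rat_map_def)

lemma mob_zero_iff: "u \<noteq> v \<Longrightarrow> mob u v x = Some 0 \<longleftrightarrow> x = u"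
  by (cases x; cases u; cases v) (auto simp: mob_simps)

lemma mob_pole_iff: "u \<noteq> v \<Longrightarrow> mob u v x = None \<longleftrightarrow> x = v"
  by (cases x; cases u; cases v) (auto simp: mob_simps)

lemma mob_surj:
  assumes "u \<noteq> v"
  shows "\<exists>x. mob u v x = Some w"
proof (cases u; cases v)
  fix a b assume ab: "u = Some a" "v = Some b"
  show ?thesis
  proof (cases "w = 1")
    case True
    then show ?thesis using ab by (intro exI[of _ None]) (simp add: mob_simps)
  next
    case False
    let ?z = "(a - w * b) / (1 - w)"
    have "?z - b = (a - b) / (1 - w)" "?z - a = w * (a - b) / (1 - w)"
      using False by (simp_all add: divide_simps) (simp_all add: algebra_simps)
    then have "mob u v (Some ?z) = Some w"
      using ab assms False by (simp add: mob_simps)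
    then show ?thesis by blast
  qed
next
  fix b assume "u = None" "v = Some b"
  then show ?thesis
    by (cases "w = 0") (auto simp: mob_simps intro: exI[of _ None] exI[of _ "Some (b + 1 / w)"])
next
  fix a assume "u = Some a" "v = None"
  then show ?thesis by (intro exI[of _ "Some (w + a)"]) (simp add: mob_simps)
qed (use assms in auto)

lemma mob_inj:
  assumes "u \<noteq> v" "mob u v x = mob u v y"
  shows "x = y"
proof -
  have *: "z = z'" if "(z - a) / (z - b) = (z' - a) / (z' - b)" "z \<noteq> b" "z' \<noteq> b" "a \<noteq> b" for z z' a b :: complex
  proof -
    have "(z - a) * (z' - b) = (z' - a) * (z - b)" using that by (simp add: divide_simps)
    then have "(a - b) * (z - z') = 0" by (simp add: algebra_simps)
    then show ?thesis using that(4) by simp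
  qed
  show ?thesis using assms
    by (cases u; cases v; cases x; cases y) (auto simp: mob_simps dest: * split: if_splits)
qed

context rational
begin

text \<open>The member of the pencil of \<open>p\<close> and \<open>q\<close> that vanishes on the
  fibre over \<open>u\<close>; these are numerator and denominator after \<open>f\<close> is
  followed by \<open>mob u v\<close>.\<close>

definition lpoly :: "sphere \<Rightarrow> complex poly" where
  "lpoly u = (case u of Some c \<Rightarrow> p - smult c q | None \<Rightarrow> q)"

lemma lpoly_simps [simp]: "lpoly (Some c) = p - smult c q" "lpoly None = q"
  by (simp_all add: lpoly_def)

lemma degree_lpoly: "degree (lpoly u) \<le> D"
  by (cases u) (auto intro!: degree_diff_le degs intro: order_trans[OF degree_smult_le])

lemma lpoly_nz: "lpoly u \<noteq> 0"
  by (cases u) (auto simp: q0 pencil_nonzero simp del: right_minus_eq)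

lemma rational_lpoly:
  assumes "u \<noteq> v"
  shows "rational (lpoly u) (lpoly v) D"
proof
  show "lpoly v \<noteq> 0" by (rule lpoly_nz)
  show "coprime (lpoly u) (lpoly v)"
  proof (rule coprime_polyI[OF _ lpoly_nz])
    fix z assume "poly (lpoly u) z = 0"
    then show "poly (lpoly v) z \<noteq> 0"
      using coprime_poly_0[OF cop, of z] assms by (cases u; cases v) auto
  qed
  have "coeff p D \<noteq> 0 \<or> coeff q D \<noteq> 0"
    using degs D1 by (metis degree_0 leading_coeff_0_iff not_one_le_zero)
  then have "coeff (lpoly u) D \<noteq> 0 \<or> coeff (lpoly v) D \<noteq> 0"
    using assms by (cases u; cases v) auto
  then have "D \<le> degree (lpoly u) \<or> D \<le> degree (lpoly v)" using le_degree by blast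
  then show "max (degree (lpoly u)) (degree (lpoly v)) = D" using degree_lpoly[of u] degree_lpoly[of v] by auto
  show "D \<ge> 1" by (rule D1)
qed

lemma poly_hpoly_lpoly:
  "poly (hpoly D x (lpoly u)) (chart x x) =
    (case u of Some c \<Rightarrow> poly (hpoly D x p) (chart x x) - c * poly (hpoly D x q) (chart x x)
     | None \<Rightarrow> poly (hpoly D x q) (chart x x))"
proof (cases x)
  case [simp]: None
  have "poly (hrev D (lpoly u)) 0 = coeff (lpoly u) D" by (rule poly_hrev_0[OF degree_lpoly])
  then show ?thesis using degs by (cases u) (auto simp: hpoly_def poly_hrev_0)
next
  case (Some z)
  then show ?thesis by (cases u) (auto simp: hpoly_def)
qed

lemma f_homogeneous:
  "f x = (if poly (hpoly D x q) (chart x x) = 0 then None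
    else Some (poly (hpoly D x p) (chart x x) / poly (hpoly D x q) (chart x x)))"
  using f_chart_inv[of x "chart x x"] by (simp add: rat_map_Some)

lemma mob_comp:
  assumes "u \<noteq> v"
  shows "mob u v \<circ> f = rat_map (lpoly u) (lpoly v)"
proof
  fix x
  interpret L: rational "lpoly u" "lpoly v" D by (rule rational_lpoly[OF assms])
  show "(mob u v \<circ> f) x = rat_map (lpoly u) (lpoly v) x"
    unfolding L.f_homogeneous comp_apply f_homogeneous poly_hpoly_lpoly
    using hpoly_no_common[of x "chart x x"] assms
    by (cases u; cases v) (auto simp: mob_simps divide_simps)
qed

end

text \<open>The map \<open>w \<mapsto> \<gamma> w^K\<close> for positive or negative \<open>K\<close>, on the complement of \<open>0\<close> and infinity.\<close>

locale two_point_pcf = pcf +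
  fixes u v :: sphere and \<gamma> :: complex and K :: int
  assumes uv: "u \<noteq> v" "P = {u, v}" and \<gamma>: "\<gamma> \<noteq> 0" and K: "\<bar>K\<bar> = int D"
    and conj_power: "\<And>x. x \<notin> P \<Longrightarrow> mob u v (f x) = Some (\<gamma> * (the (mob u v x)) powi K)"
    and conj_deriv: "\<And>x. x \<notin> P \<Longrightarrow> sphere_deriv (mob u v \<circ> f) x =
       \<gamma> * of_int K * (the (mob u v x)) powi (K - 1) * sphere_deriv (mob u v) x"

lemma rat_map_power_comp:
  assumes "a \<noteq> b" "\<alpha> \<noteq> 0" "\<beta> \<noteq> 0" "n \<ge> 1"
  shows "rat_map (smult \<alpha> (mlin a ^ n)) (smult \<beta> (mlin b ^ n)) = rat_map (monom \<alpha> n) [:\<beta>:] \<circ> mob a b"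
proof
  fix x show "rat_map (smult \<alpha> (mlin a ^ n)) (smult \<beta> (mlin b ^ n)) x = (rat_map (monom \<alpha> n) [:\<beta>:] \<circ> mob a b) x"
  proof (cases x)
    case (Some z)
    then show ?thesis using assms
      by (auto simp: rat_map_def mob_simps degree_monom_eq poly_monom power_divide)
  next
    case None
    have lc: "lead_coeff ([:-c, 1:] ^ n) = 1" for c :: complex by (simp add: lead_coeff_power)
    show ?thesis using assms lc None
      by (cases a; cases b) (auto simp: rat_map_def mob_simps degree_monom_eq poly_monom degree_linear_power power_0_left coeff_eq_0)
  qed
qed

lemma rational_power:
  assumes "\<alpha> \<noteq> 0" "\<beta> \<noteq> 0" "n \<ge> 1"
  shows "rational (monom \<alpha> n) [:\<beta>:] n"
proof
  show "coprime (monom \<alpha> n) [:\<beta>:]"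
    using assms by (intro coprime_polyI) (auto simp: monom_eq_0_iff)
qed (use assms in \<open>auto simp: degree_monom_eq\<close>)

lemma sphere_deriv_power:
  assumes "\<alpha> \<noteq> 0" "\<beta> \<noteq> 0" "n \<ge> 2"
  shows "sphere_deriv (rat_map (monom \<alpha> n) [:\<beta>:]) (Some 0) = 0" "sphere_deriv (rat_map (monom \<alpha> n) [:\<beta>:]) None = 0"
    "sphere_deriv (rat_map (monom \<alpha> n) [:\<beta>:]) (Some w) = of_nat n * (\<alpha> / \<beta>) * w ^ (n - 1)"
proof -
  interpret rational "monom \<alpha> n" "[:\<beta>:]" n using assms by (intro rational_power) auto
  have pd: "poly (pderiv (monom \<alpha> n)) w = of_nat n * \<alpha> * w ^ (n - 1)" for w
    by (simp add: pderiv_monom poly_monom)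
  show *: "sphere_deriv f (Some w) = of_nat n * (\<alpha> / \<beta>) * w ^ (n - 1)" for w
    unfolding sphere_deriv_f using assms
    by (auto simp: rat_map_Some hpoly_def wronskian_def pd pderiv_pCons power2_eq_square)
  show "sphere_deriv f (Some 0) = 0" using *[of 0] assms by simp
  have "poly (hrev n [:\<beta>:]) 0 = 0" using assms by (subst poly_hrev_0) (auto simp: coeff_pCons split: nat.split)
  moreover have "poly (pderiv (hrev n [:\<beta>:])) 0 = 0"
  proof -
    have "poly (pderiv (hrev n [:\<beta>:])) 0 = coeff (hrev n [:\<beta>:]) 1" by (simp add: poly_0_coeff_0 coeff_pderiv)
    also have "\<dots> = 0" using assms by (subst coeff_hrev) (auto simp: coeff_pCons split: nat.split)
    finally show ?thesis .
  qed
  ultimately show "sphere_deriv f None = 0" by (simp add: critical_iff hpoly_def wronskian_def)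
qed

lemma mob_swap:
  assumes "mob u v x = Some w" "w \<noteq> 0" "u \<noteq> v"
  shows "mob v u x = Some (1 / w)"
  using assms by (cases x; cases u; cases v) (auto simp: mob_simps split: if_splits)

lemma mob_swap_eq:
  assumes "u \<noteq> v"
  shows "mob v u = rat_map 1 [:0, 1:] \<circ> mob u v"
proof
  fix y
  show "mob v u y = (rat_map 1 [:0, 1:] \<circ> mob u v) y"
  proof (cases "mob u v y")
    case None
    then have "y = v" using mob_pole_iff[OF assms] by blast
    then show ?thesis using None mob_zero_iff[of v u v] assms by (simp add: rat_map_def)
  next
    case (Some w)
    show ?thesis
    proof (cases "w = 0")
      case True
      then have "y = u" using Some mob_zero_iff[OF assms] by blast
      then show ?thesis using Some True mob_pole_iff[of v u u] assms by (simp add: rat_map_Some)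
    next
      case False
      then show ?thesis using mob_swap[OF Some False assms] Some by (simp add: rat_map_Some)
    qed
  qed
qed

context pcf
begin

text \<open>By \<open>two_branch_points\<close>, \<open>f\<close> followed by \<open>mob u v\<close>
  is a constant times the power \<open>D\<close> of \<open>mob c1 c2\<close>, where
  \<open>c1\<close> and \<open>c2\<close> are critical and form the whole preimage of
  \<open>P\<close>. Forward invariance then puts \<open>u\<close> and \<open>v\<close> among
  \<open>c1\<close> and \<open>c2\<close>. The order in which they correspond decides the sign of
  \<open>K\<close>. Only an inclusion is assumed, so that sets \<open>P\<close> with fewer points
  can be ruled out.\<close>

lemma postcritical_two:
  assumes uv: "u \<noteq> v" "P \<subseteq> {u, v}"
  shows "P = {u, v} \<and> (\<exists>\<gamma> K. two_point_pcf p q D u v \<gamma> K)"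
proof -
  let ?h = "rat_map (lpoly u) (lpoly v)"
  interpret L: rational "lpoly u" "lpoly v" D by (rule rational_lpoly[OF uv(1)])
  have h: "mob u v \<circ> f = ?h" by (rule mob_comp[OF uv(1)])
  have dh: "sphere_deriv ?h x = sphere_deriv (mob u v) (f x) * sphere_deriv f x" for x
    unfolding h[symmetric] by (rule sphere_deriv_comp[OF sph_holo_f sph_holo_mob[OF uv(1)]])
  have crit: "sphere_deriv ?h x = 0 \<longleftrightarrow> sphere_deriv f x = 0" for x
    using dh[of x] sphere_deriv_mob[OF uv(1)] by simp
  have hx: "?h x = mob u v (f x)" for x using h by (metis comp_apply)
  have br: "?h x = Some 0 \<or> ?h x = None" if "sphere_deriv ?h x = 0" for x
    using critical_value_in_P[of x] that uv(2) unfolding crit hx mob_zero_iff[OF uv(1)] mob_pole_iff[OF uv(1)] by blast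
  obtain \<alpha> \<beta> c1 c2 where ab: "\<alpha> \<noteq> 0" "\<beta> \<noteq> 0" "c1 \<noteq> c2" "lpoly u = smult \<alpha> (mlin c1 ^ D)" "lpoly v = smult \<beta> (mlin c2 ^ D)"
    using L.two_branch_points[OF br] by blast
  let ?g = "rat_map (monom \<alpha> D) [:\<beta>:]"
  have hg: "?h = ?g \<circ> mob c1 c2" unfolding ab(4,5) by (rule rat_map_power_comp[OF ab(3,1,2) D1])
  have g_holo: "sph_holo ?g" by (rule rational.sph_holo_f[OF rational_power[OF ab(1,2) D1]])
  note gd = sphere_deriv_power[OF ab(1,2) D2]
  have dh': "sphere_deriv ?h x = sphere_deriv ?g (mob c1 c2 x) * sphere_deriv (mob c1 c2) x" for x
    unfolding hg by (rule sphere_deriv_comp[OF sph_holo_mob[OF ab(3)] g_holo])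
  have gS: "?g (Some w) = Some (\<alpha> / \<beta> * w ^ D)" for w using ab by (simp add: rat_map_Some poly_monom)
  have gN: "?g None = None" using D1 ab by (simp add: rat_map_def degree_monom_eq)
  have m1: "mob c1 c2 c1 = Some 0" "mob c1 c2 c2 = None" using mob_zero_iff mob_pole_iff ab(3) by blast+
  have "sphere_deriv f c1 = 0" "sphere_deriv f c2 = 0" using dh' m1 gd(1,2) crit by (metis mult_zero_left)+
  then have fc: "f c1 \<in> P" "f c2 \<in> P" using critical_value_in_P by blast+
  have "?h c1 = Some 0" "?h c2 = None" using hg m1 gS gN D1 by (simp_all add: power_0_left)
  then have "f c1 = u" "f c2 = v" using hx mob_zero_iff[OF uv(1)] mob_pole_iff[OF uv(1)] by metis+
  then have P: "P = {u, v}" using fc uv(2) by blast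
  have inv: "x = c1 \<or> x = c2" if x: "f x \<in> P" for x
  proof -
    have "?h x = Some 0 \<or> ?h x = None" using x P unfolding hx mob_zero_iff[OF uv(1)] mob_pole_iff[OF uv(1)] by blast
    then have "mob c1 c2 x = Some 0 \<or> mob c1 c2 x = None"
      unfolding hg comp_apply using gS ab(1,2) by (cases "mob c1 c2 x") auto
    then show ?thesis unfolding mob_zero_iff[OF ab(3)] mob_pole_iff[OF ab(3)] .
  qed
  have "u \<in> {c1, c2}" "v \<in> {c1, c2}" using inv[of u] inv[of v] P P_forward by blast+
  then consider "c1 = u" "c2 = v" | "c1 = v" "c2 = u" using uv(1) by blast
  then have "\<exists>\<gamma> K. two_point_pcf p q D u v \<gamma> K"
  proof cases
    case 1
    have "two_point_pcf p q D u v (\<alpha> / \<beta>) (int D)"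
    proof
      fix x assume "x \<notin> P"
      then obtain w where w: "mob u v x = Some w" using P mob_pole_iff[OF uv(1)] by (metis insertCI not_None_eq)
      show "mob u v (f x) = Some (\<alpha> / \<beta> * (the (mob u v x)) powi int D)"
        using hx[of x] hg gS w 1 by simp
      have "int D - 1 = int (D - 1)" using D1 by simp
      then show "sphere_deriv (mob u v \<circ> f) x = \<alpha> / \<beta> * of_int (int D) * (the (mob u v x)) powi (int D - 1) * sphere_deriv (mob u v) x"
        unfolding h dh' 1 w gd(3) by (simp only: option.sel power_int_of_nat of_int_of_nat_eq) simp
    qed (use uv(1) P ab in auto)
    then show ?thesis by blast
  next
    \<comment> \<open>Exchanging \<open>u\<close> and \<open>v\<close> inverts the coordinate, which
      turns the exponent \<open>D\<close> into \<open>- int D\<close>.\<close>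
    case 2
    have "two_point_pcf p q D u v (\<alpha> / \<beta>) (- int D)"
    proof
      fix x assume x: "x \<notin> P"
      then obtain w where w: "mob u v x = Some w" using P mob_pole_iff[OF uv(1)] by (metis insertCI not_None_eq)
      have w0: "w \<noteq> 0" using x P w mob_zero_iff[OF uv(1)] by (metis insertCI)
      have w': "mob v u x = Some (1 / w)" by (rule mob_swap[OF w w0 uv(1)])
      show "mob u v (f x) = Some (\<alpha> / \<beta> * (the (mob u v x)) powi (- int D))"
      proof -
        have "w powi (- int D) = (1 / w) ^ D" by (simp add: power_int_minus power_one_over inverse_eq_divide)
        then show ?thesis using hx[of x] hg gS w' w 2 by simp
      qed
      have dm: "sphere_deriv (mob v u) x = - (1 / w\<^sup>2) * sphere_deriv (mob u v) x"
      proof -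
        let ?i = "rat_map 1 [:0, 1:]"
        have ri: "rational 1 [:0, 1::complex:] 1" by unfold_locales (auto)
        have e: "sphere_deriv (mob v u) x = sphere_deriv (?i \<circ> mob u v) x"
          by (simp only: mob_swap_eq[OF uv(1)])
        have "sphere_deriv (?i \<circ> mob u v) x = sphere_deriv ?i (Some w) * sphere_deriv (mob u v) x"
          using sphere_deriv_comp[OF sph_holo_mob[OF uv(1)] rational.sph_holo_f[OF ri], of x] w by simp
        moreover have "sphere_deriv ?i (Some w) = - (1 / w\<^sup>2)"
          unfolding rational.sphere_deriv_f[OF ri] using w0
          by (simp add: rat_map_Some hpoly_def wronskian_def pderiv_pCons pderiv_1)
        ultimately show ?thesis using e by simp
      qed
      have E: "(1 / w) ^ (D - 1) * (1 / w\<^sup>2) = w powi (- int D - 1)"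
      proof -
        have "- int D - 1 = - int (Suc D)" by simp
        then have "w powi (- int D - 1) = inverse (w ^ Suc D)" by (simp only: power_int_minus power_int_of_nat)
        also have "\<dots> = (1 / w) ^ (D - 1 + 2)" using D1 by (simp add: power_one_over inverse_eq_divide)
        also have "\<dots> = (1 / w) ^ (D - 1) * (1 / w\<^sup>2)" by (simp only: power_add power_one_over)
        finally show ?thesis by simp
      qed
      then show "sphere_deriv (mob u v \<circ> f) x = \<alpha> / \<beta> * of_int (- int D) * (the (mob u v x)) powi (- int D - 1) * sphere_deriv (mob u v) x"
        unfolding h dh' 2 w w' gd(3) dm option.sel E[symmetric]
        by (simp only: of_int_minus of_int_of_nat_eq mult_minus_left mult_minus_right mult_ac)
    qed (use uv(1) P ab in auto)
    then show ?thesis by blast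
  qed
  then show ?thesis using P by blast
qed

text \<open>A smaller \<open>P\<close> could be padded by an arbitrary second point, which
  \<open>postcritical_two\<close> would then force to belong to \<open>P\<close>.\<close>

lemma card_P_ge_2: "card P \<ge> 2"
proof (rule ccontr)
  assume "\<not> card P \<ge> 2"
  then have "card P \<le> 1" by simp
  then obtain w where w: "P \<subseteq> {w}" using finite_postcritical by (metis One_nat_def card_le_Suc0_iff_eq empty_subsetI insertCI subsetI subset_singletonD)
  obtain v where v: "v \<noteq> w" by (metis option.distinct(1) not_None_eq)
  have "P \<subseteq> {w, v}" using w by blast
  then have "P = {w, v}" using postcritical_two[of w v] v by blast
  then show False using w v by blast
qed

lemma card_P_2: "card P = 2 \<Longrightarrow> \<exists>u v \<gamma> K. two_point_pcf p q D u v \<gamma> K"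
  using postcritical_two by (metis card_2_iff subset_refl)

end

context two_point_pcf
begin

abbreviation M :: "sphere \<Rightarrow> sphere" where "M \<equiv> mob u v"

text \<open>The vector field \<open>w d/dw\<close> in the coordinate \<open>w = M\<close>; \<open>f\<close> multiplies it by \<open>K\<close>.\<close>

definition euler_field :: "sphere \<Rightarrow> complex" where
  "euler_field x = the (M x) / sphere_deriv M x"

lemma M_Some: "x \<notin> P \<Longrightarrow> \<exists>w. w \<noteq> 0 \<and> M x = Some w"
  using mob_zero_iff[OF uv(1), of x] mob_pole_iff[OF uv(1), of x] uv(2) by (cases "M x") auto

lemma M_not_P: "M x = Some w \<Longrightarrow> w \<noteq> 0 \<Longrightarrow> x \<notin> P"
  using mob_zero_iff[OF uv(1), of x] mob_pole_iff[OF uv(1), of x] uv(2) by auto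

lemma f_not_P: "x \<notin> P \<Longrightarrow> f x \<notin> P"
proof -
  assume x: "x \<notin> P"
  then obtain w where w: "w \<noteq> 0" "M x = Some w" using M_Some by blast
  show ?thesis
    by (rule M_not_P[of "f x" "\<gamma> * w powi K"]) (use conj_power[OF x] w \<gamma> in \<open>simp_all add: power_int_eq_0_iff\<close>)
qed

lemma K_facts: "K \<noteq> 0" "\<bar>K\<bar> \<ge> 2"
  using K D2 by auto

lemma sphere_deriv_euler:
  assumes "x \<notin> P"
  shows "sphere_deriv f x = of_int K * euler_field (f x) / euler_field x"
proof -
  obtain w where w: "w \<noteq> 0" "M x = Some w" using M_Some[OF assms] by blast
  have d: "sphere_deriv M y \<noteq> 0" for y by (rule sphere_deriv_mob[OF uv(1)])
  have "sphere_deriv M (f x) * sphere_deriv f x = \<gamma> * of_int K * w powi (K - 1) * sphere_deriv M x"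
    using conj_deriv[OF assms] sphere_deriv_comp[OF sph_holo_f sph_holo_mob[OF uv(1)], of x] w by simp
  moreover have "w powi (K - 1) = w powi K / w" using w(1) by (simp add: power_int_diff)
  ultimately have "sphere_deriv M (f x) * sphere_deriv f x = of_int K * (\<gamma> * w powi K) * sphere_deriv M x / w"
    by simp
  then have "sphere_deriv f x = of_int K * (\<gamma> * w powi K) * sphere_deriv M x / w / sphere_deriv M (f x)"
    using d[of "f x"] by (metis nonzero_mult_div_cancel_left)
  then show ?thesis using conj_power[OF assms] w by (simp add: euler_field_def)
qed

lemma orbit_euler:
  assumes "x \<notin> P"
  shows "(f ^^ n) x \<notin> P \<and> sphere_deriv (f ^^ n) x = of_int K ^ n * euler_field ((f ^^ n) x) / euler_field x"
proof (induction n)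
  case 0
  have "euler_field x \<noteq> 0"
    using M_Some[OF assms] sphere_deriv_mob[OF uv(1), of x] by (auto simp: euler_field_def)
  then show ?case using assms by simp
next
  case (Suc n)
  have "euler_field ((f ^^ n) x) \<noteq> 0"
    using M_Some[of "(f ^^ n) x"] Suc sphere_deriv_mob[OF uv(1), of "(f ^^ n) x"] by (auto simp: euler_field_def)
  moreover have "sphere_deriv (f ^^ Suc n) x = sphere_deriv f ((f ^^ n) x) * sphere_deriv (f ^^ n) x"
    unfolding funpow.simps by (rule sphere_deriv_comp[OF sph_holo_funpow[OF sph_holo_f] sph_holo_f])
  moreover have "sphere_deriv f ((f ^^ n) x) = of_int K * euler_field (f ((f ^^ n) x)) / euler_field ((f ^^ n) x)"
    by (rule sphere_deriv_euler) (use Suc in blast)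
  moreover have "sphere_deriv (f ^^ n) x = of_int K ^ n * euler_field ((f ^^ n) x) / euler_field x" using Suc by blast
  moreover have "(c * a / b) * (d * b / e) = (c * d) * a / e" if "b \<noteq> 0" for a b c d e :: complex using that by simp
  ultimately have "sphere_deriv (f ^^ Suc n) x = (of_int K * of_int K ^ n) * euler_field (f ((f ^^ n) x)) / euler_field x"
    by (simp only:)
  moreover have "(f ^^ Suc n) x = f ((f ^^ n) x)" by simp
  moreover have "f ((f ^^ n) x) \<notin> P" using Suc f_not_P by blast
  ultimately show ?case by (metis power_Suc)
qed

lemma periodic_multiplier:
  assumes "x \<notin> P" "(f ^^ m) x = x"
  shows "sphere_deriv (f ^^ m) x = of_int K ^ m"
proof -
  have "euler_field x \<noteq> 0"
    using M_Some[OF assms(1)] sphere_deriv_mob[OF uv(1), of x] by (auto simp: euler_field_def)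
  then show ?thesis using orbit_euler[OF assms(1), of m] assms(2) by simp
qed

text \<open>A nonzero fixed point \<open>s\<close> of \<open>\<gamma> w^K\<close>; in the coordinate
  z with w = s z the map becomes the pure power \<open>z powi K\<close>. The exponent
  \<open>K - 1\<close> is nonzero since \<open>K\<close> has modulus at least 2.\<close>

lemma fixed_scale: "\<exists>s. s \<noteq> 0 \<and> \<gamma> * s powi K = s"
proof -
  have "\<exists>s. s \<noteq> 0 \<and> s powi (K - 1) = 1 / \<gamma>"
  proof (cases "K \<ge> 1")
    case True
    define n where "n = nat (K - 1)"
    have n: "K - 1 = int n" "n \<noteq> 0" using True K_facts by (auto simp: n_def)
    obtain s where "s \<noteq> 0" "1 / \<gamma> = s ^ n" using exists_complex_root_nonzero[of "1 / \<gamma>" n] \<gamma> n by auto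
    then show ?thesis unfolding n(1) by (intro exI[of _ s]) simp
  next
    case False
    define n where "n = nat (1 - K)"
    have n: "K - 1 = - int n" "n \<noteq> 0" using False by (auto simp: n_def)
    obtain s where "s \<noteq> 0" "\<gamma> = s ^ n" using exists_complex_root_nonzero[of \<gamma> n] \<gamma> n by auto
    then show ?thesis unfolding n(1) by (intro exI[of _ s]) (simp add: power_int_minus inverse_eq_divide)
  qed
  then obtain s where s: "s \<noteq> 0" "s powi (K - 1) = 1 / \<gamma>" by blast
  have "s powi K = s powi (K - 1) * s" using s(1) power_int_add[of s "K - 1" 1] by simp
  then show ?thesis using s \<gamma> by (intro exI[of _ s]) simp
qed

lemma orbit_power:
  assumes s: "s \<noteq> 0" "\<gamma> * s powi K = s" and x: "M x = Some (s * z)" "z \<noteq> 0"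
  shows "M ((f ^^ j) x) = Some (s * z powi (K ^ j))"
proof (induction j)
  case 0
  then show ?case using x by simp
next
  case (Suc j)
  have "s * z powi (K ^ j) \<noteq> 0" using s x by (simp add: power_int_eq_0_iff)
  then have "(f ^^ j) x \<notin> P" using Suc M_not_P by blast
  then have "M (f ((f ^^ j) x)) = Some (\<gamma> * (s * z powi (K ^ j)) powi K)" using conj_power Suc by simp
  also have "\<gamma> * (s * z powi (K ^ j)) powi K = \<gamma> * s powi K * z powi (K ^ j * K)"
    by (simp only: power_int_mult_distrib power_int_mult mult.assoc)
  also have "\<dots> = s * z powi (K ^ Suc j)" unfolding s(2) by (simp add: mult.commute)
  finally show ?case by simp
qed

lemma cis_root_powi: "n > 0 \<Longrightarrow> cis (2 * pi / real n) powi k = 1 \<longleftrightarrow> int n dvd k"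
proof -
  assume n: "n > 0"
  have "cis (2 * pi / real n) powi k = cis (of_int k * (2 * pi / real n))" by (rule cis_power_int)
  also have "\<dots> = 1 \<longleftrightarrow> (\<exists>j. of_int k * (2 * pi / real n) = of_int j * (2 * pi))" by (rule cis_eq_1_iff)
  also have "\<dots> \<longleftrightarrow> (\<exists>j. real_of_int k = real_of_int (j * int n))"
    using n by (simp add: field_simps)
  also have "\<dots> \<longleftrightarrow> (\<exists>j. k = j * int n)" by (simp only: of_int_eq_iff)
  also have "\<dots> \<longleftrightarrow> int n dvd k" by (auto simp: dvd_def mult.commute)
  finally show ?thesis .
qed

text \<open>In the coordinate of \<open>fixed_scale\<close>, a primitive root of unity of order n
  returns after j steps exactly when n divides \<open>K ^ j - 1\<close>. For even \<open>N\<close>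
  the number \<open>K ^ N\<close> is \<open>D ^ N\<close> also for negative \<open>K\<close>, which
  suggests n = \<open>D ^ N - 1\<close>.\<close>

lemma cycle_of_period:
  assumes N: "even N" "N \<ge> 4"
  shows "\<exists>C. is_cycle f N C \<and> \<not> C \<subseteq> P \<and> is_multiplier f N C (of_int K ^ N)"
proof -
  obtain s where s: "s \<noteq> 0" "\<gamma> * s powi K = s" using fixed_scale by blast
  define n where "n = D ^ N - 1"
  have DN: "D ^ N \<ge> 2 ^ N" using D2 by (intro power_mono) auto
  have "(2::nat) ^ 4 \<le> 2 ^ N" using N by (intro power_increasing) auto
  then have n0: "n > 0" and n_int: "int n = int D ^ N - 1" using DN by (auto simp: n_def of_nat_diff)
  define z where "z = cis (2 * pi / real n)"
  have z0: "z \<noteq> 0" by (simp add: z_def)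
  obtain x where x: "M x = Some (s * z)" using mob_surj[OF uv(1)] by blast
  have xP: "x \<notin> P" using M_not_P[OF x] s z0 by simp
  have orb: "M ((f ^^ j) x) = Some (s * z powi (K ^ j))" for j by (rule orbit_power[OF s x z0])
  have per: "(f ^^ j) x = x \<longleftrightarrow> int n dvd K ^ j - 1" for j
  proof -
    have "(f ^^ j) x = x \<longleftrightarrow> M ((f ^^ j) x) = M x" using mob_inj[OF uv(1)] by metis
    also have "\<dots> \<longleftrightarrow> z powi (K ^ j) = z" using orb x s by simp
    also have "\<dots> \<longleftrightarrow> z powi (K ^ j - 1) = 1" using z0 by (simp add: power_int_diff)
    finally show ?thesis unfolding z_def cis_root_powi[OF n0] .
  qed
  have KN: "K ^ N = int D ^ N" using K N(1) by (metis power_even_abs)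
  have "(f ^^ N) x = x" unfolding per KN n_int by simp
  moreover have "(f ^^ j) x \<noteq> x" if j: "0 < j" "j < N" for j
  proof
    assume "(f ^^ j) x = x"
    then have dv: "int n dvd K ^ j - 1" using per by blast
    have Kj: "\<bar>K ^ j\<bar> = int D ^ j" using K by (simp add: power_abs)
    have Dj: "int D ^ 1 \<le> int D ^ j" using j D2 by (intro power_increasing) auto
    then have "2 \<le> \<bar>K ^ j\<bar>" using D2 unfolding Kj power_one_right by linarith
    then have "K ^ j - 1 \<noteq> 0" by linarith
    then have "int n \<le> \<bar>K ^ j - 1\<bar>" using dvd_imp_le_int[OF _ dv] by simp
    also have "\<dots> \<le> int D ^ j + 1" using Kj by linarith
    also have "int D ^ j \<le> int D ^ (N - 1)" using j D2 by (intro power_increasing) auto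
    \<comment> \<open>An earlier return would give n at most \<open>D ^ (N - 1) + 1\<close>. But
      \<open>D ^ N\<close> is at least twice \<open>D ^ (N - 1)\<close>, which is at least 8 because
      \<open>N\<close> is at least 4.\<close>
    finally have le: "int D ^ N \<le> int D ^ (N - 1) + 2" using n_int by linarith
    have "int D ^ N = int D * int D ^ (N - 1)" using N(2) by (metis Suc_pred' power_Suc less_le_trans zero_less_numeral)
    moreover have "2 * int D ^ (N - 1) \<le> int D * int D ^ (N - 1)" using D2 by (intro mult_right_mono) auto
    moreover have "(2::int) ^ 3 \<le> 2 ^ (N - 1)" using N(2) by (intro power_increasing) auto
    moreover have "(2::int) ^ (N - 1) \<le> int D ^ (N - 1)" using D2 by (intro power_mono) auto
    ultimately show False using le by simp
  qed
  ultimately have "is_cycle f N ((\<lambda>i. (f ^^ i) x) ` {..<N})" unfolding is_cycle_def using N(2)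
    by (intro conjI exI[of _ x]) auto
  moreover have "\<not> (\<lambda>i. (f ^^ i) x) ` {..<N} \<subseteq> P"
  proof
    assume sub: "(\<lambda>i. (f ^^ i) x) ` {..<N} \<subseteq> P"
    have "(f ^^ 0) x \<in> (\<lambda>i. (f ^^ i) x) ` {..<N}" using N(2) by (intro imageI) auto
    then show False using xP sub by auto
  qed
  moreover have "is_multiplier f N ((\<lambda>i. (f ^^ i) x) ` {..<N}) (of_int K ^ N)"
    unfolding is_multiplier_def
  proof
    fix y assume "y \<in> (\<lambda>i. (f ^^ i) x) ` {..<N}"
    then obtain i where y: "y = (f ^^ i) x" by blast
    have "(f ^^ N) y = (f ^^ i) ((f ^^ N) x)" unfolding y by (metis add.commute comp_apply funpow_add)
    then have "(f ^^ N) y = y" using \<open>(f ^^ N) x = x\<close> y by simp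
    moreover have "y \<notin> P" using y orbit_euler[OF xP] by blast
    ultimately show "sphere_deriv (f ^^ N) y = of_int K ^ N" by (rule periodic_multiplier[rotated])
  qed
  ultimately show ?thesis by blast
qed

lemma cycles_disjoint:
  assumes "is_cycle f m C" "is_cycle f n C'" "m < n"
  shows "C \<inter> C' = {}"
proof (rule ccontr)
  assume "C \<inter> C' \<noteq> {}"
  then obtain y where y: "y \<in> C" "y \<in> C'" by blast
  obtain a where a: "m \<ge> 1" "(f ^^ m) a = a" "C = (\<lambda>i. (f ^^ i) a) ` {..<m}"
    using assms(1) unfolding is_cycle_def by blast
  obtain b where b: "(f ^^ n) b = b" "\<And>i. 0 < i \<Longrightarrow> i < n \<Longrightarrow> (f ^^ i) b \<noteq> b" "C' = (\<lambda>i. (f ^^ i) b) ` {..<n}"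
    using assms(2) unfolding is_cycle_def by blast
  obtain i j where ij: "y = (f ^^ i) a" "y = (f ^^ j) b" "j < n" using y a(3) b(3) by blast
  have "(f ^^ m) y = (f ^^ i) ((f ^^ m) a)" unfolding ij(1) by (metis add.commute comp_apply funpow_add)
  then have my: "(f ^^ m) y = y" using a(2) ij(1) by simp
  have yb: "(f ^^ (n - j)) y = b" unfolding ij(2) using b(1) ij(3)
    by (metis comp_apply funpow_add le_add_diff_inverse2 less_imp_le)
  have "(f ^^ m) b = (f ^^ (n - j)) ((f ^^ m) y)" unfolding yb[symmetric] by (metis add.commute comp_apply funpow_add)
  then have "(f ^^ m) b = b" using my yb by simp
  then show False using b(2)[of m] a(1) assms(3) by simp
qed

text \<open>Every multiplier is \<open>K\<close> to the period, so the given cycle yields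
  \<open>K ^ m = 1 / c ^ m\<close>, and this equation persists for all multiples of
  \<open>m\<close>. The periods \<open>4 * m\<close> and \<open>8 * m\<close> are even and at least
  4, and being different they make the cycles disjoint.\<close>

lemma two_cycles:
  assumes "is_cycle f m C" "\<not> C \<subseteq> P" "is_multiplier f m C (1 / c ^ m)"
  shows "two_cycles c"
proof -
  obtain x where x: "m \<ge> 1" "(f ^^ m) x = x" "C = (\<lambda>i. (f ^^ i) x) ` {..<m}"
    using assms(1) unfolding is_cycle_def by blast
  have "(f ^^ 0) x \<in> C" unfolding x(3) using x(1) by (intro imageI) auto
  then have xC: "x \<in> C" by simp
  then have "x \<notin> P" using cycle_disjoint_P[OF assms(1,2)] by blast
  then have Km: "of_int K ^ m = 1 / c ^ m" using periodic_multiplier[OF _ x(2)] assms(3) xC unfolding is_multiplier_def by metis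
  have Kk: "of_int K ^ (m * k) = 1 / c ^ (m * k)" for k
    by (simp only: power_mult Km power_one_over)
  obtain C1 where C1: "is_cycle f (m * 4) C1" "\<not> C1 \<subseteq> P" "is_multiplier f (m * 4) C1 (of_int K ^ (m * 4))"
    using cycle_of_period[of "m * 4"] x(1) by auto
  obtain C2 where C2: "is_cycle f (m * 8) C2" "\<not> C2 \<subseteq> P" "is_multiplier f (m * 8) C2 (of_int K ^ (m * 8))"
    using cycle_of_period[of "m * 8"] x(1) by auto
  have "C1 \<inter> C2 = {}" by (rule cycles_disjoint[OF C1(1) C2(1)]) (use x(1) in simp)
  then show ?thesis using C1 C2 unfolding Kk two_cycles_def by blast
qed

lemma periodic_multiplier_norm:
  assumes "x \<notin> P" "(f ^^ m) x = x" "m \<ge> 1"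
  shows "norm (sphere_deriv (f ^^ m) x) > 1"
proof -
  have "norm (sphere_deriv (f ^^ m) x) = real_of_int \<bar>K\<bar> ^ m"
    unfolding periodic_multiplier[OF assms(1,2)] by (simp add: norm_power)
  also have "\<dots> > 1" using K_facts assms(3) by (intro one_less_power) auto
  finally show ?thesis .
qed

end

section \<open>Lower bounds for multipliers off the postcritical set\<close>

section \<open>Bounded families of inverse branches\<close>

text \<open>Schottky's theorem after an affine change that sends the omitted values to 0 and 1 and
  the disc of radius \<open>r/2\<close> to the unit disc; radius \<open>r/4\<close> becomes 1/2. The
  bound depends on \<open>g\<close> only through the value \<open>w\<close> at the centre.\<close>

lemma omit_two_values_bound:
  fixes a b w z0 :: complex
  assumes ab: "a \<noteq> b" and r: "r > 0"
  obtains C where "\<And>g y. g holomorphic_on ball z0 r \<Longrightarrow> (\<And>y. y \<in> ball z0 r \<Longrightarrow> g y \<noteq> a \<and> g y \<noteq> b) \<Longrightarrow>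
      g z0 = w \<Longrightarrow> y \<in> cball z0 (r/4) \<Longrightarrow> norm (g y) \<le> C"
proof -
  define R where "R = norm ((w - a) / (b - a))"
  define C where "C = norm a + norm (b - a) * exp (pi * exp (pi * (2 + 2 * R + 12 * (1/2) / (1 - 1/2))))"
  show ?thesis
  proof (rule that[of C])
    fix g y assume g: "g holomorphic_on ball z0 r" and om: "\<And>y. y \<in> ball z0 r \<Longrightarrow> g y \<noteq> a \<and> g y \<noteq> b"
      and gz: "g z0 = w" and y: "y \<in> cball z0 (r/4)"
    define H where "H = (\<lambda>u. (g (z0 + of_real (r/2) * u) - a) / (b - a))"
    have sub: "z0 + of_real (r/2) * u \<in> ball z0 r" if "u \<in> cball 0 1" for u
    proof -
      have "norm (of_real (r/2) * u) \<le> (r/2) * 1"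
        unfolding norm_mult using that r by (intro mult_mono) auto
      then have "norm (of_real (r/2) * u) < r" using r by linarith
      then show ?thesis by (simp add: dist_norm norm_minus_commute)
    qed
    have "(\<lambda>u. g (z0 + of_real (r/2) * u)) holomorphic_on cball 0 1"
    proof -
      have "g \<circ> (\<lambda>u. z0 + of_real (r/2) * u) holomorphic_on cball 0 1"
        by (rule holomorphic_on_compose_gen[OF _ g]) (use sub in \<open>auto intro!: holomorphic_intros\<close>)
      then show ?thesis by (simp add: o_def)
    qed
    then have holH: "H holomorphic_on cball 0 1" unfolding H_def using ab by (intro holomorphic_intros) auto
    have H01: "\<not> (H u = 0 \<or> H u = 1)" if "u \<in> cball 0 1" for u
      using om[OF sub[OF that]] ab by (auto simp: H_def)
    have H0: "norm (H 0) \<le> R" using gz by (simp add: H_def R_def)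
    define u where "u = (y - z0) / of_real (r/2)"
    have "norm (y - z0) \<le> r/4" using y by (simp add: dist_norm norm_minus_commute)
    moreover have "norm u = norm (y - z0) / (r/2)" unfolding u_def norm_divide norm_of_real using r by simp
    ultimately have u: "norm u \<le> 1/2" using r by (simp add: divide_le_eq)
    have yu: "z0 + of_real (r/2) * u = y" using r by (simp add: u_def)
    have "norm (H u) \<le> exp (pi * exp (pi * (2 + 2 * R + 12 * (1/2) / (1 - 1/2))))"
      by (rule Schottky[OF holH H0 H01 _ _ u]) auto
    moreover have "g y = a + (b - a) * H u" unfolding H_def yu using ab by simp
    then have "norm (g y) \<le> norm a + norm (b - a) * norm (H u)" by (metis norm_mult norm_triangle_ineq)
    ultimately show "norm (g y) \<le> C" unfolding C_def
      by (smt (verit) mult_left_mono norm_ge_zero)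
  qed
qed

text \<open>The quotient extends over \<open>z0\<close> because it has a limit there; Cauchy's
  estimate on the circle of radius \<open>\<rho>\<close> then bounds its value
  \<open>L\<close>.\<close>

lemma leading_coeff_bound:
  fixes h :: "complex \<Rightarrow> complex"
  assumes h: "h holomorphic_on ball z0 r" and rho: "0 < \<rho>" "\<rho> < r"
    and bd: "\<And>y. y \<in> cball z0 \<rho> \<Longrightarrow> norm (h y) \<le> B"
    and lim: "((\<lambda>y. h y / (y - z0) ^ k) \<longlongrightarrow> L) (at z0)"
  shows "norm L \<le> B / \<rho> ^ k"
proof -
  let ?q = "\<lambda>y. h y / (y - z0) ^ k"
  have hq: "?q holomorphic_on (ball z0 r - {z0})"
    using h by (intro holomorphic_intros) (auto intro: holomorphic_on_subset)
  have int: "z0 \<in> interior (ball z0 r)" using rho by simp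
  have "((\<lambda>y. (y - z0) * ?q y) \<longlongrightarrow> 0 * L) (at z0)"
    by (intro tendsto_mult lim tendsto_diff_at)
  then obtain q where q: "q holomorphic_on ball z0 r" "\<And>y. y \<in> ball z0 r - {z0} \<Longrightarrow> q y = ?q y"
    using holomorphic_on_extend_lim[OF hq int] by auto
  have ev: "\<forall>\<^sub>F y in at z0. y \<in> ball z0 r - {z0}"
    using rho by (intro eventually_at_in_open) auto
  have "isCont q z0" using q(1) rho holomorphic_on_imp_continuous_on continuous_on_eq_continuous_at[OF open_ball, of z0 r q] by auto
  then have "(q \<longlongrightarrow> q z0) (at z0)" by (simp add: isCont_def)
  moreover have "(q \<longlongrightarrow> L) (at z0)"
    by (rule Lim_transform_eventually[OF lim]) (use ev q(2) in \<open>auto elim!: eventually_mono\<close>)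
  ultimately have qL: "q z0 = L" using LIM_unique by blast
  have "norm ((deriv ^^ 0) q z0) \<le> fact 0 * (B / \<rho> ^ k) / \<rho> ^ 0"
  proof (rule Cauchy_inequality[OF _ _ rho(1)])
    show "q holomorphic_on ball z0 \<rho>" using q(1) by (rule holomorphic_on_subset) (use rho in auto)
    show "continuous_on (cball z0 \<rho>) q"
      using holomorphic_on_imp_continuous_on[OF q(1)] by (rule continuous_on_subset) (use rho in auto)
    fix y assume y: "norm (z0 - y) = \<rho>"
    then have "y \<in> ball z0 r - {z0}" "y \<in> cball z0 \<rho>" using rho by (auto simp: dist_norm)
    then have "norm (q y) = norm (h y) / \<rho> ^ k" using q(2) y by (simp add: norm_divide norm_power norm_minus_commute)
    also have "\<dots> \<le> B / \<rho> ^ k" using bd[OF \<open>y \<in> cball z0 \<rho>\<close>] rho by (intro divide_right_mono) auto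
    finally show "norm (q y) \<le> B / \<rho> ^ k" .
  qed
  then show ?thesis by (simp add: qL)
qed

lemma analytic_locally_injective:
  fixes \<psi> :: "complex \<Rightarrow> complex"
  assumes "\<psi> analytic_on {z0}" "deriv \<psi> z0 \<noteq> 0"
  obtains d where "d > 0" "inj_on \<psi> (ball z0 d)"
proof -
  obtain e where e: "e > 0" "\<psi> holomorphic_on ball z0 e" using assms(1) by (auto simp: analytic_on_def)
  then show ?thesis
    using has_complex_derivative_locally_injective[OF e(2) _ open_ball assms(2)] that by auto
qed

text \<open>The inverse branches \<open>g n\<close> of the iterates of \<open>\<psi>\<close> fix \<open>z0\<close> and are uniformly bounded, so their
  Taylor coefficients at \<open>z0\<close> are bounded as well. If \<open>\<psi>\<close> is tangent to the identity, the first
  nontrivial coefficient of \<open>g n\<close> grows linearly in \<open>n\<close>.\<close>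

lemma bounded_inverse_branches:
  fixes g :: "nat \<Rightarrow> complex \<Rightarrow> complex"
  assumes r: "r > 0" and hol: "\<And>n. g n holomorphic_on ball z0 r" and gz0: "\<And>n. g n z0 = z0"
    and bd: "\<And>n y. y \<in> cball z0 (r/4) \<Longrightarrow> norm (g n y) \<le> C"
    and g0: "\<And>y. g 0 y = y" and inv: "\<And>n y. y \<in> ball z0 r \<Longrightarrow> \<psi> (g (Suc n) y) = g n y"
    and \<psi>: "\<psi> analytic_on {z0}"
  shows "norm (deriv \<psi> z0) \<ge> 1" and "deriv \<psi> z0 = 1 \<Longrightarrow> \<forall>\<^sub>F y in nhds z0. \<psi> y = y"
proof -
  define \<mu> where "\<mu> = deriv \<psi> z0"
  have z0r: "z0 \<in> ball z0 r" using r by simp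
  have dpsi: "(\<psi> has_field_derivative \<mu>) (at z0)"
    using \<psi> by (simp add: \<mu>_def DERIV_deriv_iff_field_differentiable analytic_on_imp_differentiable_at)
  have dg: "(g n has_field_derivative deriv (g n) z0) (at z0)" for n
    using holomorphic_derivI[OF hol open_ball z0r] .
  have nball: "\<forall>\<^sub>F y in nhds z0. y \<in> ball z0 r" using r by (intro eventually_nhds_in_open) auto
  have step: "\<mu> * deriv (g (Suc n)) z0 = deriv (g n) z0" for n
  proof -
    have "((\<lambda>y. \<psi> (g (Suc n) y)) has_field_derivative \<mu> * deriv (g (Suc n)) z0) (at z0)"
      by (rule DERIV_chain2[OF _ dg]) (simp add: gz0 dpsi)
    moreover have "\<forall>\<^sub>F y in nhds z0. \<psi> (g (Suc n) y) = g n y"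
      using nball by eventually_elim (rule inv)
    ultimately have "(g n has_field_derivative \<mu> * deriv (g (Suc n)) z0) (at z0)" by (rule DERIV_transfer)
    then show ?thesis using dg DERIV_unique by blast
  qed
  have pow: "\<mu> ^ n * deriv (g n) z0 = 1" for n
  proof (induction n)
    case 0
    have "g 0 = (\<lambda>y. y)" using g0 by auto
    then show ?case by simp
  next
    case (Suc n)
    have "\<mu> ^ Suc n * deriv (g (Suc n)) z0 = \<mu> ^ n * (\<mu> * deriv (g (Suc n)) z0)" by simp
    also have "\<dots> = 1" unfolding step by (rule Suc)
    finally show ?case .
  qed
  have \<mu>0: "\<mu> \<noteq> 0" using pow[of 1] by auto
  define B where "B = C + norm z0 + r"
  have g_bd: "norm (g n y - y) \<le> B" if "y \<in> cball z0 (r/4)" for n y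
  proof -
    have "norm y \<le> norm z0 + r" using that r norm_triangle_sub[of y z0] by (simp add: dist_norm norm_minus_commute)
    then show ?thesis using bd[OF that, of n] norm_triangle_ineq4[of "g n y" y] by (simp add: B_def)
  qed
  have lin: "((\<lambda>y. (g n y - z0) / (y - z0)) \<longlongrightarrow> deriv (g n) z0) (at z0)" for n
    using dg[of n] by (simp add: has_field_derivative_iff gz0)
  show "norm (deriv \<psi> z0) \<ge> 1"
  proof (rule ccontr)
    assume "\<not> ?thesis"
    then have lt: "norm \<mu> < 1" by (simp add: \<mu>_def)
    \<comment> \<open>Cauchy bound for the derivative of \<open>g n\<close> at \<open>z0\<close>,
      uniform in \<open>n\<close>. It is incompatible with \<open>pow\<close> when
      \<open>\<mu>\<close> has modulus below 1, as these derivatives are the powers of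
      \<open>1 / \<mu>\<close>.\<close>
    define c where "c = (B + r) * 4 / r"
    have "norm (deriv (g n) z0) \<le> c" for n
    proof -
      have "((\<lambda>y. (g n y - z0) / (y - z0) ^ 1) \<longlongrightarrow> deriv (g n) z0) (at z0)" using lin by simp
      moreover have "norm (g n y - z0) \<le> B + r" if "y \<in> cball z0 (r/4)" for y
      proof -
        have "g n y - z0 = (g n y - y) + (y - z0)" by simp
        then have "norm (g n y - z0) \<le> norm (g n y - y) + norm (y - z0)" using norm_triangle_ineq by metis
        moreover have "norm (y - z0) \<le> r" using that r by (simp add: dist_norm norm_minus_commute)
        ultimately show ?thesis using g_bd[OF that, of n] by simp
      qed
      ultimately have "norm (deriv (g n) z0) \<le> (B + r) / (r/4) ^ 1"
        using r by (intro leading_coeff_bound[of "\<lambda>y. g n y - z0" z0 r]) (auto intro!: holomorphic_intros hol)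
      then show ?thesis by (simp add: c_def)
    qed
    then have "1 \<le> norm \<mu> ^ n * c" for n
    proof -
      assume a: "\<And>n. norm (deriv (g n) z0) \<le> c"
      have "1 = norm \<mu> ^ n * norm (deriv (g n) z0)" using pow[of n] by (metis norm_mult norm_one norm_power)
      also have "\<dots> \<le> norm \<mu> ^ n * c" using a by (intro mult_left_mono) auto
      finally show ?thesis .
    qed
    moreover have "(\<lambda>n. norm \<mu> ^ n * c) \<longlonglongrightarrow> 0 * c"
      using lt by (intro tendsto_mult tendsto_const LIMSEQ_power_zero) auto
    ultimately have "1 \<le> 0 * c" by (intro LIMSEQ_le_const) auto
    then show False by simp
  qed
  assume "deriv \<psi> z0 = 1"
  then have \<mu>1: "\<mu> = 1" by (simp add: \<mu>_def)
  have d1: "deriv (g n) z0 = 1" for n using pow[of n] \<mu>1 by simp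
  obtain d where d: "d > 0" "inj_on \<psi> (ball z0 d)" using analytic_locally_injective[OF \<psi>] \<mu>0 by (auto simp: \<mu>_def)
  have tend: "(g n \<longlongrightarrow> z0) (nhds z0)" for n
    using isCont_tendsto_nhds[OF DERIV_isCont[OF dg[of n]]] by (simp add: gz0)
  define \<gamma> where "\<gamma> = g 1"
  \<comment> \<open>Both sides are preimages of \<open>g n y\<close> under \<open>\<psi>\<close>
    near \<open>z0\<close>, where \<open>\<psi>\<close> is injective. So near \<open>z0\<close> the
    branches are the iterates of the single germ \<open>\<gamma>\<close>.\<close>
  have comp: "\<forall>\<^sub>F y in nhds z0. g (Suc n) y = \<gamma> (g n y)" for n
  proof -
    have e1: "\<forall>\<^sub>F y in nhds z0. g n y \<in> ball z0 r" using tend r by (intro topological_tendstoD) auto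
    have e2: "\<forall>\<^sub>F y in nhds z0. g (Suc n) y \<in> ball z0 d" using tend d by (intro topological_tendstoD) auto
    have "((\<lambda>y. g 1 (g n y)) \<longlongrightarrow> z0) (nhds z0)" using filterlim_compose[OF tend tend] .
    then have e3: "\<forall>\<^sub>F y in nhds z0. \<gamma> (g n y) \<in> ball z0 d" unfolding \<gamma>_def using d by (intro topological_tendstoD) auto
    show ?thesis using nball e1 e2 e3
    proof eventually_elim
      case (elim y)
      have "\<psi> (\<gamma> (g n y)) = g n y" using inv[OF elim(2), of 0] g0 by (simp add: \<gamma>_def)
      moreover have "\<psi> (g (Suc n) y) = g n y" by (rule inv[OF elim(1)])
      ultimately show ?case using inj_onD[OF d(2), of "g (Suc n) y" "\<gamma> (g n y)"] elim by simp
    qed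
  qed
  have "\<forall>y\<in>ball z0 r. \<gamma> y = y"
  proof (rule ccontr)
    assume "\<not> ?thesis"
    then have nz: "\<exists>y\<in>ball z0 r. \<gamma> y - y \<noteq> 0" by auto
    have hole: "(\<lambda>y. \<gamma> y - y) holomorphic_on ball z0 r" unfolding \<gamma>_def by (intro holomorphic_intros hol)
    define A where "A = zor_poly (\<lambda>y. \<gamma> y - y) z0"
    define k where "k = nat (zorder (\<lambda>y. \<gamma> y - y) z0)"
    obtain s where s: "s > 0" "A holomorphic_on cball z0 s" "\<And>y. y \<in> cball z0 s \<Longrightarrow> \<gamma> y - y = A y * (y - z0) ^ k \<and> A y \<noteq> 0"
      using zorder_exist_zero[OF hole open_ball connected_ball z0r nz] unfolding A_def k_def by blast
    define \<alpha> where "\<alpha> = A z0"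
    have \<alpha>0: "\<alpha> \<noteq> 0" using s unfolding \<alpha>_def by auto
    have limA: "((\<lambda>y. (\<gamma> y - y) / (y - z0) ^ k) \<longlongrightarrow> \<alpha>) (at z0)"
    proof (rule Lim_transform_eventually)
      have "A holomorphic_on ball z0 s" using s(2) by (rule holomorphic_on_subset) auto
      then have "isCont A z0" using s(1) holomorphic_on_imp_continuous_on continuous_on_eq_continuous_at[OF open_ball, of z0 s A] by auto
      then show "(A \<longlongrightarrow> \<alpha>) (at z0)" by (simp add: isCont_def \<alpha>_def)
      have "\<forall>\<^sub>F y in at z0. y \<in> ball z0 s - {z0}" using s(1) by (intro eventually_at_in_open) auto
      then show "\<forall>\<^sub>F y in at z0. A y = (\<gamma> y - y) / (y - z0) ^ k"
        by eventually_elim (use s(3) in auto)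
    qed
    have gat: "filterlim (g n) (at z0) (at z0)" for n
    proof (rule filterlim_atI)
      show "(g n \<longlongrightarrow> z0) (at z0)" using tend tendsto_mono[OF at_within_le_nhds] by blast
      have "((\<lambda>y. (g n y - z0) / (y - z0)) \<longlongrightarrow> 1) (at z0)" using lin[of n] unfolding d1 .
      from tendsto_imp_eventually_ne[OF this, of 0]
      have "\<forall>\<^sub>F y in at z0. (g n y - z0) / (y - z0) \<noteq> 0" by simp
      then show "\<forall>\<^sub>F y in at z0. g n y \<noteq> z0" by eventually_elim auto
    qed
    \<comment> \<open>Each iteration adds \<open>\<alpha>\<close> to the coefficient of order
      \<open>k\<close>: every \<open>g n\<close> is tangent to the identity, so composing with it
      does not change the leading term of \<open>\<gamma> y - y\<close>.\<close>
    have lim: "((\<lambda>y. (g n y - y) / (y - z0) ^ k) \<longlongrightarrow> of_nat n * \<alpha>) (at z0)" for n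
    proof (induction n)
      case 0
      then show ?case by (simp add: g0)
    next
      case (Suc n)
      have L1: "((\<lambda>y. (g n y - y) / (y - z0) ^ k + (\<gamma> (g n y) - g n y) / (g n y - z0) ^ k * ((g n y - z0) / (y - z0)) ^ k) \<longlongrightarrow>
         of_nat n * \<alpha> + \<alpha> * 1 ^ k) (at z0)"
        using lin[of n] unfolding d1 by (intro tendsto_intros Suc filterlim_compose[OF limA gat])
      have E1: "\<forall>\<^sub>F y in at z0. g n y \<noteq> z0" using gat[of n] by (simp add: filterlim_at)
      have E2: "\<forall>\<^sub>F y in at z0. g (Suc n) y = \<gamma> (g n y)"
        using comp[of n] unfolding eventually_at_filter by eventually_elim simp
      have E3: "\<forall>\<^sub>F y in at z0. y \<noteq> z0" by (simp add: eventually_at_filter)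
      have "\<forall>\<^sub>F y in at z0. (g n y - y) / (y - z0) ^ k + (\<gamma> (g n y) - g n y) / (g n y - z0) ^ k * ((g n y - z0) / (y - z0)) ^ k
        = (g (Suc n) y - y) / (y - z0) ^ k"
        using E1 E2 E3
      proof eventually_elim
        case (elim y)
        have "(\<gamma> (g n y) - g n y) / (g n y - z0) ^ k * ((g n y - z0) / (y - z0)) ^ k = (\<gamma> (g n y) - g n y) / (y - z0) ^ k"
          using elim by (simp add: power_divide)
        then show ?case using elim(2) by (simp add: diff_divide_distrib)
      qed
      from Lim_transform_eventually[OF L1 this] show ?case by (simp add: algebra_simps)
    qed
    have bound: "norm (of_nat n * \<alpha>) \<le> B / (r/4) ^ k" for n
      using r by (intro leading_coeff_bound[OF _ _ _ g_bd lim]) (auto intro!: holomorphic_intros hol)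
    obtain n where "real n * norm \<alpha> > B / (r/4) ^ k"
      using ex_less_of_nat_mult[of "norm \<alpha>" "B / (r/4) ^ k"] \<alpha>0 by auto
    then show False using bound[of n] by (simp add: norm_mult)
  qed
  then have idy: "\<And>y. y \<in> ball z0 r \<Longrightarrow> \<gamma> y = y" by blast
  show "\<forall>\<^sub>F y in nhds z0. \<psi> y = y"
    using nball
  proof eventually_elim
    case (elim y)
    then show ?case using inv[OF elim, of 0] idy[OF elim] g0 by (simp add: \<gamma>_def)
  qed
qed

section \<open>Lifting to inverse branches\<close>

text \<open>The properties that survive a change of coordinate on the sphere, collected so that a
  point of \<open>P\<close> may be placed at infinity. \<open>Q\<close> then contributes two finite
  omitted values \<open>a\<close> and \<open>b\<close>; \<open>noninj\<close> is what prevents an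
  iterate from being the identity.\<close>

locale hyperbolic_cover =
  fixes F :: "sphere \<Rightarrow> sphere" and Q :: "sphere set" and a b :: complex
  assumes holo: "sph_holo F" and fin: "\<And>y. finite {x. F x = y}" and surj: "\<And>y. \<exists>x. F x = y"
    and Q: "finite Q" "None \<in> Q" "Some a \<in> Q" "Some b \<in> Q" "a \<noteq> b"
    and fwd: "\<And>x. x \<in> Q \<Longrightarrow> F x \<in> Q" and ncrit: "\<And>x. F x \<notin> Q \<Longrightarrow> sphere_deriv F x \<noteq> 0"
    and noninj: "\<And>S. finite S \<Longrightarrow> \<exists>x y. x \<noteq> y \<and> F x = F y \<and> x \<notin> S \<and> y \<notin> S"
begin

text \<open>\<open>B\<close> is the sphere without \<open>Q\<close>, \<open>E\<close> its preimage,
  and \<open>\<phi>\<close> the unbranched covering of \<open>B\<close> by \<open>E\<close> induced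
  by \<open>F\<close>. All of this takes place in the plane because infinity is in
  \<open>Q\<close>.\<close>

definition B :: "complex set" where "B = {z. Some z \<notin> Q}"
definition E :: "complex set" where "E = {z. F (Some z) \<notin> Q}"
definition \<phi> :: "complex \<Rightarrow> complex" where "\<phi> z = the (F (Some z))"

lemma EB: "E \<subseteq> B" using fwd by (auto simp: E_def B_def)

lemma finite_vimage_F: "finite S \<Longrightarrow> finite {x. F x \<in> S}"
proof -
  assume "finite S"
  have "{x. F x \<in> S} = (\<Union>y\<in>S. {x. F x = y})" by auto
  then show ?thesis using \<open>finite S\<close> fin by simp
qed

lemma finite_Some_set: "finite S \<Longrightarrow> finite {z. Some z \<in> S}"
  using finite_vimageI[of S Some] by (simp add: vimage_def)

lemma openB: "open B"
proof -
  have "B = - {z. Some z \<in> Q}" by (auto simp: B_def)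
  then show ?thesis using finite_imp_closed[OF finite_Some_set[OF Q(1)]] by (simp add: open_Compl)
qed

lemma openE: "open E"
proof -
  have "E = - {z. Some z \<in> {x. F x \<in> Q}}" by (auto simp: E_def)
  then show ?thesis using finite_imp_closed[OF finite_Some_set[OF finite_vimage_F[OF Q(1)]]] by (simp add: open_Compl)
qed

lemma F_E: "z \<in> E \<Longrightarrow> F (Some z) = Some (\<phi> z)"
  using Q(2) by (cases "F (Some z)") (auto simp: E_def \<phi>_def)

lemma \<phi>_B: "z \<in> E \<Longrightarrow> \<phi> z \<in> B"
  using F_E[of z] by (auto simp: E_def B_def)

lemma \<phi>_deriv: "z \<in> E \<Longrightarrow> (\<phi> has_field_derivative sphere_deriv F (Some z)) (at z)"
proof -
  assume z: "z \<in> E"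
  have "(chart_rep F (Some z) has_field_derivative sphere_deriv F (Some z)) (at z)"
    using sph_holo_has_deriv[OF holo, of "Some z"] by simp
  moreover have "\<forall>\<^sub>F t in nhds z. t \<in> E" using openE z by (rule eventually_nhds_in_open)
  then have "\<forall>\<^sub>F t in nhds z. chart_rep F (Some z) t = \<phi> t"
    by eventually_elim (simp add: chart_rep_def F_E z)
  ultimately show ?thesis by (rule DERIV_transfer)
qed

lemma \<phi>_holo: "\<phi> holomorphic_on E"
  using \<phi>_deriv openE by (metis holomorphic_onI field_differentiable_at_within field_differentiable_def)

lemma \<phi>_deriv_nz: "z \<in> E \<Longrightarrow> deriv \<phi> z \<noteq> 0"
  using DERIV_imp_deriv[OF \<phi>_deriv] ncrit by (simp add: E_def)

lemma B_fibre: "y \<in> B \<Longrightarrow> F x = Some y \<Longrightarrow> \<exists>z. x = Some z \<and> z \<in> E \<and> \<phi> z = y"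
  using fwd[of x] Q(2) by (cases x) (auto simp: B_def E_def \<phi>_def)

lemma covering: "covering_space E \<phi> B"
proof
  show "continuous_on E \<phi>" using \<phi>_holo by (rule holomorphic_on_imp_continuous_on)
  show "\<phi> ` E = B"
  proof
    show "\<phi> ` E \<subseteq> B" using \<phi>_B by blast
    show "B \<subseteq> \<phi> ` E"
    proof
      fix y assume y: "y \<in> B"
      obtain x where "F x = Some y" using surj by blast
      then show "y \<in> \<phi> ` E" using B_fibre[OF y] by blast
    qed
  qed
  fix y assume y: "y \<in> B"
  let ?v = "Some y"
  have nc: "sphere_deriv F x \<noteq> 0" if "F x = ?v" for x using ncrit[of x] that y by (simp add: B_def)
  obtain r U s where "even_cover F ?v r U s" using evenly_covered[OF holo fin nc] by blast
  note c = even_coverD[OF this, unfolded chart_simps]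
  \<comment> \<open>Shrinking the disc to \<open>B\<close> excludes values in \<open>Q\<close>, so
    every sheet over it lies in \<open>E\<close>.\<close>
  define T where "T = ball y r \<inter> B"
  have T: "open T" "y \<in> T" "T \<subseteq> ball y r" "T \<subseteq> B" using openB y c(1) by (auto simp: T_def)
  let ?I = "{x. F x = ?v}"
  have xSome: "\<exists>z. x = Some z" if "F x = ?v" for x using B_fibre[OF y that] by blast
  have sE: "s x u \<in> E \<and> \<phi> (s x u) = u" if x: "F x = ?v" and u: "u \<in> T" for x u
  proof -
    obtain z where z: "x = Some z" using xSome[OF x] by blast
    have "F (Some (s x u)) = Some u" using c(10)[OF x, of u] u T z by auto
    then show ?thesis using B_fibre[of u] u T by auto
  qed
  have hs: "s x holomorphic_on T" if "F x = ?v" for x using c(5)[OF that] T holomorphic_on_subset by blast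
  let ?V = "(\<lambda>x. s x ` T) ` ?I"
  have openV: "open (s x ` T)" if x: "F x = ?v" for x
  proof (rule open_mapping_thm3[OF hs[OF x] T(1)])
    show "inj_on (s x) T" by (rule inj_on_inverseI[of _ \<phi>]) (use sE[OF x] in blast)
  qed
  show "\<exists>T. y \<in> T \<and> openin (top_of_set B) T \<and>
      (\<exists>v. \<Union>v = E \<inter> \<phi> -` T \<and> (\<forall>u\<in>v. openin (top_of_set E) u) \<and> pairwise disjnt v \<and> (\<forall>u\<in>v. \<exists>q. homeomorphism u T \<phi> q))"
  proof (intro exI[of _ T] conjI exI[of _ ?V])
    show "openin (top_of_set B) T" using T by (simp add: openin_open_eq openB)
    show "\<Union>?V = E \<inter> \<phi> -` T"
    proof
      show "\<Union>?V \<subseteq> E \<inter> \<phi> -` T" using sE by auto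
      show "E \<inter> \<phi> -` T \<subseteq> \<Union>?V"
      proof
        fix z assume z: "z \<in> E \<inter> \<phi> -` T"
        then have "F (Some z) = Some (\<phi> z)" "\<phi> z \<in> T" using F_E by auto
        then have "Some z \<in> {x. F x = Some (\<phi> z)}" "\<phi> z \<in> ball y r" using T by auto
        then obtain x where x: "F x = ?v" "Some z = chart_inv x (s x (\<phi> z))" using c(11)[of "\<phi> z"] by auto
        then have "z = s x (\<phi> z)" using xSome[OF x(1)] by auto
        then show "z \<in> \<Union>?V" using x(1) \<open>\<phi> z \<in> T\<close> by blast
      qed
    qed
    show "\<forall>u\<in>?V. openin (top_of_set E) u"
    proof
      fix W assume "W \<in> ?V"
      then obtain x where x: "F x = ?v" "W = s x ` T" by blast
      then have "open W" "W \<subseteq> E" using openV sE by auto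
      then show "openin (top_of_set E) W" by (simp add: openin_open_eq openE)
    qed
    show "pairwise disjnt ?V"
    proof (rule pairwiseI)
      fix W W' assume W: "W \<in> ?V" "W' \<in> ?V" "W \<noteq> W'"
      then obtain x x' where x: "F x = ?v" "W = s x ` T" "F x' = ?v" "W' = s x' ` T" by blast
      show "disjnt W W'" unfolding disjnt_iff
      proof (intro allI notI)
        fix z assume "z \<in> W \<and> z \<in> W'"
        then obtain u u' where u: "u \<in> T" "z = s x u" "u' \<in> T" "z = s x' u'" using x by blast
        then have "u = u'" using sE[OF x(1) u(1)] sE[OF x(3) u(3)] by simp
        then have eq: "chart_inv x (s x u) = chart_inv x' (s x' u)" using u xSome[OF x(1)] xSome[OF x(3)] by auto
        have ub: "u \<in> ball y r" using u(1) T(3) by blast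
        have "x = x'" by (rule inj_onD[OF c(12)[OF ub] eq]) (use x(1,3) in simp_all)
        then show False using x W by blast
      qed
    qed
    show "\<forall>u\<in>?V. \<exists>q. homeomorphism u T \<phi> q"
    proof
      fix W assume "W \<in> ?V"
      then obtain x where x: "F x = ?v" "W = s x ` T" by blast
      have WE: "W \<subseteq> E" using sE[OF x(1)] x(2) by blast
      have "homeomorphism W T \<phi> (s x)" unfolding x(2)
      proof (rule homeomorphismI)
        show "continuous_on (s x ` T) \<phi>" using \<phi>_holo WE x(2) holomorphic_on_imp_continuous_on holomorphic_on_subset by blast
        show "continuous_on T (s x)" using hs[OF x(1)] by (rule holomorphic_on_imp_continuous_on)
      qed (use sE[OF x(1)] in auto)
      then show "\<exists>q. homeomorphism W T \<phi> q" by blast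
    qed
  qed (rule T(2))
qed

text \<open>A disc is simply connected, so a continuous lift exists; it is holomorphic because
  locally it is \<open>h\<close> followed by a local inverse of \<open>\<phi>\<close>.\<close>

lemma holomorphic_lift:
  assumes h: "h holomorphic_on ball z0 r" "h ` ball z0 r \<subseteq> B" and r: "r > 0" and w: "w \<in> E" "\<phi> w = h z0"
  shows "\<exists>g. g holomorphic_on ball z0 r \<and> g ` ball z0 r \<subseteq> E \<and> g z0 = w \<and> (\<forall>y\<in>ball z0 r. \<phi> (g y) = h y)"
proof -
  obtain g where g: "continuous_on (ball z0 r) g" "g \<in> ball z0 r \<rightarrow> E" "g z0 = w" "\<And>y. y \<in> ball z0 r \<Longrightarrow> \<phi> (g y) = h y"
  proof (rule covering_space_lift_strong[OF covering w(1), of z0 "ball z0 r" h])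
    show "simply_connected (ball z0 r)" by (simp add: convex_imp_simply_connected)
    show "locally path_connected (ball z0 r)" by (simp add: convex_imp_locally_path_connected)
    show "continuous_on (ball z0 r) h" using h(1) by (rule holomorphic_on_imp_continuous_on)
  qed (use h r w in auto)
  have "g field_differentiable at t" if t: "t \<in> ball z0 r" for t
  proof -
    have wE: "g t \<in> E" using g(2) t by blast
    obtain d where d: "d > 0" "ball (g t) d \<subseteq> E" "inj_on \<phi> (ball (g t) d)"
      using has_complex_derivative_locally_injective[OF \<phi>_holo wE openE \<phi>_deriv_nz[OF wE]] by blast
    have hol: "\<phi> holomorphic_on ball (g t) d" using \<phi>_holo d(2) holomorphic_on_subset by blast
    obtain k where k: "k holomorphic_on \<phi> ` ball (g t) d"
      "\<And>z. z \<in> ball (g t) d \<Longrightarrow> deriv \<phi> z * deriv k (\<phi> z) = 1"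
      "\<And>z. z \<in> ball (g t) d \<Longrightarrow> k (\<phi> z) = z"
      using holomorphic_has_inverse[OF hol open_ball d(3)] by blast
    have op: "open (\<phi> ` ball (g t) d)" by (rule open_mapping_thm3[OF hol open_ball d(3)])
    have ht: "h t \<in> \<phi> ` ball (g t) d" using g(4)[OF t] d(1) by (metis centre_in_ball imageI)
    have "k field_differentiable at (h t)" using k(1) op ht holomorphic_on_imp_differentiable_at by blast
    moreover have "h field_differentiable at t" using h(1) t holomorphic_on_imp_differentiable_at[OF _ open_ball] by blast
    ultimately have "k \<circ> h field_differentiable at t" by (rule field_differentiable_compose[rotated])
    moreover have "\<forall>\<^sub>F y in nhds t. (k \<circ> h) y = g y"
    proof -
      have "isCont g t" using g(1) t continuous_on_eq_continuous_at[OF open_ball] by blast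
      from isCont_tendsto_nhds[OF this] have "\<forall>\<^sub>F y in nhds t. g y \<in> ball (g t) d"
        using d(1) by (intro topological_tendstoD) auto
      moreover have "\<forall>\<^sub>F y in nhds t. y \<in> ball z0 r" using t by (intro eventually_nhds_in_open) auto
      ultimately show ?thesis by eventually_elim (use k(3) g(4) in \<open>metis comp_apply\<close>)
    qed
    ultimately show ?thesis unfolding field_differentiable_def using DERIV_transfer by blast
  qed
  then have "g holomorphic_on ball z0 r" by (auto simp: holomorphic_on_def intro: field_differentiable_at_within)
  then show ?thesis using g by blast
qed

text \<open>Off the finite set \<open>X\<close> of poles the plane is connected, so the identity
  theorem would make the iterate the identity there. But two points off \<open>X\<close> have the
  same image under \<open>F\<close>, hence under the iterate.\<close>

lemma not_id_near:
  assumes "Some z0 \<notin> Q" "(F ^^ m) (Some z0) = Some z0" "m \<ge> 1"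
  shows "\<not> (\<forall>\<^sub>F t in nhds z0. (F ^^ m) (Some t) = Some t)"
proof
  assume ev: "\<forall>\<^sub>F t in nhds z0. (F ^^ m) (Some t) = Some t"
  have hm: "sph_holo (F ^^ m)" by (rule sph_holo_funpow[OF holo])
  have fin_m: "finite {x. (F ^^ n) x \<in> S}" if "finite S" for n S using that
  proof (induction n arbitrary: S)
    case (Suc n)
    have "{x. (F ^^ Suc n) x \<in> S} = {x. (F ^^ n) x \<in> {x. F x \<in> S}}" by auto
    then show ?case using Suc.IH[OF finite_vimage_F[OF Suc.prems]] by simp
  qed simp
  define X where "X = {z. (F ^^ m) (Some z) = None}"
  have "X = {z. Some z \<in> {x. (F ^^ m) x \<in> {None}}}" by (auto simp: X_def)
  then have finX: "finite X" using finite_Some_set fin_m by (metis finite.emptyI finite.insertI)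
  define \<psi> where "\<psi> = (\<lambda>z. the ((F ^^ m) (Some z)) - z)"
  have openX: "open (- X)" using finX by (intro open_Compl finite_imp_closed)
  have hol: "\<psi> holomorphic_on - X"
  proof -
    have "(\<lambda>z. the ((F ^^ m) (Some z))) field_differentiable at z" if z: "z \<in> - X" for z
    proof -
      have "(chart_rep (F ^^ m) (Some z) has_field_derivative sphere_deriv (F ^^ m) (Some z)) (at z)"
        using sph_holo_has_deriv[OF hm, of "Some z"] by simp
      moreover have "\<forall>\<^sub>F t in nhds z. t \<in> - X" using openX z by (rule eventually_nhds_in_open)
      then have "\<forall>\<^sub>F t in nhds z. chart_rep (F ^^ m) (Some z) t = the ((F ^^ m) (Some t))"
        by eventually_elim (use z in \<open>auto simp: chart_rep_def X_def\<close>)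
      ultimately have "((\<lambda>z. the ((F ^^ m) (Some z))) has_field_derivative sphere_deriv (F ^^ m) (Some z)) (at z)"
        by (rule DERIV_transfer)
      then show ?thesis unfolding field_differentiable_def by blast
    qed
    then have "(\<lambda>z. the ((F ^^ m) (Some z))) holomorphic_on - X"
      by (auto simp: holomorphic_on_def intro: field_differentiable_at_within)
    then show ?thesis unfolding \<psi>_def by (intro holomorphic_intros)
  qed
  have conn: "connected (- X)"
    using connected_open_diff_countable[of UNIV X] connected_UNIV finX by (simp add: countable_finite Compl_eq_Diff_UNIV)
  obtain U where U: "open U" "z0 \<in> U" "\<And>t. t \<in> U \<Longrightarrow> (F ^^ m) (Some t) = Some t"
    using ev unfolding eventually_nhds by blast
  have UX: "U \<subseteq> - X" using U(3) by (auto simp: X_def)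
  have "\<psi> z = 0" if z: "z \<in> - X" for z
    by (rule analytic_continuation[OF hol openX conn UX _ _ _ z, of z0])
       (use U UX assms(2) interior_limit_point[of z0 U] in \<open>auto simp: \<psi>_def interior_open\<close>)
  then have \<psi>0: "\<psi> z = 0" if "z \<notin> X" for z using that by simp
  have good: "(F ^^ m) (Some z) = Some z" if "z \<notin> X" for z
  proof -
    obtain u where u: "(F ^^ m) (Some z) = Some u" using \<open>z \<notin> X\<close> by (auto simp: X_def)
    then show ?thesis using \<psi>0[OF \<open>z \<notin> X\<close>] by (simp add: \<psi>_def)
  qed
  obtain x y where xy: "x \<noteq> y" "F x = F y" "x \<notin> insert None (Some ` X)" "y \<notin> insert None (Some ` X)"
  proof -
    have "finite (insert None (Some ` X))" using finX by simp
    from noninj[OF this] show ?thesis using that by blast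
  qed
  have "(F ^^ m) x = (F ^^ m) y" using xy(2) assms(3) by (metis One_nat_def Suc_le_D funpow_Suc_right comp_apply)
  moreover have "(F ^^ m) x = x" "(F ^^ m) y = y" using xy(3,4) good by (cases x; cases y; auto)+
  ultimately show False using xy(1) by simp
qed

text \<open>Lifting the identity of a small disc repeatedly through the \<open>m\<close>-th iterate
  gives inverse branches fixing \<open>z0\<close>. They avoid \<open>a\<close> and \<open>b\<close>,
  hence are uniformly bounded, and \<open>bounded_inverse_branches\<close> applies.\<close>

theorem periodic_multiplier_bound:
  assumes z0: "Some z0 \<notin> Q" and per: "(F ^^ m) (Some z0) = Some z0" and m: "m \<ge> 1"
  shows "norm (sphere_deriv (F ^^ m) (Some z0)) \<ge> 1" "sphere_deriv (F ^^ m) (Some z0) \<noteq> 1"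
proof -
  have Qf: "x \<in> Q \<Longrightarrow> (F ^^ n) x \<in> Q" for n x by (induction n) (auto simp: fwd)
  have orb: "(F ^^ i) (Some z0) \<notin> Q" if "i \<le> m" for i
  proof
    assume "(F ^^ i) (Some z0) \<in> Q"
    then have "(F ^^ (m - i)) ((F ^^ i) (Some z0)) \<in> Q" by (rule Qf)
    also have "(F ^^ (m - i)) ((F ^^ i) (Some z0)) = (F ^^ m) (Some z0)" using that by (metis comp_apply funpow_add le_add_diff_inverse2)
    finally show False using per z0 by simp
  qed
  define w where "w = (\<lambda>i. the ((F ^^ i) (Some z0)))"
  have w: "(F ^^ i) (Some z0) = Some (w i)" if "i \<le> m" for i
    using orb[OF that] Q(2) by (cases "(F ^^ i) (Some z0)") (auto simp: w_def)
  have w0: "w 0 = z0" "w m = z0" using per by (auto simp: w_def)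
  have wE: "w i \<in> E \<and> \<phi> (w i) = w (Suc i)" if "i < m" for i
  proof -
    have "F (Some (w i)) = Some (w (Suc i))" using w[of i] w[of "Suc i"] that by simp
    then show ?thesis using orb[of "Suc i"] w[of "Suc i"] that by (simp add: E_def \<phi>_def)
  qed
  have "z0 \<in> B" using z0 by (simp add: B_def)
  then obtain r where r: "r > 0" "ball z0 r \<subseteq> B" using openB open_contains_ball[of B] by blast
  have lift_m: "\<exists>g. g holomorphic_on ball z0 r \<and> g ` ball z0 r \<subseteq> B \<and> g z0 = z0 \<and> (\<forall>y\<in>ball z0 r. (F ^^ m) (Some (g y)) = Some (h y))"
    if h: "h holomorphic_on ball z0 r" "h ` ball z0 r \<subseteq> B" "h z0 = z0" for h
  proof -
    \<comment> \<open>The cycle is traversed backwards: after \<open>i\<close> lifts the centre sits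
      at \<open>w (m - i)\<close>, so that after \<open>m\<close> lifts it is back at
      \<open>z0\<close>.\<close>
    have "\<exists>g. g holomorphic_on ball z0 r \<and> g ` ball z0 r \<subseteq> B \<and> g z0 = w (m - i) \<and> (\<forall>y\<in>ball z0 r. (F ^^ i) (Some (g y)) = Some (h y))"
      if "i \<le> m" for i using that
    proof (induction i)
      case 0
      then show ?case using h w0 by auto
    next
      case (Suc i)
      then obtain g where g: "g holomorphic_on ball z0 r" "g ` ball z0 r \<subseteq> B" "g z0 = w (m - i)"
        "\<And>y. y \<in> ball z0 r \<Longrightarrow> (F ^^ i) (Some (g y)) = Some (h y)" by auto
      have "w (m - Suc i) \<in> E \<and> \<phi> (w (m - Suc i)) = g z0"
        using wE[of "m - Suc i"] Suc.prems g(3) by (simp add: Suc_diff_Suc)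
      then obtain g' where g': "g' holomorphic_on ball z0 r" "g' ` ball z0 r \<subseteq> E" "g' z0 = w (m - Suc i)"
        "\<And>y. y \<in> ball z0 r \<Longrightarrow> \<phi> (g' y) = g y"
        using holomorphic_lift[OF g(1,2) r(1)] by blast
      have "(F ^^ Suc i) (Some (g' y)) = Some (h y)" if y: "y \<in> ball z0 r" for y
      proof -
        have "(F ^^ Suc i) (Some (g' y)) = (F ^^ i) (F (Some (g' y)))" by (simp add: funpow_swap1)
        also have "g' y \<in> E" using g'(2) y by blast
        then have "F (Some (g' y)) = Some (g y)" using F_E[of "g' y"] g'(4)[OF y] by simp
        finally show ?thesis using g(4)[OF y] by simp
      qed
      then show ?case using g' EB by blast
    qed
    from this[of m] show ?thesis using w0 by simp
  qed
  \<comment> \<open>The values in \<open>B\<close> and the fixed centre allow the next lift; the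
    last clause pins the start of the sequence to the identity.\<close>
  let ?P = "\<lambda>n g. g holomorphic_on ball z0 r \<and> g ` ball z0 r \<subseteq> B \<and> g z0 = z0 \<and> (n = 0 \<longrightarrow> g = (\<lambda>y. y))"
  have "\<exists>g. \<forall>n. ?P n (g n) \<and> (\<forall>y\<in>ball z0 r. (F ^^ m) (Some (g (Suc n) y)) = Some (g n y))"
  proof (rule dependent_nat_choice)
    show "\<exists>g. ?P 0 g" by (intro exI[of _ "\<lambda>y. y"]) (use r in auto)
    show "\<exists>g'. ?P (Suc n) g' \<and> (\<forall>y\<in>ball z0 r. (F ^^ m) (Some (g' y)) = Some (g y))" if "?P n g" for g n
      using lift_m[of g] that by auto
  qed
  then obtain g where G: "\<forall>n. ?P n (g n) \<and> (\<forall>y\<in>ball z0 r. (F ^^ m) (Some (g (Suc n) y)) = Some (g n y))"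
    by (rule exE)
  have g: "g n holomorphic_on ball z0 r" "g n ` ball z0 r \<subseteq> B" "g n z0 = z0" for n
    using spec[OF G, of n] by simp_all
  have g0: "g 0 = (\<lambda>y. y)" using spec[OF G, of 0] by simp
  have gS: "(F ^^ m) (Some (g (Suc n) y)) = Some (g n y)" if "y \<in> ball z0 r" for n y
    using spec[OF G, of n] that by blast
  obtain C where C: "\<And>g y. g holomorphic_on ball z0 r \<Longrightarrow> (\<And>y. y \<in> ball z0 r \<Longrightarrow> g y \<noteq> a \<and> g y \<noteq> b) \<Longrightarrow>
      g z0 = z0 \<Longrightarrow> y \<in> cball z0 (r/4) \<Longrightarrow> norm (g y) \<le> C"
    using omit_two_values_bound[OF Q(5) r(1)] by metis
  have bd: "norm (g n y) \<le> C" if "y \<in> cball z0 (r/4)" for n y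
  proof (rule C[OF g(1) _ g(3) that])
    fix y assume "y \<in> ball z0 r"
    then have "g n y \<in> B" using g(2) by blast
    then show "g n y \<noteq> a \<and> g n y \<noteq> b" using Q by (auto simp: B_def)
  qed
  define \<psi> where "\<psi> = chart_rep (F ^^ m) (Some z0)"
  have inv: "\<psi> (g (Suc n) y) = g n y" if "y \<in> ball z0 r" for n y
    using gS[OF that, of n] per by (simp add: \<psi>_def chart_rep_def)
  have an: "\<psi> analytic_on {z0}" using sph_holoD(2)[OF sph_holo_funpow[OF holo], of m "Some z0"] by (simp add: \<psi>_def)
  have d: "deriv \<psi> z0 = sphere_deriv (F ^^ m) (Some z0)" by (simp add: \<psi>_def sphere_deriv_rep)
  note res = bounded_inverse_branches[where g = g and \<psi> = \<psi>, OF r(1) g(1) g(3) bd _ inv an, unfolded d]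
  show "norm (sphere_deriv (F ^^ m) (Some z0)) \<ge> 1" by (rule res(1)) (simp_all add: g0)
  show "sphere_deriv (F ^^ m) (Some z0) \<noteq> 1"
  proof
    assume "sphere_deriv (F ^^ m) (Some z0) = 1"
    then have "\<forall>\<^sub>F y in nhds z0. \<psi> y = y" by (intro res(2)) (simp_all add: g0)
    moreover have "\<forall>\<^sub>F t in nhds z0. (F ^^ m) (Some t) \<in> chart_dom (Some z0)"
      using eventually_in_chart_dom[OF sph_holoD(1)[OF sph_holo_funpow[OF holo]], of m "Some z0"] per by simp
    ultimately have "\<forall>\<^sub>F t in nhds z0. (F ^^ m) (Some t) = Some t"
    proof eventually_elim
      case (elim t)
      then show ?case using per by (cases "(F ^^ m) (Some t)") (auto simp: \<psi>_def chart_rep_def chart_dom_def)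
    qed
    then show False using not_id_near[OF z0 per m] by blast
  qed
qed

end

section \<open>Cycles outside the postcritical set are not attracting and not parabolic\<close>

text \<open>Either \<open>lpoly v\<close> has a root, or it is constant and its coefficient of
  degree \<open>D\<close> vanishes, which means that infinity lies over \<open>v\<close>.\<close>

lemma (in rational) surj_f: "\<exists>x. f x = v"
proof (cases "degree (lpoly v) = 0")
  case False
  then obtain z where z: "poly (lpoly v) z = 0"
    using fundamental_theorem_of_algebra[of "lpoly v"] by (auto simp: constant_degree)
  have "f (Some z) = v"
    using z f_Some_eq_iff[of z] f_Some_None_iff[of z] by (cases v) auto
  then show ?thesis by blast
next
  case True
  then have c: "coeff (lpoly v) D = 0" using D1 by (simp add: coeff_eq_0)
  have *: "poly (hpoly D None r) (chart None None) = coeff r D" if "degree r \<le> D" for r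
    using that by (simp add: hpoly_def poly_hrev_0)
  have "f None = v"
    unfolding f_homogeneous[of None] *[OF degs(1)] *[OF degs(2)]
    using c hpoly_no_common[of None "chart None None"] unfolding *[OF degs(1)] *[OF degs(2)]
    by (cases v) (auto simp: divide_eq_eq)
  then show ?thesis by blast
qed

lemma (in rational) not_inj_off_finite:
  assumes "D \<ge> 2" "finite S"
  shows "\<exists>x y. x \<noteq> y \<and> f x = f y \<and> x \<notin> S \<and> y \<notin> S"
proof -
  have "finite {y. Some y \<in> f ` S}" using finite_vimageI[of "f ` S" Some] assms(2) by (simp add: vimage_def)
  then have "\<forall>\<^sub>\<infinity>y. Some y \<notin> f ` S" by (simp add: eventually_cofinite)
  with generic_fibre_card have "\<forall>\<^sub>\<infinity>y. card {z. f (Some z) = Some y} = D \<and> Some y \<notin> f ` S"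
    by eventually_elim simp
  then have "finite {y. \<not> (card {z. f (Some z) = Some y} = D \<and> Some y \<notin> f ` S)}"
    by (simp only: eventually_cofinite)
  from ex_new_if_finite[OF infinite_UNIV_char_0 this]
  obtain y where y: "card {z. f (Some z) = Some y} = D" "Some y \<notin> f ` S" by blast
  have "\<not> card {z. f (Some z) = Some y} \<le> 1" using y assms(1) by simp
  then obtain z1 z2 where z: "f (Some z1) = Some y" "f (Some z2) = Some y" "z1 \<noteq> z2"
    by (auto simp: card_le_Suc0_iff_eq[OF finite_Some_fibre])
  have "Some z1 \<notin> S" "Some z2 \<notin> S" using y(2) z(1,2) by (metis imageI)+
  then show ?thesis using z by (intro exI[of _ "Some z1"] exI[of _ "Some z2"]) auto
qed

text \<open>The coordinate change is \<open>1 / (z - c)\<close> with inverse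
  \<open>c + 1 / z\<close>, and the identity if \<open>v\<close> is already infinity.\<close>

lemma move_to_infinity:
  "\<exists>J J'. sph_holo J \<and> sph_holo J' \<and> J \<circ> J' = id \<and> J' \<circ> J = id \<and> J v = None"
proof (cases v)
  case None
  then show ?thesis by (intro exI[of _ id]) (simp add: sph_holo_id)
next
  case (Some c)
  let ?J = "rat_map 1 [:-c, 1:]" and ?J' = "rat_map [:1, c:] [:0, 1:]"
  have J: "rational 1 [:-c, 1:] 1" by unfold_locales auto
  have J': "rational [:1, c:] [:0, 1:] 1"
    by unfold_locales (auto intro!: coprime_polyI simp: max_def)
  have J1: "?J None = Some 0" "?J (Some z) = (if z = c then None else Some (1 / (z - c)))" for z
    by (auto simp: rat_map_def)
  have J2: "?J' None = Some c" "?J' (Some z) = (if z = 0 then None else Some ((1 + z * c) / z))" for z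
    by (auto simp: rat_map_def)
  have "?J (?J' y) = y" for y
  proof (cases y)
    case (Some z)
    have 1: "(1 + z * c) / z = 1 / z + c" if "z \<noteq> 0" using that by (simp add: add_divide_distrib)
    show ?thesis
    proof (cases "z = 0")
      case False
      then show ?thesis unfolding Some J2 if_not_P[OF False] 1[OF False] by (simp add: J1)
    qed (simp add: J1 J2 Some)
  qed (simp add: J1 J2)
  moreover have "?J' (?J y) = y" for y
  proof (cases y)
    case (Some z)
    show ?thesis
    proof (cases "z = c")
      case False
      then have "(1 + 1 / (z - c) * c) / (1 / (z - c)) = (z - c) + c"
        by (simp add: distrib_right)
      also have "\<dots> = z" by simp
      finally have 1: "(1 + 1 / (z - c) * c) / (1 / (z - c)) = z" .
      have 2: "1 / (z - c) \<noteq> 0" using False by simp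
      show ?thesis unfolding Some J1 if_not_P[OF False] J2 if_not_P[OF 2] 1 ..
    qed (simp add: J1 J2 Some)
  qed (simp add: J1 J2)
  ultimately show ?thesis using rational.sph_holo_f[OF J] rational.sph_holo_f[OF J'] Some
    by (intro exI[of _ ?J] exI[of _ ?J'] conjI) (simp_all only: J1 fun_eq_iff comp_apply id_apply if_True refl simp_thms)
qed

text \<open>With three postcritical points, \<open>f\<close> is conjugated by a coordinate change
  moving one of them to infinity; multipliers of cycles are unchanged. With two points there are too
  few omitted values, and the explicit multiplier of the power map is used.\<close>

theorem (in pcf) periodic_multiplier_bound:
  assumes x: "x \<notin> P" and per: "(f ^^ m) x = x" and m: "m \<ge> 1"
  shows "norm (sphere_deriv (f ^^ m) x) \<ge> 1 \<and> sphere_deriv (f ^^ m) x \<noteq> 1"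
proof (cases "card P = 2")
  case True
  then obtain u v \<gamma> K where "two_point_pcf p q D u v \<gamma> K" using card_P_2 by blast
  from two_point_pcf.periodic_multiplier_norm[OF this x per m] show ?thesis by auto
next
  case False
  then have P3: "card P \<ge> 3" using card_P_ge_2 by linarith
  then obtain v where v: "v \<in> P" by (metis card.empty ex_in_conv not_numeral_le_zero)
  obtain J J' where J: "sph_holo J" "sph_holo J'" "J \<circ> J' = id" "J' \<circ> J = id" "J v = None"
    using move_to_infinity[of v] by blast
  have JJ: "J (J' y) = y" "J' (J y) = y" for y using J(3,4) by (metis comp_apply id_apply)+
  have dJ: "sphere_deriv J y \<noteq> 0" for y
  proof -
    have "sphere_deriv J' (J y) * sphere_deriv J y = sphere_deriv (J' \<circ> J) y"
      by (rule sphere_deriv_comp[OF J(1,2), symmetric])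
    then show ?thesis using J(4) by auto
  qed
  have dJ': "sphere_deriv J' y \<noteq> 0" for y
  proof -
    have "sphere_deriv J (J' y) * sphere_deriv J' y = sphere_deriv (J \<circ> J') y"
      by (rule sphere_deriv_comp[OF J(2,1), symmetric])
    then show ?thesis using J(3) by auto
  qed
  define F where "F = J \<circ> (f \<circ> J')"
  define Q where "Q = J ` P"
  have FJ: "F (J y) = J (f y)" for y by (simp add: F_def JJ)
  have FJn: "(F ^^ n) (J y) = J ((f ^^ n) y)" for n y by (induction n) (auto simp: FJ)
  have Fx: "F y = J (f (J' y))" for y by (simp add: F_def)
  have injJ: "inj J" using JJ(2) by (metis injI)
  have QP: "J y \<in> Q \<longleftrightarrow> y \<in> P" for y unfolding Q_def using injJ by (simp add: inj_image_mem_iff)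
  have holoF: "sph_holo F" unfolding F_def by (intro sph_holo_comp J sph_holo_f)
  have NQ: "None \<in> Q" using v J(5) by (auto simp: Q_def intro: rev_image_eqI)
  have "card Q = card P" unfolding Q_def using injJ by (intro card_image) (auto intro: inj_on_subset)
  have finQ: "finite Q" using finite_postcritical by (simp add: Q_def)
  have "card (Q - {None}) \<ge> 2" using \<open>card Q = card P\<close> P3 NQ finQ by simp
  then have "\<not> card (Q - {None}) \<le> 1" by simp
  then obtain y1 y2 where y: "y1 \<in> Q - {None}" "y2 \<in> Q - {None}" "y1 \<noteq> y2"
    using card_le_Suc0_iff_eq[of "Q - {None}"] finQ unfolding One_nat_def by blast
  obtain a b where ab: "y1 = Some a" "y2 = Some b" using y by auto
  interpret hyperbolic_cover F Q a b
  proof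
    show "sph_holo F" by (rule holoF)
    show "finite {x. F x = y}" for y
    proof -
      have "{x. F x = y} \<subseteq> J ` {x. f x = J' y}"
      proof
        fix x assume "x \<in> {x. F x = y}"
        then have "f (J' x) = J' y" by (auto simp: Fx JJ)
        then show "x \<in> J ` {x. f x = J' y}" using JJ(1)[of x] by (intro image_eqI[of _ _ "J' x"]) auto
      qed
      then show ?thesis using finite_fibre[of "J' y"] finite_subset by blast
    qed
    show "\<exists>x. F x = y" for y
    proof -
      obtain x where "f x = J' y" using surj_f by blast
      then show ?thesis using FJ[of x] JJ(1)[of y] by (intro exI[of _ "J x"]) simp
    qed
    show "finite Q" "None \<in> Q" "Some a \<in> Q" "Some b \<in> Q" "a \<noteq> b" using finQ NQ y ab by auto
    show "F x \<in> Q" if "x \<in> Q" for x using that P_forward unfolding Q_def by (auto simp: FJ)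
    show "sphere_deriv F x \<noteq> 0" if "F x \<notin> Q" for x
    proof -
      have "f (J' x) \<notin> P" using that by (simp add: Fx QP)
      then have "sphere_deriv f (J' x) \<noteq> 0" using not_P_preimage by blast
      moreover have "sphere_deriv F x = sphere_deriv J (f (J' x)) * (sphere_deriv f (J' x) * sphere_deriv J' x)"
        unfolding F_def using sphere_deriv_comp[OF sph_holo_comp[OF J(2) sph_holo_f] J(1), of x] sphere_deriv_comp[OF J(2) sph_holo_f, of x]
        by simp
      ultimately show ?thesis using dJ dJ' by simp
    qed
    show "\<exists>x y. x \<noteq> y \<and> F x = F y \<and> x \<notin> S \<and> y \<notin> S" if "finite S" for S
    proof -
      have "finite (J' ` S)" using that by simp
      from not_inj_off_finite[OF D2 this] obtain x y where xy: "x \<noteq> y" "f x = f y" "x \<notin> J' ` S" "y \<notin> J' ` S" by blast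
      then have "J x \<notin> S" "J y \<notin> S" using JJ(2) by (metis imageI)+
      moreover have "J x \<noteq> J y" using xy(1) injJ by (auto dest: injD)
      moreover have "F (J x) = F (J y)" using xy(2) by (simp add: FJ)
      ultimately show ?thesis by blast
    qed
  qed
  have "J x \<notin> Q" using x QP by blast
  then obtain z0 where z0: "J x = Some z0" using NQ by (cases "J x") auto
  have per': "(F ^^ m) (Some z0) = Some z0" using FJn[of m x] per z0 by simp
  have "F ^^ m \<circ> J = J \<circ> f ^^ m" using FJn by auto
  then have "sphere_deriv (F ^^ m \<circ> J) x = sphere_deriv (J \<circ> f ^^ m) x" by (rule arg_cong)
  then have "sphere_deriv (F ^^ m) (J x) * sphere_deriv J x = sphere_deriv J ((f ^^ m) x) * sphere_deriv (f ^^ m) x"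
    unfolding sphere_deriv_comp[OF J(1) sph_holo_funpow[OF holoF]] sphere_deriv_comp[OF sph_holo_funpow[OF sph_holo_f] J(1)] .
  then have "sphere_deriv (F ^^ m) (Some z0) = sphere_deriv (f ^^ m) x" using per z0 dJ[of x] by simp
  then show ?thesis using periodic_multiplier_bound[OF _ per' m] \<open>J x \<notin> Q\<close> z0 by simp
qed

section \<open>Arithmetic of the eigenvalues\<close>

section \<open>Partial field homomorphisms\<close>

text \<open>A homomorphism of a subfield \<open>K\<close> into the complex numbers; outside
  \<open>K\<close> the values of \<open>\<sigma>\<close> are arbitrary. Countability of
  \<open>K\<close> leaves uncountably many numbers transcendental over its image. Closure under
  \<open>inverse\<close> needs no exception, as \<open>inverse 0 = 0\<close>.\<close>

locale fhom =
  fixes K :: "complex set" and \<sigma> :: "complex \<Rightarrow> complex"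
  assumes countable_K: "countable K" and one_K: "1 \<in> K"
    and diff_K: "\<And>x y. x \<in> K \<Longrightarrow> y \<in> K \<Longrightarrow> x - y \<in> K"
    and mult_K: "\<And>x y. x \<in> K \<Longrightarrow> y \<in> K \<Longrightarrow> x * y \<in> K"
    and inverse_K: "\<And>x. x \<in> K \<Longrightarrow> inverse x \<in> K"
    and hom_diff: "\<And>x y. x \<in> K \<Longrightarrow> y \<in> K \<Longrightarrow> \<sigma> (x - y) = \<sigma> x - \<sigma> y"
    and hom_mult: "\<And>x y. x \<in> K \<Longrightarrow> y \<in> K \<Longrightarrow> \<sigma> (x * y) = \<sigma> x * \<sigma> y"
    and hom_1 [simp]: "\<sigma> 1 = 1"
begin

lemma zero_K: "0 \<in> K" and hom_0 [simp]: "\<sigma> 0 = 0"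
  using diff_K[OF one_K one_K] hom_diff[OF one_K one_K] by auto

lemma uminus_K: "x \<in> K \<Longrightarrow> - x \<in> K" and hom_uminus: "x \<in> K \<Longrightarrow> \<sigma> (- x) = - \<sigma> x"
  using diff_K[OF zero_K, of x] hom_diff[OF zero_K, of x] by auto

lemma add_K: "x \<in> K \<Longrightarrow> y \<in> K \<Longrightarrow> x + y \<in> K" and hom_add: "x \<in> K \<Longrightarrow> y \<in> K \<Longrightarrow> \<sigma> (x + y) = \<sigma> x + \<sigma> y"
  using diff_K[OF _ uminus_K, of x y] hom_diff[OF _ uminus_K, of x y] hom_uminus[of y] by auto

lemma hom_eq_0: "x \<in> K \<Longrightarrow> \<sigma> x = 0 \<longleftrightarrow> x = 0"
proof
  assume x: "x \<in> K" "\<sigma> x = 0"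
  show "x = 0"
  proof (rule ccontr)
    assume "x \<noteq> 0"
    then have "\<sigma> x * \<sigma> (inverse x) = 1" using hom_mult[OF x(1) inverse_K[OF x(1)]] by simp
    then show False using x(2) by simp
  qed
qed simp

lemma hom_inj: "x \<in> K \<Longrightarrow> y \<in> K \<Longrightarrow> \<sigma> x = \<sigma> y \<longleftrightarrow> x = y"
  using hom_eq_0[of "x - y"] hom_diff diff_K by auto

lemma divide_K: "x \<in> K \<Longrightarrow> y \<in> K \<Longrightarrow> x / y \<in> K"
  by (simp add: divide_inverse mult_K inverse_K)

lemma hom_inverse: "x \<in> K \<Longrightarrow> \<sigma> (inverse x) = inverse (\<sigma> x)"
proof (cases "x = 0")
  case False
  assume x: "x \<in> K"
  have "\<sigma> x * \<sigma> (inverse x) = 1" using hom_mult[OF x inverse_K[OF x]] False by simp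
  then show ?thesis by (metis inverse_unique)
qed simp

lemma hom_divide: "x \<in> K \<Longrightarrow> y \<in> K \<Longrightarrow> \<sigma> (x / y) = \<sigma> x / \<sigma> y"
  by (simp add: divide_inverse hom_mult inverse_K hom_inverse)

lemma power_K: "x \<in> K \<Longrightarrow> x ^ n \<in> K" and hom_power: "x \<in> K \<Longrightarrow> \<sigma> (x ^ n) = \<sigma> x ^ n"
  by (induction n) (auto simp: one_K mult_K hom_mult)

lemma sum_K:
  assumes "\<And>i. i \<in> I \<Longrightarrow> g i \<in> K"
  shows "sum g I \<in> K \<and> \<sigma> (sum g I) = (\<Sum>i\<in>I. \<sigma> (g i))"
  using assms by (induction I rule: infinite_finite_induct) (auto simp: zero_K add_K hom_add)

lemma prod_K:
  assumes "\<And>i. i \<in> I \<Longrightarrow> g i \<in> K"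
  shows "prod g I \<in> K \<and> \<sigma> (prod g I) = (\<Prod>i\<in>I. \<sigma> (g i))"
  using assms by (induction I rule: infinite_finite_induct) (auto simp: one_K mult_K hom_mult)

lemma of_nat_K: "of_nat n \<in> K" and hom_of_nat: "\<sigma> (of_nat n) = of_nat n"
  by (induction n) (auto simp: zero_K one_K add_K hom_add)

definition polyK :: "complex poly \<Rightarrow> bool" where "polyK r \<longleftrightarrow> (\<forall>i. coeff r i \<in> K)"

abbreviation hp :: "complex poly \<Rightarrow> complex poly" where "hp \<equiv> map_poly \<sigma>"

lemma coeff_hp [simp]: "coeff (hp r) i = \<sigma> (coeff r i)"
  by (simp add: coeff_map_poly)

lemma polyKD: "polyK r \<Longrightarrow> coeff r i \<in> K"
  by (simp add: polyK_def)

lemma hp_eq_0: "polyK r \<Longrightarrow> hp r = 0 \<longleftrightarrow> r = 0"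
  by (auto simp: poly_eq_iff polyK_def hom_eq_0)

lemma degree_hp: "polyK r \<Longrightarrow> degree (hp r) = degree r"
  by (cases "r = 0") (auto intro!: map_poly_degree_eq simp: hom_eq_0 polyKD)

lemma polyK_diff: "polyK r \<Longrightarrow> polyK s \<Longrightarrow> polyK (r - s)"
  and hp_diff: "polyK r \<Longrightarrow> polyK s \<Longrightarrow> hp (r - s) = hp r - hp s"
  by (auto simp: polyK_def diff_K poly_eq_iff hom_diff)

lemma polyK_add: "polyK r \<Longrightarrow> polyK s \<Longrightarrow> polyK (r + s)"
  and hp_add: "polyK r \<Longrightarrow> polyK s \<Longrightarrow> hp (r + s) = hp r + hp s"
  by (auto simp: polyK_def add_K poly_eq_iff hom_add)

lemma polyK_mult: "polyK r \<Longrightarrow> polyK s \<Longrightarrow> polyK (r * s)"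
  unfolding polyK_def coeff_mult by (intro allI conjunct1[OF sum_K] mult_K) auto

lemma hp_mult: "polyK r \<Longrightarrow> polyK s \<Longrightarrow> hp (r * s) = hp r * hp s"
proof (rule poly_eqI)
  fix n assume rs: "polyK r" "polyK s"
  have "\<sigma> (\<Sum>i\<le>n. coeff r i * coeff s (n - i)) = (\<Sum>i\<le>n. \<sigma> (coeff r i * coeff s (n - i)))"
    using rs by (intro conjunct2[OF sum_K]) (auto simp: mult_K polyK_def)
  then show "coeff (hp (r * s)) n = coeff (hp r * hp s) n"
    using rs by (simp add: coeff_mult hom_mult polyK_def)
qed

lemma polyK_monom: "c \<in> K \<Longrightarrow> polyK (monom c n)" and hp_monom: "hp (monom c n) = monom (\<sigma> c) n"
  by (auto simp: polyK_def zero_K poly_eq_iff)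

lemma polyK_const: "c \<in> K \<Longrightarrow> polyK [:c:]" and hp_const: "hp [:c:] = [:\<sigma> c:]"
  using polyK_monom[of c 0] hp_monom[of c 0] by (auto simp: monom_0)

lemma polyK_linear: "c \<in> K \<Longrightarrow> polyK [:- c, 1:]" and hp_linear: "c \<in> K \<Longrightarrow> hp [:- c, 1:] = [:- \<sigma> c, 1:]"
  by (auto simp: polyK_def zero_K one_K uminus_K coeff_pCons poly_eq_iff hom_uminus split: nat.split)

lemma polyK_0: "polyK 0" and polyK_1: "polyK 1" and hp_1: "hp 1 = 1"
  using polyK_const[OF zero_K] polyK_const[OF one_K] hp_const[of 1] by (auto simp: one_pCons)

lemma hp_smult: "c \<in> K \<Longrightarrow> polyK r \<Longrightarrow> hp (smult c r) = smult (\<sigma> c) (hp r)"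
  by (auto simp: polyK_def mult_K poly_eq_iff hom_mult)

lemma polyK_power: "polyK r \<Longrightarrow> polyK (r ^ n)" and hp_power: "polyK r \<Longrightarrow> hp (r ^ n) = hp r ^ n"
  by (induction n) (auto simp: polyK_1 hp_1 polyK_mult hp_mult)

lemma polyK_prod:
  assumes "\<And>i. i \<in> I \<Longrightarrow> polyK (g i)"
  shows "polyK (prod g I) \<and> hp (prod g I) = (\<Prod>i\<in>I. hp (g i))"
  using assms by (induction I rule: infinite_finite_induct) (auto simp: polyK_1 hp_1 polyK_mult hp_mult)

lemma polyK_pderiv: "polyK r \<Longrightarrow> polyK (pderiv r)" and hp_pderiv: "polyK r \<Longrightarrow> hp (pderiv r) = pderiv (hp r)"
  using of_nat_K hom_of_nat
  by (auto simp: polyK_def coeff_pderiv poly_eq_iff mult_K hom_mult simp del: of_nat_Suc)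

lemma polyK_pCons: "polyK (pCons a r) \<longleftrightarrow> a \<in> K \<and> polyK r"
  by (auto simp: polyK_def coeff_pCons split: nat.splits)

lemma hp_pCons: "hp (pCons a r) = pCons (\<sigma> a) (hp r)"
  by (rule map_poly_pCons) (rule hom_0)

lemma poly_K: "polyK r \<Longrightarrow> x \<in> K \<Longrightarrow> poly r x \<in> K"
  by (induction r) (auto simp: zero_K polyK_pCons add_K mult_K)

lemma poly_hp: "polyK r \<Longrightarrow> x \<in> K \<Longrightarrow> poly (hp r) (\<sigma> x) = \<sigma> (poly r x)"
  by (induction r) (auto simp: polyK_pCons hp_pCons hom_add hom_mult mult_K poly_K)

lemma countable_polyK: "countable {r. polyK r}"
proof -
  have "coeffs ` {r. polyK r} \<subseteq> lists K"
    by (auto simp: polyK_def coeffs_def)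
  then have "countable (coeffs ` {r. polyK r})" using countable_lists[OF countable_K] countable_subset by blast
  moreover have "inj_on coeffs {r. polyK r}" by (metis coeffs_eq_iff inj_onI)
  ultimately show ?thesis using countable_image_inj_on by blast
qed

end

context fhom
begin

text \<open>The condition for \<open>\<sigma>\<close> to extend to the field generated by
  \<open>c\<close> with \<open>c\<close> sent to \<open>d\<close>. Over the rationals, for algebraic
  \<open>c\<close>, it says that \<open>d\<close> is a Galois conjugate of \<open>c\<close>; for
  transcendental \<open>c\<close> any transcendental \<open>d\<close> qualifies.\<close>

definition compat :: "complex \<Rightarrow> complex \<Rightarrow> bool" where
  "compat c d \<longleftrightarrow> (\<forall>r. polyK r \<longrightarrow> (poly r c = 0 \<longleftrightarrow> poly (hp r) d = 0))"

text \<open>The generated field consists of the quotients of polynomial values at \<open>c\<close>.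
  Two fractions representing the same number differ by a polynomial relation for \<open>c\<close>,
  which \<open>compat\<close> carries over to \<open>d\<close>; so the extension is well
  defined.\<close>

lemma extend_by_one:
  assumes "compat c d"
  shows "\<exists>K' \<sigma>'. fhom K' \<sigma>' \<and> insert c K \<subseteq> K' \<and> (\<forall>x\<in>K. \<sigma>' x = \<sigma> x) \<and> \<sigma>' c = d"
proof -
  define fr where "fr r s = poly r c / poly s c" for r s
  define fr' where "fr' r s = poly (hp r) d / poly (hp s) d" for r s
  define K' where "K' = {fr r s | r s. polyK r \<and> polyK s \<and> poly s c \<noteq> 0}"
  define \<sigma>' where "\<sigma>' x = (THE y. \<exists>r s. polyK r \<and> polyK s \<and> poly s c \<noteq> 0 \<and> x = fr r s \<and> y = fr' r s)" for x
  have nz: "poly (hp s) d \<noteq> 0" if "polyK s" "poly s c \<noteq> 0" for s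
    using assms that by (auto simp: compat_def)
  have val: "\<sigma>' (fr r s) = fr' r s" if rs: "polyK r" "polyK s" "poly s c \<noteq> 0" for r s
    unfolding \<sigma>'_def
  proof (rule the_equality)
    show "\<exists>r' s'. polyK r' \<and> polyK s' \<and> poly s' c \<noteq> 0 \<and> fr r s = fr r' s' \<and> fr' r s = fr' r' s'"
      using rs by blast
    fix y assume "\<exists>r' s'. polyK r' \<and> polyK s' \<and> poly s' c \<noteq> 0 \<and> fr r s = fr r' s' \<and> y = fr' r' s'"
    then obtain r' s' where s: "polyK r'" "polyK s'" "poly s' c \<noteq> 0" "fr r s = fr r' s'" "y = fr' r' s'" by blast
    have "poly (r * s' - r' * s) c = 0" using s(3,4) rs(3) by (simp add: fr_def frac_eq_eq)
    moreover have "polyK (r * s' - r' * s)" using s rs by (intro polyK_diff polyK_mult)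
    ultimately have "poly (hp (r * s' - r' * s)) d = 0" using assms unfolding compat_def by blast
    then have "poly (hp r) d * poly (hp s') d = poly (hp r') d * poly (hp s) d"
      using s rs by (simp add: hp_diff hp_mult polyK_mult)
    then show "y = fr' r s" unfolding s(5) fr'_def frac_eq_eq[OF nz[OF s(2,3)] nz[OF rs(2,3)]] by (rule sym)
  qed
  have mem: "fr r s \<in> K'" if "polyK r" "polyK s" "poly s c \<noteq> 0" for r s
    unfolding K'_def mem_Collect_eq using that by (intro exI[of _ r] exI[of _ s] conjI refl)
  have of_K: "x = fr [:x:] 1" for x by (simp add: fr_def)
  have of_K': "x \<in> K \<Longrightarrow> fr' [:x:] 1 = \<sigma> x" for x by (simp add: fr'_def hp_const hp_1)
  have E: "\<exists>r s. polyK r \<and> polyK s \<and> poly s c \<noteq> 0 \<and> x = fr r s" if "x \<in> K'" for x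
    using that unfolding K'_def mem_Collect_eq by metis
  have diff: "x - y \<in> K' \<and> \<sigma>' (x - y) = \<sigma>' x - \<sigma>' y" and mult: "x * y \<in> K' \<and> \<sigma>' (x * y) = \<sigma>' x * \<sigma>' y"
    if xy: "x \<in> K'" "y \<in> K'" for x y
  proof -
    obtain r s r' s' where s: "polyK r" "polyK s" "poly s c \<noteq> 0" "x = fr r s"
      "polyK r'" "polyK s'" "poly s' c \<noteq> 0" "y = fr r' s'" using E[OF xy(1)] E[OF xy(2)] by blast
    have pK: "polyK (r * s' - r' * s)" "polyK (s * s')" "polyK (r * r')" using s by (auto intro: polyK_diff polyK_mult)
    have 0: "poly (s * s') c \<noteq> 0" using s by simp
    have 1: "x - y = fr (r * s' - r' * s) (s * s')" using s by (simp add: fr_def diff_frac_eq)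
    have 2: "fr' (r * s' - r' * s) (s * s') = fr' r s - fr' r' s'"
      using s nz[OF s(2,3)] nz[OF s(6,7)] by (simp add: fr'_def diff_frac_eq hp_diff hp_mult polyK_mult)
    show "x - y \<in> K' \<and> \<sigma>' (x - y) = \<sigma>' x - \<sigma>' y"
      using mem[OF pK(1,2) 0] val[OF pK(1,2) 0] val[OF s(1-3)] val[OF s(5-7)] unfolding 2 1[symmetric] s(4)[symmetric] s(8)[symmetric]
      by simp
    have 3: "x * y = fr (r * r') (s * s')" using s by (simp add: fr_def)
    have 4: "fr' (r * r') (s * s') = fr' r s * fr' r' s'" using s by (simp add: fr'_def hp_mult)
    show "x * y \<in> K' \<and> \<sigma>' (x * y) = \<sigma>' x * \<sigma>' y"
      using mem[OF pK(3,2) 0] val[OF pK(3,2) 0] val[OF s(1-3)] val[OF s(5-7)] unfolding 4 3[symmetric] s(4)[symmetric] s(8)[symmetric]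
      by simp
  qed
  have inv: "inverse x \<in> K'" if x: "x \<in> K'" for x
  proof -
    obtain r s where s: "polyK r" "polyK s" "poly s c \<noteq> 0" "x = fr r s" using E[OF x] by blast
    show ?thesis
    proof (cases "x = 0")
      case False
      then have *: "poly r c \<noteq> 0" using s by (auto simp: fr_def)
      have "inverse x = fr s r" unfolding s(4) fr_def by simp
      then show ?thesis using mem[OF s(2,1) *] by simp
    qed (use x in simp)
  qed
  have sub: "x \<in> K' \<and> \<sigma>' x = \<sigma> x" if x: "x \<in> K" for x
  proof -
    have 1: "polyK [:x:]" "polyK 1" "poly 1 c \<noteq> 0" using polyK_const[OF x] polyK_1 by auto
    show ?thesis using mem[OF 1] val[OF 1] unfolding of_K[symmetric] of_K'[OF x] by simp
  qed
  have countable': "countable K'"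
  proof -
    have "K' \<subseteq> (\<lambda>(r, s). fr r s) ` ({r. polyK r} \<times> {r. polyK r})" unfolding K'_def by force
    from countable_subset[OF this countable_image[OF countable_SIGMA[OF countable_polyK countable_polyK]]]
    show ?thesis .
  qed
  have "fhom K' \<sigma>'"
    using countable' sub[OF one_K] diff mult inv by unfold_locales simp_all
  moreover have "c \<in> K' \<and> \<sigma>' c = d"
  proof -
    have "polyK [:0, 1:]" "hp [:0, 1:] = [:0, 1:]" using polyK_linear[OF zero_K] hp_linear[OF zero_K] by auto
    then have 1: "polyK [:0, 1:]" "polyK 1" "poly 1 c \<noteq> 0" "fr' [:0, 1:] 1 = d" "fr [:0, 1:] 1 = c"
      using polyK_1 by (auto simp: fr'_def fr_def hp_1)
    show ?thesis using mem[OF 1(1-3)] val[OF 1(1-3)] 1 by simp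
  qed
  ultimately show ?thesis using sub by (intro exI[of _ K'] exI[of _ \<sigma>']) auto
qed

lemma monic_division:
  assumes g: "polyK g" "lead_coeff g = 1" and r: "polyK r"
  shows "\<exists>s t. polyK s \<and> polyK t \<and> r = g * s + t \<and> (t = 0 \<or> degree t < degree g)"
  using r
\<comment> \<open>The measure puts the zero polynomial strictly below nonzero constants, which have
  the same \<open>degree\<close>.\<close>
proof (induction "if r = 0 then 0 else Suc (degree r)" arbitrary: r rule: less_induct)
  case less
  show ?case
  proof (cases "r = 0 \<or> degree r < degree g")
    case True
    then show ?thesis using less.prems polyK_0 by (intro exI[of _ 0] exI[of _ r]) auto
  next
    case False
    define s where "s = monom (lead_coeff r) (degree r - degree g)"
    have s: "polyK s" unfolding s_def by (intro polyK_monom polyKD less.prems)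
    have g0: "g \<noteq> 0" using g(2) by auto
    have s0: "s \<noteq> 0" "degree s = degree r - degree g" using False degree_monom_eq[of "lead_coeff r" "degree r - degree g"] unfolding s_def by simp_all
    have dgs: "degree (g * s) = degree r" using False g0 s0 by (simp add: degree_mult_eq)
    moreover have "lead_coeff (g * s) = lead_coeff r" unfolding lead_coeff_mult g(2) s0(2) by (simp add: s_def)
    ultimately have "coeff (r - g * s) (degree r) = 0" by simp
    moreover have "degree (r - g * s) \<le> degree r" using dgs by (simp add: degree_diff_le)
    ultimately have lt: "r - g * s = 0 \<or> degree (r - g * s) < degree r"
      by (intro eq_zero_or_degree_less)
    have pK: "polyK (r - g * s)" by (intro polyK_diff polyK_mult less.prems s g)
    have "(if r - g * s = 0 then 0 else Suc (degree (r - g * s))) < (if r = 0 then 0 else Suc (degree r))"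
      using lt False by auto
    from less.hyps[OF this pK] obtain s' t where st: "polyK s'" "polyK t" "r - g * s = g * s' + t" "t = 0 \<or> degree t < degree g"
      by blast
    have "r = g * (s + s') + t" using st(3) by (simp add: algebra_simps)
    then show ?thesis using st s polyK_add by blast
  qed
qed

text \<open>The monic polynomial of least degree among those vanishing at \<open>c\<close>. The
  parameter \<open>\<tau>\<close> covers both uses: relations for a number itself, and relations
  after \<open>\<sigma>\<close> has been applied to the coefficients.\<close>

lemma ideal_generator:
  assumes r0: "polyK r0" "r0 \<noteq> 0" "poly (map_poly \<tau> r0) c = 0"
    and \<tau>: "\<tau> = \<sigma> \<or> \<tau> = id"
  obtains g where "polyK g" "lead_coeff g = 1" "poly (map_poly \<tau> g) c = 0"
    "\<And>r. polyK r \<Longrightarrow> poly (map_poly \<tau> r) c = 0 \<Longrightarrow> \<exists>s. polyK s \<and> r = g * s"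
proof -
  let ?Z = "\<lambda>r. poly (map_poly \<tau> r) c = 0"
  have hom: "map_poly \<tau> (r - s) = map_poly \<tau> r - map_poly \<tau> s" "map_poly \<tau> (r * s) = map_poly \<tau> r * map_poly \<tau> s"
    if "polyK r" "polyK s" for r s
    using \<tau> that by (auto simp: hp_diff hp_mult map_poly_id)
  define h where "h = arg_min degree (\<lambda>r. polyK r \<and> r \<noteq> 0 \<and> ?Z r)"
  have h: "polyK h" "h \<noteq> 0" "?Z h" and minimal: "\<And>r. polyK r \<Longrightarrow> r \<noteq> 0 \<Longrightarrow> ?Z r \<Longrightarrow> degree h \<le> degree r"
    using arg_min_nat_lemma[of "\<lambda>r. polyK r \<and> r \<noteq> 0 \<and> ?Z r" r0 degree] r0 unfolding h_def by auto
  define g where "g = [:inverse (lead_coeff h):] * h"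
  have cK: "polyK [:inverse (lead_coeff h):]" by (intro polyK_const inverse_K polyKD h)
  have g: "polyK g" unfolding g_def by (rule polyK_mult[OF cK h(1)])
  have lg: "lead_coeff g = 1" "degree g = degree h" using h(2) by (auto simp: g_def)
  have Zg: "?Z g" unfolding g_def hom(2)[OF cK h(1)] using h(3) by simp
  show ?thesis
  proof (rule that[OF g lg(1) Zg])
    fix r assume r: "polyK r" "?Z r"
    obtain s t where st: "polyK s" "polyK t" "r = g * s + t" "t = 0 \<or> degree t < degree g"
      using monic_division[OF g lg(1) r(1)] by blast
    have "t = r - g * s" using st(3) by simp
    then have "?Z t" using r(2) Zg by (simp add: hom polyK_mult r(1) g st(1))
    then have "t = 0" using minimal[of t] st(2,4) lg(2) by fastforce
    then show "\<exists>s. polyK s \<and> r = g * s" using st by auto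
  qed
qed

text \<open>The hard direction of \<open>compat\<close> starts from a relation at \<open>d\<close>.
  The generator \<open>h\<close> of all such relations divides \<open>g\<close>; the cofactor has
  smaller degree, so it cannot vanish at \<open>c\<close>, hence \<open>h\<close> does, and with it
  every multiple of \<open>h\<close>.\<close>

lemma minimal_polynomial:
  assumes "polyK r0" "r0 \<noteq> 0" "poly r0 c = 0"
  obtains g where "polyK g" "lead_coeff g = 1" "poly g c = 0" "\<And>d. poly (hp g) d = 0 \<Longrightarrow> compat c d"
    "\<And>r. polyK r \<Longrightarrow> r \<noteq> 0 \<Longrightarrow> poly r c = 0 \<Longrightarrow> degree g \<le> degree r"
proof -
  obtain g where g: "polyK g" "lead_coeff g = 1" "poly g c = 0"
    and gdvd: "\<And>r. polyK r \<Longrightarrow> poly r c = 0 \<Longrightarrow> \<exists>s. polyK s \<and> r = g * s"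
    using ideal_generator[of r0 id c] assms unfolding map_poly_id' map_poly_id by auto
  have g0: "g \<noteq> 0" using g(2) by auto
  have min: "degree g \<le> degree r" if "polyK r" "r \<noteq> 0" "poly r c = 0" for r
    using gdvd[OF that(1,3)] that(2) by (auto simp: degree_mult_eq)
  have "compat c d" if d: "poly (hp g) d = 0" for d
    unfolding compat_def
  proof (intro allI impI iffI)
    fix r assume r: "polyK r"
    show "poly (hp r) d = 0" if rc: "poly r c = 0"
    proof -
      obtain s where "polyK s" "r = g * s" using gdvd[OF r rc] by blast
      then show ?thesis using d g by (simp add: hp_mult)
    qed
    show "poly r c = 0" if rd: "poly (hp r) d = 0"
    proof -
      obtain h where h: "polyK h" "lead_coeff h = 1" "poly (hp h) d = 0"
        and hdvd: "\<And>r. polyK r \<Longrightarrow> poly (hp r) d = 0 \<Longrightarrow> \<exists>s. polyK s \<and> r = h * s"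
        using ideal_generator[of g \<sigma> d] g(1) g0 d by blast
      obtain s where s: "polyK s" "g = h * s" using hdvd[OF g(1) d] by blast
      have h0: "h \<noteq> 0" "s \<noteq> 0" using g0 s(2) by auto
      have "degree h \<noteq> 0"
      proof
        assume "degree h = 0"
        then obtain a where "h = [:a:]" by (rule degree_eq_zeroE)
        then have "h = 1" using h(2) by (simp add: one_pCons)
        then show False using h(3) by (simp add: hp_1)
      qed
      then have "\<not> degree g \<le> degree s" using s(2) h0 by (simp add: degree_mult_eq)
      then have "poly s c \<noteq> 0" using min[OF s(1) h0(2)] by blast
      then have "poly h c = 0" using g(3) s(2) by simp
      moreover obtain s' where "r = h * s'" using hdvd[OF r rd] by blast
      ultimately show ?thesis by simp
    qed
  qed
  then show ?thesis using that[OF g] min by blast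
qed

text \<open>Only countably many \<open>d\<close> satisfy an algebraic relation over the image field,
  while an interval is uncountable. The interval from 2 to 3 is chosen to lie outside the closed
  unit disc, contradicting the bound on conjugates.\<close>

lemma transcendental_compat:
  assumes "\<And>r. polyK r \<Longrightarrow> poly r c = 0 \<Longrightarrow> r = 0"
  shows "\<exists>d. norm d > 1 \<and> compat c d"
proof -
  define B where "B = (\<Union>r\<in>{r. polyK r \<and> r \<noteq> 0}. {d. poly (hp r) d = 0})"
  have "countable B" unfolding B_def
  proof (rule countable_UN)
    show "countable {r. polyK r \<and> r \<noteq> 0}" by (rule countable_subset[OF _ countable_polyK]) auto
    show "countable {d. poly (hp r) d = 0}" if "r \<in> {r. polyK r \<and> r \<noteq> 0}" for r
      using that by (intro countable_finite poly_roots_finite) (auto simp: hp_eq_0)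
  qed
  moreover have "\<not> countable (complex_of_real ` {2<..<3})"
    using uncountable_open_interval[of 2 "3::real"] countable_image_inj_on[of complex_of_real "{2<..<3}"]
    by (auto simp: inj_on_def)
  ultimately have "\<not> complex_of_real ` {2<..<3} \<subseteq> B" by (metis countable_subset)
  then obtain t where t: "t \<in> {2<..<3}" "complex_of_real t \<notin> B" by blast
  have "poly (hp r) (complex_of_real t) \<noteq> 0" if "polyK r" "r \<noteq> 0" for r
    using t(2) that unfolding B_def by blast
  then have "compat c (complex_of_real t)"
    unfolding compat_def using assms by (metis hp_eq_0 poly_0)
  then show ?thesis using t(1) by (intro exI[of _ "complex_of_real t"]) auto
qed

lemma exists_compat: "\<exists>d. compat c d"
proof (cases "\<exists>r. polyK r \<and> r \<noteq> 0 \<and> poly r c = 0")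
  case True
  then obtain r0 where "polyK r0" "r0 \<noteq> 0" "poly r0 c = 0" by blast
  from minimal_polynomial[OF this] obtain g where
    g: "polyK g" "lead_coeff g = 1" "poly g c = 0" "\<And>d. poly (hp g) d = 0 \<Longrightarrow> compat c d" by metis
  have "degree g \<noteq> 0"
  proof
    assume "degree g = 0"
    then obtain a where "g = [:a:]" by (rule degree_eq_zeroE)
    then show False using g(2,3) by simp
  qed
  then have "\<not> constant (poly (hp g))" by (simp add: constant_degree degree_hp g(1))
  then show ?thesis using fundamental_theorem_of_algebra g(4) by blast
qed (use transcendental_compat in blast)

end

lemma fhom_extend:
  assumes "finite A" "fhom K \<sigma>"
  shows "\<exists>K' \<sigma>'. fhom K' \<sigma>' \<and> K \<union> A \<subseteq> K' \<and> (\<forall>x\<in>K. \<sigma>' x = \<sigma> x)"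
  using assms
proof (induction A arbitrary: K \<sigma> rule: finite_induct)
  case empty
  then show ?case by auto
next
  case (insert c A)
  interpret fhom K \<sigma> by fact
  obtain d where "compat c d" using exists_compat by blast
  then obtain K1 \<sigma>1 where 1: "fhom K1 \<sigma>1" "insert c K \<subseteq> K1" "\<forall>x\<in>K. \<sigma>1 x = \<sigma> x"
    using extend_by_one by blast
  then obtain K2 \<sigma>2 where 2: "fhom K2 \<sigma>2" "K1 \<union> A \<subseteq> K2" "\<forall>x\<in>K1. \<sigma>2 x = \<sigma>1 x"
    using insert.IH by blast
  have "\<forall>x\<in>K. \<sigma>2 x = \<sigma> x" using 1 2 by auto
  then show ?case using 1 2 by (intro exI[of _ K2] exI[of _ \<sigma>2]) auto
qed

lemma fhom_Rats: "fhom \<rat> id"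
  by unfold_locales (auto simp: countable_rat)

section \<open>Galois conjugates of a postcritically finite map\<close>

context fhom
begin

definition pts :: "sphere set" where "pts = {x. set_option x \<subseteq> K}"

lemma pts_simps [simp]: "None \<in> pts" "Some z \<in> pts \<longleftrightarrow> z \<in> K"
  by (simp_all add: pts_def)

lemma inj_on_pts: "inj_on (map_option \<sigma>) pts"
proof (rule inj_onI)
  fix x y assume "x \<in> pts" "y \<in> pts" "map_option \<sigma> x = map_option \<sigma> y"
  then show "x = y" by (cases x; cases y) (auto simp: hom_inj)
qed

lemma chart_pts: "x \<in> pts \<Longrightarrow> chart x x \<in> K \<and> \<sigma> (chart x x) = chart (map_option \<sigma> x) (map_option \<sigma> x)"
  by (cases x) (auto simp: chart_def zero_K)

lemma polyKI: "(\<And>i. i \<le> degree r \<Longrightarrow> coeff r i \<in> K) \<Longrightarrow> polyK r"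
  unfolding polyK_def by (metis coeff_eq_0 not_le zero_K)

lemma
  assumes "polyK r"
  shows polyK_hpoly: "polyK (hpoly D x r)" and hp_hpoly: "hp (hpoly D x r) = hpoly D (map_option \<sigma> x) (hp r)"
proof -
  have 1: "polyK (reflect_poly r)" using assms zero_K by (auto simp: polyK_def coeff_reflect_poly)
  have 2: "hp (reflect_poly r) = reflect_poly (hp r)"
    using assms by (intro poly_eqI) (simp add: coeff_reflect_poly degree_hp)
  have "polyK (hrev D r)" "hp (hrev D r) = hrev D (hp r)"
    using assms 1 2 by (simp_all add: hrev_def polyK_mult polyK_monom one_K hp_mult hp_monom degree_hp)
  then show "polyK (hpoly D x r)" "hp (hpoly D x r) = hpoly D (map_option \<sigma> x) (hp r)"
    using assms by (simp_all add: hpoly_def split: option.split)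
qed

lemma
  assumes "polyK r" "polyK s"
  shows polyK_wronskian: "polyK (wronskian r s)" and hp_wronskian: "hp (wronskian r s) = wronskian (hp r) (hp s)"
  using assms
  by (simp_all add: wronskian_def polyK_diff polyK_mult polyK_pderiv hp_diff hp_mult hp_pderiv)

text \<open>The factorisation of \<open>r\<close> into linear factors can be conjugated once all
  roots are in \<open>K\<close>. It is needed to see that the conjugate map has no critical points
  other than the images of those of \<open>f\<close>.\<close>

lemma hp_root:
  assumes "polyK r" "r \<noteq> 0" "\<And>w. poly r w = 0 \<Longrightarrow> w \<in> K" "poly (hp r) z = 0"
  shows "\<exists>w. poly r w = 0 \<and> z = \<sigma> w"
proof -
  have 1: "polyK ([:- w, 1:] ^ order w r)" if "w \<in> {w. poly r w = 0}" for w
    using that by (intro polyK_power polyK_linear) (auto intro: assms(3))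
  have "hp r = hp (smult (lead_coeff r) (\<Prod>w | poly r w = 0. [:- w, 1:] ^ order w r))"
    by (simp only: complex_poly_decompose)
  also have "\<dots> = smult (\<sigma> (lead_coeff r)) (hp (\<Prod>w | poly r w = 0. [:- w, 1:] ^ order w r))"
    by (intro hp_smult conjunct1[OF polyK_prod] 1 polyKD[OF assms(1)])
  also have "hp (\<Prod>w | poly r w = 0. [:- w, 1:] ^ order w r) = (\<Prod>w | poly r w = 0. hp ([:- w, 1:] ^ order w r))"
    by (intro conjunct2[OF polyK_prod] 1)
  also have "\<dots> = (\<Prod>w | poly r w = 0. [:- \<sigma> w, 1:] ^ order w r)"
    using assms(3) by (intro prod.cong refl) (simp add: hp_power polyK_linear hp_linear)
  finally have "\<sigma> (lead_coeff r) * (\<Prod>w | poly r w = 0. (z - \<sigma> w) ^ order w r) = 0"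
    using assms(4) by (simp add: poly_prod)
  moreover have "\<sigma> (lead_coeff r) \<noteq> 0" using assms(1,2) by (simp add: hom_eq_0 polyKD)
  ultimately show ?thesis using poly_roots_finite[OF assms(2)] by auto
qed

end

text \<open>The conjugate map has the conjugated coefficients. The Bezout identity carries
  coprimality across \<open>\<sigma>\<close>, and \<open>critical_K\<close> carries the critical
  points, hence the finiteness of the postcritical set.\<close>

locale conjugate_pcf = pcf p q D + fhom K \<sigma> for p q D K \<sigma> +
  fixes u w
  assumes polyK_pq: "polyK p" "polyK q" and bezout: "polyK u" "polyK w" "u * p + w * q = 1"
    and critical_K: "\<And>z. poly (wronskian p q) z = 0 \<Longrightarrow> z \<in> K"
begin

abbreviation g :: "sphere \<Rightarrow> sphere" where "g \<equiv> rat_map (hp p) (hp q)"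

abbreviation \<iota> :: "sphere \<Rightarrow> sphere" where "\<iota> \<equiv> map_option \<sigma>"

lemma rational_conj: "rational (hp p) (hp q) D"
proof
  show "hp q \<noteq> 0" using q0 polyK_pq by (simp add: hp_eq_0)
  show "coprime (hp p) (hp q)"
  proof (rule coprimeI)
    fix c assume "c dvd hp p" "c dvd hp q"
    then have "c dvd hp u * hp p + hp w * hp q" by simp
    also have "hp u * hp p + hp w * hp q = hp (u * p + w * q)"
      by (simp only: hp_mult hp_add polyK_mult polyK_pq bezout(1,2))
    finally show "is_unit c" by (simp add: bezout hp_1)
  qed
qed (use deg D1 polyK_pq degree_hp in auto)

sublocale conj: rational "hp p" "hp q" D by (rule rational_conj)

lemma conj_values:
  assumes "x \<in> pts"
  shows "f x \<in> pts" "g (\<iota> x) = \<iota> (f x)"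
    and "sphere_deriv f x \<in> K" "sphere_deriv g (\<iota> x) = \<sigma> (sphere_deriv f x)"
proof -
  let ?c = "chart x x"
  have c: "?c \<in> K" "\<sigma> ?c = chart (\<iota> x) (\<iota> x)" using chart_pts[OF assms] by auto
  have val: "poly r ?c \<in> K" "poly (hp r) (chart (\<iota> x) (\<iota> x)) = \<sigma> (poly r ?c)" if "polyK r" for r
    using poly_K[OF that c(1)] poly_hp[OF that c(1)] c(2) by auto
  note P = polyK_hpoly[OF polyK_pq(1), of D x] and Q = polyK_hpoly[OF polyK_pq(2), of D x]
  note W = polyK_wronskian[OF P Q]
  have p: "poly (hpoly D (\<iota> x) (hp p)) (chart (\<iota> x) (\<iota> x)) = \<sigma> (poly (hpoly D x p) ?c)"
    using val(2)[OF P] by (simp add: hp_hpoly polyK_pq)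
  have q: "poly (hpoly D (\<iota> x) (hp q)) (chart (\<iota> x) (\<iota> x)) = \<sigma> (poly (hpoly D x q) ?c)"
    using val(2)[OF Q] by (simp add: hp_hpoly polyK_pq)
  have w: "poly (wronskian (hpoly D (\<iota> x) (hp p)) (hpoly D (\<iota> x) (hp q))) (chart (\<iota> x) (\<iota> x))
      = \<sigma> (poly (wronskian (hpoly D x p) (hpoly D x q)) ?c)"
    using val(2)[OF W] by (simp add: hp_wronskian P Q hp_hpoly polyK_pq)
  show 1: "f x \<in> pts" unfolding f_homogeneous[of x] using val(1)[OF P] val(1)[OF Q] by (simp add: divide_K)
  show 2: "g (\<iota> x) = \<iota> (f x)"
    unfolding f_homogeneous[of x] conj.f_homogeneous[of "\<iota> x"] p q
    using val(1)[OF P] val(1)[OF Q] by (simp add: hom_eq_0 hom_divide)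
  show "sphere_deriv f x \<in> K"
    unfolding sphere_deriv_f[of x] using val(1)[OF P] val(1)[OF Q] val(1)[OF W]
    by (simp add: divide_K power_K uminus_K)
  show "sphere_deriv g (\<iota> x) = \<sigma> (sphere_deriv f x)"
    unfolding sphere_deriv_f[of x] conj.sphere_deriv_f[of "\<iota> x"] p q w 2
    using val(1)[OF P] val(1)[OF Q] val(1)[OF W]
    by (simp add: hom_divide divide_K power_K uminus_K hom_uminus hom_power)
qed

lemma conj_funpow:
  assumes "x \<in> pts"
  shows "(f ^^ n) x \<in> pts \<and> (g ^^ n) (\<iota> x) = \<iota> ((f ^^ n) x)"
  by (induction n) (auto simp: assms conj_values)

lemma conj_critical_set: "critical_set g \<subseteq> \<iota> ` (critical_set f \<inter> pts)"
proof
  fix y assume "y \<in> critical_set g"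
  then have y: "sphere_deriv g y = 0" by (simp add: critical_set_def)
  show "y \<in> \<iota> ` (critical_set f \<inter> pts)"
  proof (cases y)
    case None
    have "\<sigma> (sphere_deriv f None) = 0" using conj_values(4)[of None] y None by simp
    then have "sphere_deriv f None = 0" using hom_eq_0 conj_values(3)[of None] by simp
    then show ?thesis using None by (intro image_eqI[of _ _ None]) (auto simp: critical_set_def)
  next
    case (Some z)
    have "poly (hp (wronskian p q)) z = 0" using y Some by (simp add: conj.critical_Some_iff hp_wronskian polyK_pq)
    then obtain c where "poly (wronskian p q) c = 0" "z = \<sigma> c"
      using hp_root[OF polyK_wronskian[OF polyK_pq] wronskian_nonzero critical_K] by blast
    then show ?thesis using Some critical_K[of c]
      by (intro image_eqI[of _ _ "Some c"]) (auto simp: critical_set_def critical_Some_iff)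
  qed
qed

text \<open>Besides finiteness this shows, by injectivity of \<open>\<sigma>\<close> on
  \<open>K\<close>, that a periodic point outside \<open>P\<close> is sent outside the new
  postcritical set, so that the multiplier bound applies to its image.\<close>

lemma conj_postcritical_set: "postcritical_set g \<subseteq> \<iota> ` (P \<inter> pts)"
proof
  fix y assume "y \<in> postcritical_set g"
  then obtain n c where n: "n \<ge> 1" "c \<in> critical_set g" "y = (g ^^ n) c" by (auto simp: postcritical_set_def)
  then obtain c' where c': "c' \<in> critical_set f" "c' \<in> pts" "c = \<iota> c'" using conj_critical_set by blast
  have "(f ^^ n) c' \<in> P" using n(1) c'(1) by (auto simp: postcritical_set_def)
  then show "y \<in> \<iota> ` (P \<inter> pts)" using conj_funpow[OF c'(2), of n] n(3) c'(3) by auto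
qed

sublocale conj: pcf "hp p" "hp q" D
proof
  show "finite (postcritical_set g)"
    using conj_postcritical_set finite_postcritical by (meson finite_Int finite_imageI finite_subset)
qed (rule D2)

lemma conj_periodic_multiplier:
  assumes x: "x \<in> pts" "x \<notin> P" and per: "(f ^^ m) x = x" and m: "m \<ge> 1"
  shows "norm (\<sigma> (sphere_deriv (f ^^ m) x)) \<ge> 1"
proof -
  have "\<iota> x \<notin> postcritical_set g"
  proof
    assume "\<iota> x \<in> postcritical_set g"
    then obtain y where "y \<in> P" "y \<in> pts" "\<iota> x = \<iota> y" using conj_postcritical_set by blast
    then show False using inj_onD[OF inj_on_pts, of x y] x by blast
  qed
  moreover have "(g ^^ m) (\<iota> x) = \<iota> x" using conj_funpow[OF x(1), of m] per by simp
  ultimately have "norm (sphere_deriv (g ^^ m) (\<iota> x)) \<ge> 1" using conj.periodic_multiplier_bound m by blast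
  also have "sphere_deriv (g ^^ m) (\<iota> x) = (\<Prod>i<m. \<sigma> (sphere_deriv f ((f ^^ i) x)))"
    unfolding sphere_deriv_funpow[OF conj.sph_holo_f] using conj_funpow[OF x(1)] conj_values(4) by simp
  also have "\<dots> = \<sigma> (sphere_deriv (f ^^ m) x)"
    unfolding sphere_deriv_funpow[OF sph_holo_f]
    using conj_funpow[OF x(1)] conj_values(3) by (intro conjunct2[OF prod_K, symmetric]) blast
  finally show ?thesis .
qed

end

text \<open>The assignment of \<open>d\<close> to \<open>c\<close> is extended to everything the
  dynamics involves. The image of the multiplier is then \<open>1 / d ^ m\<close>, a multiplier of
  the conjugate map, and has modulus at least 1.\<close>

lemma (in pcf) conjugate_eigenvalue_bound:
  assumes x: "x \<notin> P" "(f ^^ m) x = x" "m \<ge> 1" and mult: "sphere_deriv (f ^^ m) x = 1 / c ^ m"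
    and c: "c \<noteq> 0" and d: "fhom.compat \<rat> id c d"
  shows "norm d \<le> 1"
proof -
  interpret Q: fhom \<rat> id by (rule fhom_Rats)
  obtain K1 \<sigma>1 where 1: "fhom K1 \<sigma>1" "insert c \<rat> \<subseteq> K1" "\<sigma>1 c = d"
    using Q.extend_by_one[OF d] by blast
  obtain u w where uw: "u * p + w * q = 1"
    using bezout_coefficients_fst_snd[of p q] cop by (auto simp: coprime_iff_gcd_eq_1)
  let ?C = "\<lambda>r. coeff r ` {..degree r}"
  \<comment> \<open>Coefficients of the map and of the Bezout cofactors, the finite critical points,
    and the coordinate of \<open>x\<close>.\<close>
  let ?A = "?C p \<union> ?C q \<union> ?C u \<union> ?C w \<union> {z. poly (wronskian p q) z = 0} \<union> set_option x"
  have "finite ?A" using poly_roots_finite[OF wronskian_nonzero] by simp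
  then obtain K \<sigma> where 2: "fhom K \<sigma>" "K1 \<union> ?A \<subseteq> K" "\<forall>x\<in>K1. \<sigma> x = \<sigma>1 x"
    using fhom_extend[OF _ 1(1)] by meson
  interpret fhom K \<sigma> by (rule 2(1))
  interpret conjugate_pcf p q D K \<sigma> u w
    using 2(2) uw by unfold_locales (auto intro!: polyKI)
  have cK: "c \<in> K" "\<sigma> c = d" using 1 2 by auto
  have "x \<in> pts" using 2(2) by (auto simp: pts_def)
  then have "1 \<le> norm (\<sigma> (1 / c ^ m))" using conj_periodic_multiplier[of x m] x mult by simp
  also have "\<sigma> (1 / c ^ m) = 1 / d ^ m" using cK by (simp add: hom_divide one_K power_K hom_power)
  finally have *: "1 \<le> 1 / norm d ^ m" by (simp add: norm_divide norm_power)
  show ?thesis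
  proof (rule ccontr)
    assume "\<not> norm d \<le> 1"
    then have "norm d ^ m > 1" using x(3) by (intro one_less_power) auto
    then show False using * by (simp add: field_simps)
  qed
qed

section \<open>Kronecker's theorem\<close>

text \<open>Lagrange interpolation: \<open>r\<close> is the combination of the basis polynomials
  \<open>L z\<close> with coefficients \<open>poly r z\<close>, so the bound is the sum of the
  moduli of their \<open>i\<close>-th coefficients.\<close>

lemma lagrange_coeff_bound:
  fixes Z :: "complex set"
  assumes "finite Z"
  shows "\<exists>B. \<forall>r. degree r < card Z \<longrightarrow> (\<forall>z\<in>Z. norm (poly r z) \<le> 1) \<longrightarrow> norm (coeff r i) \<le> B"
proof -
  define L where "L z = (\<Prod>w\<in>Z - {z}. smult (1 / (z - w)) [:- w, 1:])" for z
  have val: "poly (L z) y = (\<Prod>w\<in>Z - {z}. (y - w) / (z - w))" for z y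
    unfolding L_def poly_prod by (intro prod.cong refl) (simp add: diff_divide_distrib)
  have L: "poly (L z) z' = (if z' = z then 1 else 0)" if "z \<in> Z" "z' \<in> Z" for z z'
  proof (cases "z' = z")
    case True
    have "(\<Prod>w\<in>Z - {z}. (z - w) / (z - w)) = 1" by (intro prod.neutral ballI) auto
    then show ?thesis unfolding val True by simp
  next
    case False
    have "finite (Z - {z})" "z' \<in> Z - {z}" "(z' - z') / (z - z') = 0" using assms that(2) False by simp_all
    then have "(\<Prod>w\<in>Z - {z}. (z' - w) / (z - w)) = 0" by (intro prod_zero bexI[of _ z'])
    then show ?thesis using False by (simp only: val if_False)
  qed
  have dL: "degree (L z) < card Z" if "z \<in> Z" for z
  proof -
    have "degree (L z) \<le> (\<Sum>w\<in>Z - {z}. degree (smult (1 / (z - w)) [:- w, 1:]))"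
      unfolding L_def using degree_prod_sum_le[of "Z - {z}" "\<lambda>w. smult (1 / (z - w)) [:- w, 1:]"] assms
      unfolding o_def by blast
    also have "\<dots> \<le> (\<Sum>w\<in>Z - {z}. 1)" by (rule sum_mono, rule order_trans[OF degree_smult_le]) simp
    also have "\<dots> = card (Z - {z})" by simp
    also have "\<dots> < card Z" using that assms by (intro psubset_card_mono) auto
    finally show ?thesis .
  qed
  show ?thesis
  proof (intro exI[of _ "\<Sum>z\<in>Z. norm (coeff (L z) i)"] allI impI)
    fix r assume r: "degree r < card Z" "\<forall>z\<in>Z. norm (poly r z) \<le> 1"
    have "r = (\<Sum>z\<in>Z. smult (poly r z) (L z))"
    proof (rule poly_eqI_degree)
      show "poly r x = poly (\<Sum>z\<in>Z. smult (poly r z) (L z)) x" if "x \<in> Z" for x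
      proof -
        have "poly (\<Sum>z\<in>Z. smult (poly r z) (L z)) x = (\<Sum>z\<in>Z. if x = z then poly r z else 0)"
          unfolding poly_sum using L that by (intro sum.cong refl) simp
        then show ?thesis using assms that by simp
      qed
      show "degree (\<Sum>z\<in>Z. smult (poly r z) (L z)) < card Z"
      proof (rule degree_sum_less)
        show "degree (smult (poly r z) (L z)) < card Z" if "z \<in> Z" for z
          using dL[OF that] by (rule le_less_trans[OF degree_smult_le])
      qed (use r(1) in simp)
    qed (rule r)
    then have "coeff r i = coeff (\<Sum>z\<in>Z. smult (poly r z) (L z)) i" by (rule arg_cong)
    also have "\<dots> = (\<Sum>z\<in>Z. poly r z * coeff (L z) i)" by (simp add: coeff_sum)
    also have "norm \<dots> \<le> (\<Sum>z\<in>Z. norm (coeff (L z) i))"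
    proof (rule sum_norm_le)
      fix z assume "z \<in> Z"
      then have "norm (poly r z) * norm (coeff (L z) i) \<le> 1 * norm (coeff (L z) i)"
        using r(2) by (intro mult_right_mono) auto
      then show "norm (poly r z * coeff (L z) i) \<le> norm (coeff (L z) i)" by (simp add: norm_mult)
    qed
    finally show "norm (coeff r i) \<le> (\<Sum>z\<in>Z. norm (coeff (L z) i))" .
  qed
qed

lemma common_denominator:
  assumes "finite S" "S \<subseteq> (\<rat> :: complex set)"
  shows "\<exists>N::nat. N \<ge> 1 \<and> (\<forall>s\<in>S. of_nat N * s \<in> \<int>)"
  using assms
proof (induction S rule: finite_induct)
  case (insert s S)
  then obtain N :: nat where N: "N \<ge> 1" "\<forall>s\<in>S. of_nat N * s \<in> \<int>" by auto
  have "s \<in> \<rat>" using insert.prems by simp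
  then obtain a b :: int where ab: "b > 0" "s = of_int a / of_int b" by (rule Rats_cases') auto
  have b: "of_nat (nat b) = (of_int b :: complex)" using ab(1) by simp
  have "of_nat (N * nat b) * x \<in> \<int>" if "x \<in> insert s S" for x
  proof (cases "x = s")
    case True
    have "of_int b * s = of_int a" unfolding ab(2) using ab(1) by simp
    then have 1: "of_nat (N * nat b) * x = of_nat N * of_int a"
      unfolding True of_nat_mult b by (simp only: mult.assoc)
    show ?thesis unfolding 1 by simp
  next
    case False
    have 1: "of_nat (N * nat b) * x = of_int b * (of_nat N * x)" unfolding of_nat_mult b by simp
    have "of_nat N * x \<in> \<int>" using False that N(2) by blast
    then show ?thesis unfolding 1 by simp
  qed
  moreover have "N * nat b \<ge> 1" using N(1) ab(1) by simp
  ultimately show ?case by blast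
qed auto

text \<open>Reduction by the recursion that \<open>p\<close> imposes on its roots. The integers
  \<open>a\<close> do not depend on the root, so one polynomial represents the power at all roots
  simultaneously.\<close>

lemma power_mod_monic:
  fixes p :: "complex poly"
  assumes p: "lead_coeff p = 1" "\<And>i. coeff p i \<in> \<int>" and d: "degree p = Suc d"
  shows "\<exists>a::nat \<Rightarrow> int. \<forall>z. poly p z = 0 \<longrightarrow> z ^ k = (\<Sum>j<Suc d. of_int (a j) * z ^ j)"
proof (induction k)
  case 0
  have "(\<Sum>j<Suc d. of_int (if j = 0 then 1 else 0) * z ^ j) = 1" for z :: complex
    by (subst sum.lessThan_Suc_shift) simp
  then show ?case by (intro exI[of _ "\<lambda>j. if j = 0 then 1 else 0"]) simp
next
  case (Suc k)
  then obtain a :: "nat \<Rightarrow> int" where a: "\<And>z. poly p z = 0 \<Longrightarrow> z ^ k = (\<Sum>j<Suc d. of_int (a j) * z ^ j)" by blast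
  have "\<forall>i. \<exists>m. coeff p i = of_int m" using p(2) by (metis Ints_cases)
  then obtain b where b: "\<And>i. coeff p i = of_int (b i)" by metis
  show ?case
  proof (intro exI[of _ "\<lambda>j. (if j = 0 then 0 else a (j - 1)) - a d * b j"] allI impI)
    fix z assume z: "poly p z = 0"
    have "(\<Sum>j<Suc d. of_int (b j) * z ^ j) + z ^ Suc d = poly p z"
      unfolding poly_altdef d lessThan_Suc_atMost[symmetric]
      using p(1) by (subst sum.lessThan_Suc[of _ "Suc d"]) (simp add: b d del: power_Suc sum.lessThan_Suc)
    then have zd: "z ^ Suc d = - (\<Sum>j<Suc d. of_int (b j) * z ^ j)"
      unfolding z by (simp only: eq_neg_iff_add_eq_0 add.commute)
    have "z ^ Suc k = (\<Sum>j<Suc d. of_int (a j) * z ^ Suc j)"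
      unfolding power_Suc[of z k] a[OF z] sum_distrib_left by (simp add: algebra_simps)
    also have "\<dots> = (\<Sum>j<d. of_int (a j) * z ^ Suc j) + of_int (a d) * z ^ Suc d" by simp
    also have "(\<Sum>j<d. of_int (a j) * z ^ Suc j) = (\<Sum>j<Suc d. of_int (if j = 0 then 0 else a (j - 1)) * z ^ j)"
      by (subst sum.lessThan_Suc_shift) simp
    also have "\<dots> + of_int (a d) * z ^ Suc d
        = (\<Sum>j<Suc d. of_int ((if j = 0 then 0 else a (j - 1)) - a d * b j) * z ^ j)"
      unfolding zd sum_distrib_left mult_minus_right diff_conv_add_uminus[symmetric] sum_subtractf[symmetric]
      by (intro sum.cong refl) (simp add: algebra_simps)
    finally show "z ^ Suc k = (\<Sum>j<Suc d. of_int ((if j = 0 then 0 else a (j - 1)) - a d * b j) * z ^ j)" .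
  qed
qed

text \<open>Since \<open>c\<close> is integral, the powers of \<open>c\<close> lie in a finitely generated group of polynomials in
  \<open>c\<close> with rational coefficients. By interpolation at the conjugates of \<open>c\<close>, only finitely many of
  them have all conjugates in the unit disc.\<close>

lemma kronecker:
  assumes alg: "algebraic_int c" and c0: "c \<noteq> 0"
    and conj: "\<And>d. fhom.compat \<rat> id c d \<Longrightarrow> norm d \<le> 1"
  shows "\<exists>k\<ge>1. c ^ k = 1"
proof -
  interpret Q: fhom \<rat> id by (rule fhom_Rats)
  have hp: "map_poly id r = r" for r :: "complex poly" by (simp add: map_poly_id)
  obtain p where p: "lead_coeff p = 1" "\<forall>i. coeff p i \<in> \<int>" "poly p c = 0"
    using alg by (cases rule: algebraic_int.cases) blast
  have pQ: "Q.polyK p" using p(2) Ints_subset_Rats by (auto simp: Q.polyK_def)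
  have p0: "p \<noteq> 0" using p(1) by auto
  have nonconst: "degree r \<noteq> 0" if "lead_coeff r = 1" "poly r c = 0" for r
  proof
    assume "degree r = 0"
    then obtain x where "r = [:x:]" by (rule degree_eq_zeroE)
    then show False using that by simp
  qed
  obtain d where d: "degree p = Suc d" using nonconst[OF p(1,3)] not0_implies_Suc by blast
  obtain g where g: "Q.polyK g" "lead_coeff g = 1" "poly g c = 0"
    and compat: "\<And>d. poly g d = 0 \<Longrightarrow> Q.compat c d"
    and minimal: "\<And>r. Q.polyK r \<Longrightarrow> r \<noteq> 0 \<Longrightarrow> poly r c = 0 \<Longrightarrow> degree g \<le> degree r"
    using Q.minimal_polynomial[OF pQ p0 p(3)] unfolding hp by metis
  define Z where "Z = {z. poly g z = 0}"
  have g0: "g \<noteq> 0" using g(2) by auto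
  have dg: "degree g \<noteq> 0" by (rule nonconst[OF g(2,3)])
  have finZ: "finite Z" unfolding Z_def by (rule poly_roots_finite[OF g0])
  have cZ: "c \<in> Z" using g(3) by (simp add: Z_def)
  have normZ: "norm z \<le> 1" and pZ: "poly p z = 0" if "z \<in> Z" for z
    using conj compat[of z] that p(3) pQ unfolding Z_def Q.compat_def hp by auto
  \<comment> \<open>A double root is a conjugate of \<open>c\<close>, so the derivative of
    \<open>g\<close> would vanish at \<open>c\<close> too, against minimality. Hence
    \<open>g\<close> has as many roots as its degree, enough for interpolation.\<close>
  have "rsquarefree g"
    unfolding rsquarefree_roots
  proof (intro allI notI)
    fix z assume z: "poly g z = 0 \<and> poly (pderiv g) z = 0"
    have "poly (pderiv g) c = 0"
      using compat[of z] z Q.polyK_pderiv[OF g(1)] unfolding Q.compat_def hp by blast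
    moreover have "pderiv g \<noteq> 0" using dg by (simp add: pderiv_eq_0_iff)
    ultimately have "degree g \<le> degree (pderiv g)" using minimal[OF Q.polyK_pderiv[OF g(1)]] by blast
    then show False using dg by (simp add: degree_pderiv)
  qed
  then have "g = (\<Prod>z\<in>Z. [:- z, 1:])"
    using complex_poly_decompose_rsquarefree[of g] g(2) by (simp add: Z_def)
  then have cardZ: "card Z = degree g" using finZ by (simp add: degree_prod_eq_sum_degree)
  \<comment> \<open>The remainder of the \<open>j\<close>-th power modulo \<open>g\<close>. The
    integral polynomial \<open>p\<close> supplies integer combinations of finitely many powers, and
    \<open>g\<close> supplies the conjugates and the degree bound; a common denominator
    \<open>N\<close> of these remainders links the two.\<close>
  have "\<exists>r. Q.polyK r \<and> degree r < card Z \<and> (\<forall>z\<in>Z. poly r z = z ^ j)" for j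
  proof -
    obtain s t where st: "Q.polyK t" "monom 1 j = g * s + t" "t = 0 \<or> degree t < degree g"
      using Q.monic_division[OF g(1,2) Q.polyK_monom[OF Q.one_K, of j]] by blast
    have "poly t z = z ^ j" if "z \<in> Z" for z
    proof -
      have "poly (monom 1 j) z = poly (g * s + t) z" by (simp only: st(2))
      then show ?thesis using that by (simp add: Z_def poly_monom)
    qed
    moreover have "degree t < card Z" using st(3) dg cardZ by auto
    ultimately show ?thesis using st(1) by blast
  qed
  then obtain R where R: "\<And>j. Q.polyK (R j)" "\<And>j. degree (R j) < card Z" "\<And>j z. z \<in> Z \<Longrightarrow> poly (R j) z = z ^ j"
    by metis
  define n where "n = card Z"
  let ?S = "(\<lambda>(j, i). coeff (R j) i) ` ({..<Suc d} \<times> {..<n})"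
  have "?S \<subseteq> \<rat>" using R(1) unfolding Q.polyK_def by auto
  then obtain N :: nat where N: "N \<ge> 1" "\<forall>s\<in>?S. of_nat N * s \<in> \<int>"
    using common_denominator[of ?S] by auto
  have NR: "of_nat N * coeff (R j) i \<in> \<int>" if "j < Suc d" "i < n" for j i
    using N(2) that by (auto simp del: of_nat_Suc)
  have "\<forall>k. \<exists>a::nat \<Rightarrow> int. \<forall>z. poly p z = 0 \<longrightarrow> z ^ k = (\<Sum>j<Suc d. of_int (a j) * z ^ j)"
    using power_mod_monic[OF p(1) _ d] p(2) by blast
  then obtain a :: "nat \<Rightarrow> nat \<Rightarrow> int" where
    a: "\<And>k z. poly p z = 0 \<Longrightarrow> z ^ k = (\<Sum>j<Suc d. of_int (a k j) * z ^ j)" by metis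
  define r where "r k = (\<Sum>j<Suc d. smult (of_int (a k j)) (R j))" for k
  have dr: "degree (r k) < card Z" for k
    unfolding r_def
  proof (rule degree_sum_less)
    show "degree (smult (of_int (a k j)) (R j)) < card Z" for j
      using R(2)[of j] by (rule le_less_trans[OF degree_smult_le])
    show "0 < card Z" using R(2)[of 0] by simp
  qed
  have rZ: "poly (r k) z = z ^ k" if "z \<in> Z" for k z
    unfolding a[OF pZ[OF that], of k] r_def poly_sum using R(3)[OF that] by (intro sum.cong refl) simp
  have int: "of_nat N * coeff (r k) i \<in> \<int>" if "i < n" for k i
  proof -
    have 1: "of_nat N * coeff (r k) i = (\<Sum>j<Suc d. of_int (a k j) * (of_nat N * coeff (R j) i))"
      unfolding r_def coeff_sum sum_distrib_left by (intro sum.cong refl) simp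
    show ?thesis unfolding 1 by (intro Ints_sum Ints_mult Ints_of_int NR[OF _ that]) simp
  qed
  have "\<exists>B. \<forall>k. norm (coeff (r k) i) \<le> B" for i
  proof -
    obtain B where B: "\<And>r. degree r < card Z \<Longrightarrow> \<forall>z\<in>Z. norm (poly r z) \<le> 1 \<Longrightarrow> norm (coeff r i) \<le> B"
      using lagrange_coeff_bound[OF finZ, of i] by metis
    have "\<forall>z\<in>Z. norm (poly (r k) z) \<le> 1" for k
    proof
      fix z assume "z \<in> Z"
      then show "norm (poly (r k) z) \<le> 1" using normZ by (simp add: rZ norm_power power_le_one)
    qed
    then have "\<forall>k. norm (coeff (r k) i) \<le> B" using B[OF dr] by blast
    then show ?thesis by (rule exI)
  qed
  then obtain B where B: "\<And>i k. norm (coeff (r k) i) \<le> B i" by metis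
  define T where "T i = {x \<in> \<int>. norm (x::complex) \<le> real N * B i}" for i
  have finT: "finite (T i)" for i
  proof -
    have "T i \<subseteq> of_int ` {- \<lceil>real N * B i\<rceil>..\<lceil>real N * B i\<rceil>}"
    proof
      fix x assume "x \<in> T i"
      then obtain m where m: "x = of_int m" "\<bar>real_of_int m\<bar> \<le> real N * B i" by (auto simp: T_def elim!: Ints_cases)
      then have "m \<in> {- \<lceil>real N * B i\<rceil>..\<lceil>real N * B i\<rceil>}" by (simp; linarith)
      then show "x \<in> of_int ` {- \<lceil>real N * B i\<rceil>..\<lceil>real N * B i\<rceil>}" using m(1) by blast
    qed
    then show ?thesis using finite_subset by blast
  qed
  \<comment> \<open>The coefficients of \<open>N\<close> times \<open>r k\<close> are integers with
    bounds independent of \<open>k\<close>, so \<open>h\<close> takes finitely many values. A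
    repetition makes two of the polynomials \<open>r k\<close> equal, and hence two powers of
    \<open>c\<close>.\<close>
  define h where "h k = (\<lambda>i\<in>{..<n}. of_nat N * coeff (r k) i)" for k
  have "h k \<in> PiE {..<n} T" for k
    unfolding h_def T_def using int B by (intro restrict_PiE_iff[THEN iffD2]) (auto simp: norm_mult mult_left_mono)
  then have "range h \<subseteq> PiE {..<n} T" by blast
  then have "finite (range h)" using finite_subset[OF _ finite_PiE[of "{..<n}" T]] finT by blast
  then have "\<not> inj h" using finite_imageD infinite_UNIV_nat by blast
  then obtain k l where "h k = h l" "k \<noteq> l" unfolding inj_def by blast
  then obtain k l where kl: "h k = h l" "k < l" by (metis linorder_neq_iff)
  have "r k = r l"
  proof (rule poly_eqI)
    fix i
    show "coeff (r k) i = coeff (r l) i"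
    proof (cases "i < n")
      case True
      have "h k i = h l i" by (simp only: kl(1))
      then show ?thesis using True N(1) by (simp add: h_def)
    next
      case False
      then show ?thesis using dr[of k] dr[of l] by (simp add: coeff_eq_0 n_def)
    qed
  qed
  then have "c ^ k = c ^ l" using rZ[OF cZ] by metis
  also have "\<dots> = c ^ k * c ^ (l - k)" using kl(2) by (simp flip: power_add)
  finally have "c ^ (l - k) = 1" using c0 by simp
  then show ?thesis using kl(2) by (intro exI[of _ "l - k"]) simp
qed

section \<open>The spectrum\<close>

lemma (in pcf) eigenvalue_algebraic:
  assumes "c \<in> quot_eigenvalues f" "c \<noteq> 0"
  shows "algebraic c \<and> \<not> algebraic_int c"
proof -
  obtain m C where m: "m \<ge> 1" "is_cycle f m C" "\<not> C \<subseteq> P" "is_multiplier f m C (1 / c ^ m)"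
    using eigenvalue_imp_cycle[OF assms] by blast
  obtain x where x: "(f ^^ m) x = x" "C = (\<lambda>i. (f ^^ i) x) ` {..<m}" using m(2) unfolding is_cycle_def by blast
  have "(f ^^ 0) x \<in> C" unfolding x(2) using m(1) by (intro imageI) simp
  then have xC: "x \<in> C" by simp
  then have xP: "x \<notin> P" using cycle_disjoint_P[OF m(2,3)] by blast
  have mult: "sphere_deriv (f ^^ m) x = 1 / c ^ m" using m(4) xC unfolding is_multiplier_def by blast
  interpret Q: fhom \<rat> id by (rule fhom_Rats)
  have bound: "norm d \<le> 1" if "Q.compat c d" for d
    by (rule conjugate_eigenvalue_bound[OF xP x(1) m(1) mult assms(2) that])
  have "algebraic c"
  proof (rule ccontr)
    assume "\<not> algebraic c"
    then have 1: "r = 0" if "Q.polyK r" "poly r c = 0" for r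
      using that unfolding algebraic_altdef Q.polyK_def by blast
    obtain d where "norm d > 1" "Q.compat c d" using Q.transcendental_compat[OF 1] by blast
    then show False using bound[of d] by simp
  qed
  moreover have "\<not> algebraic_int c"
  proof
    assume "algebraic_int c"
    then obtain k where k: "k \<ge> 1" "c ^ k = 1" using kronecker[OF _ assms(2) bound] by blast
    have "((f ^^ m) ^^ i) x = x" for i by (induction i) (simp_all add: x(1))
    then have "sphere_deriv ((f ^^ m) ^^ k) x = (1 / c ^ m) ^ k"
      unfolding sphere_deriv_funpow[OF sph_holo_funpow[OF sph_holo_f]] by (simp add: mult)
    also have "\<dots> = 1 / (c ^ k) ^ m" by (simp add: power_one_over mult.commute flip: power_mult)
    finally have "sphere_deriv (f ^^ (m * k)) x = 1" by (simp add: k(2) funpow_mult)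
    moreover have "(f ^^ (m * k)) x = x"
      using \<open>\<And>i. ((f ^^ m) ^^ i) x = x\<close>[of k] by (simp add: funpow_mult)
    ultimately show False using periodic_multiplier_bound[OF xP, of "m * k"] m(1) k(1) by simp
  qed
  ultimately show ?thesis by blast
qed

theorem theorem1:
  fixes D :: nat and f :: "sphere \<Rightarrow> sphere"
  assumes "D \<ge> 2"
    and "rational_map D f"
    and "postcritically_finite f"
  shows "quot_eigenvalues f =
      insert 0 {c. c \<noteq> 0 \<and>
        (\<exists>m\<ge>1. \<exists>C. is_cycle f m C \<and> \<not> C \<subseteq> postcritical_set f \<and>
          is_multiplier f m C (1 / c ^ m))}
    \<and> (\<forall>c \<in> quot_eigenvalues f - {0}. algebraic c \<and> \<not> algebraic_int c)"
proof -
  obtain p q where pq: "rational p q D" and f: "f = rat_map p q"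
    using rational_mapE[OF assms(2)] assms(1) by auto
  interpret rational p q D by (rule pq)
  interpret pcf p q D
  proof
    show "finite (postcritical_set (rat_map p q))" using assms(3) unfolding f postcritically_finite_def .
  qed (rule assms(1))
  have "c \<in> quot_eigenvalues (rat_map p q)"
    if *: "c \<noteq> 0" "is_cycle (rat_map p q) m C" "\<not> C \<subseteq> P" "is_multiplier (rat_map p q) m C (1 / c ^ m)" for c m C
  proof -
    have "card P \<ge> 3 \<or> card P = 2 \<and> two_cycles c"
    proof (cases "card P = 2")
      case True
      then obtain u v \<gamma> K where "two_point_pcf p q D u v \<gamma> K" using card_P_2 by blast
      then show ?thesis using two_point_pcf.two_cycles[OF _ that(2-4)] True by blast
    next
      case False
      then show ?thesis using card_P_ge_2 by linarith
    qed
    then show ?thesis by (rule cycle_imp_eigenvalue[OF that(2-4,1)])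
  qed
  then have "quot_eigenvalues f =
      insert 0 {c. c \<noteq> 0 \<and>
        (\<exists>m\<ge>1. \<exists>C. is_cycle f m C \<and> \<not> C \<subseteq> postcritical_set f \<and> is_multiplier f m C (1 / c ^ m))}"
    unfolding f using zero_eigenvalue[OF card_P_ge_2]
  proof (intro set_eqI iffI)
    fix c assume "c \<in> quot_eigenvalues (rat_map p q)"
    then show "c \<in> insert 0 {c. c \<noteq> 0 \<and>
        (\<exists>m\<ge>1. \<exists>C. is_cycle (rat_map p q) m C \<and> \<not> C \<subseteq> P \<and> is_multiplier (rat_map p q) m C (1 / c ^ m))}"
      using eigenvalue_imp_cycle[of c] by (cases "c = 0") simp_all
  qed (elim insertE CollectE conjE exE; simp)
  moreover have "\<forall>c \<in> quot_eigenvalues f - {0}. algebraic c \<and> \<not> algebraic_int c"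
    unfolding f using eigenvalue_algebraic by blast
  ultimately show ?thesis by (rule conjI)
qed

end
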